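(* Let $(\eta_{ab},\rho_a{}^\mu,C_{abc})$ be local structure data of an (untwisted) Courant algebroid. The AKSZ-BV master action for the Courant sigma model on a closed 3-manifold $\Sigma$ can be expressed (up to differences in conventions and notation) as $$S_{\rm BV,0}=S_{\rm cl}\big|_{H=0}+\sum_{n=1}^{3}\frac{(-1)^{\mathrm{gh}\,\varphi+n}}{\beta_\dagger!\,\beta_n}\,\varphi^\dagger\cdot\mathcal O_{(n)}\varphi\big|_{H=0},$$ where $S_{\rm cl}|_{H=0}$ is the classical action, $\varphi$ runs over the fields $X^\mu,A^a,B_\mu$, the ghosts $\epsilon^a,\psi_\mu$ and the ghost for ghost $\widetilde\psi_\mu$ (integration over $\Sigma$ understood), the expressions $\mathcal O_{(n)}\varphi|_{H=0}$ are those given in the context, $\beta_\dagger$ counts the number of antifields of the same kind in any of the terms in the sum, and the symmetry factor $\beta_n$ counts the terms that appear more than once for fixed $n$.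
   Context: **Structure data.** On a coordinate patch of a smooth manifold $M$ with coordinates $x^\mu$, let $\eta_{ab}$ be a constant nondegenerate symmetric matrix (inverse $\eta^{ab}$, used to raise and lower Latin indices, $C_{abc}=\eta_{cd}C^d_{ab}$), $\rho_a{}^\mu(x)$ smooth functions and $C_{abc}(x)$ smooth totally antisymmetric functions. They are local data of a Courant algebroid if (i) $\eta^{ab}\rho_a{}^\mu\rho_b{}^\nu=0$; (ii) $\rho_b{}^\mu\partial_\mu\rho_a{}^\nu-\rho_a{}^\mu\partial_\mu\rho_b{}^\nu+\eta^{ef}\rho_e{}^\nu C_{fab}=0$; (iii) $\rho_d{}^\mu\partial_\mu C_{abc}-\rho_a{}^\mu\partial_\mu C_{bcd}+\rho_b{}^\mu\partial_\mu C_{cda}-\rho_c{}^\mu\partial_\mu C_{dab}+\eta^{ef}(C_{eab}C_{cdf}+C_{eac}C_{dbf}+C_{ead}C_{bcf})=0$. **Model.** Fields: a map $X:\Sigma\to M$ with components $X^\mu$, 1-forms $A^a$, 2-forms $B_\mu$; structure functions are evaluated at $X$; wedge products suppressed. The classical action is $$S_{\rm cl}\big|_{H=0}=\int_\Sigma\Big(-B_\mu\mathrm dX^\mu+\tfrac12\eta_{ab}A^a\mathrm dA^b+\rho_a{}^\mu B_\mu A^a+\tfrac1{3!}C_{abc}A^aA^bA^c\Big).$$ Put $F^\mu=\mathrm dX^\mu-\rho_a{}^\mu A^a$, $G^a=\mathrm dA^a+\eta^{ab}\rho_b{}^\mu B_\mu+\frac12C^a_{bc}A^bA^c$. **Ghosts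 and antifields** as (ghost degree, form degree): $X(0,0)$, $A(0,1)$, $B(0,2)$, $\epsilon^a(1,0)$, $\psi_\mu(1,1)$, $\widetilde\psi_\mu(2,0)$; antifields $X^\dagger_\mu(-1,3)$, $A^\dagger_a(-1,2)$, $B^{\dagger\mu}(-1,1)$, $\epsilon^\dagger_a(-2,3)$, $\psi^{\dagger\mu}(-2,2)$, $\widetilde\psi^{\dagger\mu}(-3,3)$. Signs: $\alpha_1\alpha_2=(-1)^{f_1f_2+g_1g_2}\alpha_2\alpha_1$ for form degrees $f_i$ and ghost degrees $g_i$. **AKSZ-BV action.** It is obtained from the classical action by replacing the fields by superfields on $T[1]\Sigma$ of total degree $0,1,2$ and extracting the 3-form part (Berezin integration): $$\int_{T[1]\Sigma}\Big(-\mathbf B_\mu\mathrm d\mathbf X^\mu+\tfrac12\eta_{ab}\mathbf A^a\mathrm d\mathbf A^b+\rho_a{}^\mu(\mathbf X)\mathbf B_\mu\mathbf A^a+\tfrac1{3!}C_{abc}(\mathbf X)\mathbf A^a\mathbf A^b\mathbf A^c\Big),$$ where, up to conventional signs of the component fields, $\mathbf X^\mu=X^\mu+B^{\dagger\mu}+\psi^{\dagger\mu}+\widetilde\psi^{\dagger\mu}$, $\mathbf A^a=\epsilon^a+A^a+\eta^{ab}A^\dagger_b+\eta^{ab}\epsilon^\dagger_b$, $\mathbf B_\mu=\widetilde\psi_\mu+\psi_\mu+B_\mu+X^\dagger_\mu$. **The operations $\mathcal O_{(n)}$ at $H=0$.** $\mathcal O_{(1)}\varphi=s_0\varphi$ is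 the on-shell closed BRST transformation: $s_0X^\mu=\rho_a{}^\mu\epsilon^a$; $s_0A^a=\mathrm d\epsilon^a+\eta^{ab}\rho_b{}^\mu\psi_\mu+C^a_{bc}A^b\epsilon^c$; $s_0B_\mu=-\mathrm d\psi_\mu-\partial_\mu\rho_a{}^\nu(B_\nu\epsilon^a-\psi_\nu A^a)-\frac12\partial_\mu C_{abc}A^aA^b\epsilon^c$; $s_0\epsilon^a=-\eta^{ab}(\rho_b{}^\mu\widetilde\psi_\mu+\frac12C_{bcd}\epsilon^c\epsilon^d)$; $s_0\psi_\mu=\mathrm d\widetilde\psi_\mu+\partial_\mu\rho_a{}^\nu(\widetilde\psi_\nu A^a+\psi_\nu\epsilon^a)+\frac12\partial_\mu C_{abc}A^a\epsilon^b\epsilon^c$; $s_0\widetilde\psi_\mu=-\partial_\mu\rho_a{}^\nu\widetilde\psi_\nu\epsilon^a-\frac16\partial_\mu C_{abc}\epsilon^a\epsilon^b\epsilon^c$. Let $\mathfrak f$ be the replacement of a field equation (moved to the left) by the corresponding antifield up to sign, $F^\mu\to B^{\dagger\mu}$, $G^a\to-\eta^{ab}A^\dagger_b$. Then $\mathcal O_{(2)}\varphi=\mathfrak f(s_0^2\varphi)$ and $\varphi^\dagger\mathcal O_{(3)}\varphi=\varphi^\dagger\mathfrak f(s_0(\mathfrak f(\mathcal O_{(2)}\varphi)))$ projected to ghost number zero ($s_0$ annihilates antifields). These vanish except for: $A^\dagger_a\mathcal O_{(2)}A^a=-\eta^{ab}A^\dagger_aB^{\dagger\mu}\big(\partial_\mu\rho_b{}^\nu\widetilde\psi_\nu+\frac12\partial_\mu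 C_{bcd}\epsilon^c\epsilon^d\big)$; $\psi^{\dagger\mu}\mathcal O_{(2)}\psi_\mu=-\psi^{\dagger\mu}B^{\dagger\lambda}\big(\partial_\mu\partial_\lambda\rho_a{}^\nu\widetilde\psi_\nu\epsilon^a+\frac16\partial_\mu\partial_\lambda C_{abc}\epsilon^a\epsilon^b\epsilon^c\big)$; $B^{\dagger\mu}\mathcal O_{(2)}B_\mu=-B^{\dagger\mu}B^{\dagger\lambda}\big(\partial_\mu\partial_\lambda\rho_a{}^\nu(\psi_\nu\epsilon^a+\widetilde\psi_\nu A^a)+\frac12\partial_\mu\partial_\lambda C_{abc}A^a\epsilon^b\epsilon^c\big)+\eta^{ad}B^{\dagger\mu}A^\dagger_d\big(\partial_\mu\rho_a{}^\nu\widetilde\psi_\nu+\frac12\partial_\mu C_{abc}\epsilon^b\epsilon^c\big)$; $B^{\dagger\mu}\mathcal O_{(3)}B_\mu=B^{\dagger\mu}B^{\dagger\lambda}B^{\dagger\sigma}\big(\partial_\mu\partial_\lambda\partial_\sigma\rho_a{}^\nu\widetilde\psi_\nu\epsilon^a+\frac16\partial_\mu\partial_\lambda\partial_\sigma C_{abc}\epsilon^a\epsilon^b\epsilon^c\big)$. The $A^\dagger B^\dagger$ term arises both from $A^\dagger\mathcal O_{(2)}A$ and from $B^\dagger\mathcal O_{(2)}B$, so it carries $\beta_2=2$ and appears in the action once as $-A^\dagger_aB^{\dagger\mu}\eta^{ab}(\partial_\mu\rho_b{}^\nu\widetilde\psi_\nu+\frac12\partial_\mu C_{bcd}\epsilon^c\epsilon^d)$;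 terms with two (three) factors $B^\dagger$ carry $\beta_\dagger!=2!$ ($3!$). *)

theory Defs
  imports "HOL-Analysis.Analysis" "HOL-Library.Multiset"
begin

section \<open>Local structure data of a Courant algebroid\<close>

definition pd :: "'m::finite \<Rightarrow> (real^'m \<Rightarrow> real) \<Rightarrow> real^'m \<Rightarrow> real" where
  "pd \<mu> f x = frechet_derivative f (at x) (axis \<mu> 1)"

fun pds :: "'m::finite list \<Rightarrow> (real^'m \<Rightarrow> real) \<Rightarrow> real^'m \<Rightarrow> real" where
  "pds [] f = f"
| "pds (\<mu> # l) f = pd \<mu> (pds l f)"

text \<open>On an open set this is the usual class of infinitely differentiable functions: all iterated
  partial derivatives exist and are (Frechet) differentiable, hence continuous.\<close>
definition smooth_fun :: "(real^'m::finite) set \<Rightarrow> (real^'m \<Rightarrow> real) \<Rightarrow> bool" where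
  "smooth_fun U f \<longleftrightarrow> (\<forall>l. pds l f differentiable_on U)"

text \<open>Greek indices range over the finite type \<open>'m\<close>, Latin indices over the finite type \<open>'a\<close>.
  \<open>anchor Q a \<mu>\<close> is \<open>\<rho>\<^sub>a\<^sup>\<mu>\<close> and \<open>flux Q a b c\<close> is \<open>C\<^sub>a\<^sub>b\<^sub>c\<close>.\<close>
datatype (plugins only:) ('m::finite, 'a::finite) courant_data = Courant_Data
  (patch: "(real^'m) set")
  (eta: "real^'a^'a")
  (anchor: "'a \<Rightarrow> 'm \<Rightarrow> real^'m \<Rightarrow> real")
  (flux: "'a \<Rightarrow> 'a \<Rightarrow> 'a \<Rightarrow> real^'m \<Rightarrow> real")

definition eta_inv :: "('m::finite, 'a::finite) courant_data \<Rightarrow> 'a \<Rightarrow> 'a \<Rightarrow> real" where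
  "eta_inv Q a b = matrix_inv (eta Q) $ a $ b"

definition flux_up :: "('m::finite, 'a::finite) courant_data \<Rightarrow> 'a \<Rightarrow> 'a \<Rightarrow> 'a \<Rightarrow> real^'m \<Rightarrow> real" where
  "flux_up Q a b c x = (\<Sum>e\<in>UNIV. eta_inv Q a e * flux Q e b c x)"

locale courant_algebroid_data =
  fixes Q :: "('m::finite, 'a::finite) courant_data"
  assumes open_patch: "open (patch Q)"
    and eta_sym: "transpose (eta Q) = eta Q"
    and eta_nondegenerate: "invertible (eta Q)"
    and anchor_smooth: "smooth_fun (patch Q) (anchor Q a \<mu>)"
    and flux_smooth: "smooth_fun (patch Q) (flux Q a b c)"
    and flux_antisym:
      "x \<in> patch Q \<Longrightarrow> flux Q b a c x = - flux Q a b c x"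
      "x \<in> patch Q \<Longrightarrow> flux Q a c b x = - flux Q a b c x"
    and axiom_i: "x \<in> patch Q \<Longrightarrow>
      (\<Sum>a\<in>UNIV. \<Sum>b\<in>UNIV. eta_inv Q a b * anchor Q a \<mu> x * anchor Q b \<nu> x) = 0"
    and axiom_ii: "x \<in> patch Q \<Longrightarrow>
      (\<Sum>\<mu>\<in>UNIV. anchor Q b \<mu> x * pd \<mu> (anchor Q a \<nu>) x)
      - (\<Sum>\<mu>\<in>UNIV. anchor Q a \<mu> x * pd \<mu> (anchor Q b \<nu>) x)
      + (\<Sum>e\<in>UNIV. \<Sum>f\<in>UNIV. eta_inv Q e f * anchor Q e \<nu> x * flux Q f a b x) = 0"
    and axiom_iii: "x \<in> patch Q \<Longrightarrow>
      (\<Sum>\<mu>\<in>UNIV. anchor Q d \<mu> x * pd \<mu> (flux Q a b c) x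
        - anchor Q a \<mu> x * pd \<mu> (flux Q b c d) x
        + anchor Q b \<mu> x * pd \<mu> (flux Q c d a) x
        - anchor Q c \<mu> x * pd \<mu> (flux Q d a b) x)
      + (\<Sum>e\<in>UNIV. \<Sum>f\<in>UNIV. eta_inv Q e f *
          (flux Q e a b x * flux Q c d f x + flux Q e a c x * flux Q d b f x
           + flux Q e a d x * flux Q b c f x)) = 0"


section \<open>Forms with ghost number on a closed 3-manifold\<close>

definition sg :: "int \<Rightarrow> real" where
  "sg k = (if even k then 1 else - 1)"

datatype (plugins only:) ('w, 'r) form_algebra = Form_Algebra
  (bideg: "int \<Rightarrow> nat \<Rightarrow> 'w set")
  (dif: "'w \<Rightarrow> 'w")
  (integral\<^sub>\<Sigma>: "'w \<Rightarrow> 'r")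

text \<open>The calculus of ghost-valued differential forms on a closed 3-manifold \<open>\<Sigma>\<close>.  \<open>bideg K g f\<close> is
  the space of elements of ghost degree \<open>g\<close> and form degree \<open>f\<close>.  The integral takes values in an
  arbitrary real vector space, since integrals of ghost-valued forms are not numbers; that \<open>\<Sigma>\<close>
  has dimension 3 and no boundary enters through \<open>dimension\<close> and \<open>stokes\<close>.  The de Rham complex of
  a closed oriented 3-manifold with coefficients in any ghost-graded commutative algebra (for
  instance, functionals of the fields) is an instance.\<close>
locale closed_3d_forms =
  fixes K :: "('w::real_algebra_1, 'r::real_vector) form_algebra"
  assumes bideg_subspace: "subspace (bideg K g f)"
    and one_bideg: "1 \<in> bideg K 0 0"
    and mult_bideg: "\<alpha> \<in> bideg K g f \<Longrightarrow> \<beta> \<in> bideg K g' f' \<Longrightarrow> \<alpha> * \<beta> \<in> bideg K (g + g') (f + f')"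
    and graded_comm: "\<alpha> \<in> bideg K g f \<Longrightarrow> \<beta> \<in> bideg K g' f' \<Longrightarrow>
      \<alpha> * \<beta> = sg (int f * int f' + g * g') *\<^sub>R (\<beta> * \<alpha>)"
    and dimension: "3 < f \<Longrightarrow> bideg K g f = {0}"
    and dif_linear: "linear (dif K)"
    and dif_bideg: "\<alpha> \<in> bideg K g f \<Longrightarrow> dif K \<alpha> \<in> bideg K g (Suc f)"
    and dif_dif: "\<alpha> \<in> bideg K g f \<Longrightarrow> dif K (dif K \<alpha>) = 0"
    and dif_mult: "\<alpha> \<in> bideg K g f \<Longrightarrow> \<beta> \<in> bideg K g' f' \<Longrightarrow>
      dif K (\<alpha> * \<beta>) = dif K \<alpha> * \<beta> + sg (int f) *\<^sub>R (\<alpha> * dif K \<beta>)"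
    and integral_linear: "linear (integral\<^sub>\<Sigma> K)"
    and stokes: "\<alpha> \<in> bideg K g 2 \<Longrightarrow> integral\<^sub>\<Sigma> K (dif K \<alpha>) = 0"


section \<open>Fields, ghosts and antifields\<close>

text \<open>The map \<open>X : \<Sigma> \<rightarrow> M\<close> is given by its pullback \<open>f \<mapsto> f(X)\<close> of functions on the coordinate patch;
  its components \<open>X\<^sup>\<mu>\<close> are the pullbacks of the coordinate functions.  A trailing \<open>d\<close> marks
  antifields.\<close>
datatype (plugins only:) ('m::finite, 'a::finite, 'w) bv_fields = BV_Fields
  (ev: "(real^'m \<Rightarrow> real) \<Rightarrow> 'w")
  (fA: "'a \<Rightarrow> 'w")
  (fB: "'m \<Rightarrow> 'w")
  (eps: "'a \<Rightarrow> 'w")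
  (psi: "'m \<Rightarrow> 'w")
  (tpsi: "'m \<Rightarrow> 'w")
  (Xd: "'m \<Rightarrow> 'w")
  (Ad: "'a \<Rightarrow> 'w")
  (Bd: "'m \<Rightarrow> 'w")
  (epsd: "'a \<Rightarrow> 'w")
  (psid: "'m \<Rightarrow> 'w")
  (tpsid: "'m \<Rightarrow> 'w")

definition fX :: "('m::finite, 'a::finite, 'w) bv_fields \<Rightarrow> 'm \<Rightarrow> 'w" where
  "fX \<Phi> \<mu> = ev \<Phi> (\<lambda>x. x $ \<mu>)"

locale bv_field_content = closed_3d_forms K
  for K :: "('w::real_algebra_1, 'r::real_vector) form_algebra" +
  fixes U :: "(real^'m::finite) set" and \<Phi> :: "('m, 'a::finite, 'w) bv_fields"
  assumes ev_bideg: "smooth_fun U f \<Longrightarrow> ev \<Phi> f \<in> bideg K 0 0"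
    and ev_cong: "(\<And>x. x \<in> U \<Longrightarrow> f x = g x) \<Longrightarrow> ev \<Phi> f = ev \<Phi> g"
    and ev_const: "ev \<Phi> (\<lambda>x. c) = of_real c"
    and ev_add: "smooth_fun U f \<Longrightarrow> smooth_fun U g \<Longrightarrow> ev \<Phi> (\<lambda>x. f x + g x) = ev \<Phi> f + ev \<Phi> g"
    and ev_mult: "smooth_fun U f \<Longrightarrow> smooth_fun U g \<Longrightarrow> ev \<Phi> (\<lambda>x. f x * g x) = ev \<Phi> f * ev \<Phi> g"
    and ev_dif: "smooth_fun U f \<Longrightarrow>
      dif K (ev \<Phi> f) = (\<Sum>\<mu>\<in>UNIV. ev \<Phi> (pd \<mu> f) * dif K (fX \<Phi> \<mu>))"
    and fields_bideg:
      "fA \<Phi> a \<in> bideg K 0 1" "fB \<Phi> \<mu> \<in> bideg K 0 2"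
      "eps \<Phi> a \<in> bideg K 1 0" "psi \<Phi> \<mu> \<in> bideg K 1 1" "tpsi \<Phi> \<mu> \<in> bideg K 2 0"
    and antifields_bideg:
      "Xd \<Phi> \<mu> \<in> bideg K (-1) 3" "Ad \<Phi> a \<in> bideg K (-1) 2" "Bd \<Phi> \<mu> \<in> bideg K (-1) 1"
      "epsd \<Phi> a \<in> bideg K (-2) 3" "psid \<Phi> \<mu> \<in> bideg K (-2) 2" "tpsid \<Phi> \<mu> \<in> bideg K (-3) 3"


section \<open>Classical action and field equations\<close>

definition classical_action ::
  "('m::finite, 'a::finite) courant_data \<Rightarrow> ('w::real_algebra_1, 'r::real_vector) form_algebra
    \<Rightarrow> ('m, 'a, 'w) bv_fields \<Rightarrow> 'r" where
  "classical_action Q K \<Phi> = integral\<^sub>\<Sigma> K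
    (- (\<Sum>\<mu>\<in>UNIV. fB \<Phi> \<mu> * dif K (fX \<Phi> \<mu>))
     + (1/2) *\<^sub>R (\<Sum>a\<in>UNIV. \<Sum>b\<in>UNIV. (eta Q $ a $ b) *\<^sub>R (fA \<Phi> a * dif K (fA \<Phi> b)))
     + (\<Sum>a\<in>UNIV. \<Sum>\<mu>\<in>UNIV. ev \<Phi> (anchor Q a \<mu>) * fB \<Phi> \<mu> * fA \<Phi> a)
     + (1 / fact 3) *\<^sub>R (\<Sum>a\<in>UNIV. \<Sum>b\<in>UNIV. \<Sum>c\<in>UNIV.
          ev \<Phi> (flux Q a b c) * fA \<Phi> a * fA \<Phi> b * fA \<Phi> c))"

definition eomF ::
  "('m::finite, 'a::finite) courant_data \<Rightarrow> ('w::real_algebra_1, 'r::real_vector) form_algebra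
    \<Rightarrow> ('m, 'a, 'w) bv_fields \<Rightarrow> 'm \<Rightarrow> 'w" where
  "eomF Q K \<Phi> \<mu> = dif K (fX \<Phi> \<mu>) - (\<Sum>a\<in>UNIV. ev \<Phi> (anchor Q a \<mu>) * fA \<Phi> a)"

definition eomG ::
  "('m::finite, 'a::finite) courant_data \<Rightarrow> ('w::real_algebra_1, 'r::real_vector) form_algebra
    \<Rightarrow> ('m, 'a, 'w) bv_fields \<Rightarrow> 'a \<Rightarrow> 'w" where
  "eomG Q K \<Phi> a = dif K (fA \<Phi> a)
    + (\<Sum>b\<in>UNIV. \<Sum>\<mu>\<in>UNIV. eta_inv Q a b *\<^sub>R (ev \<Phi> (anchor Q b \<mu>) * fB \<Phi> \<mu>))
    + (1/2) *\<^sub>R (\<Sum>b\<in>UNIV. \<Sum>c\<in>UNIV. ev \<Phi> (flux_up Q a b c) * fA \<Phi> b * fA \<Phi> c)"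


section \<open>The AKSZ action\<close>

text \<open>A function on \<open>T[1]\<Sigma>\<close> of total degree \<open>k\<close> is represented by the sequence of its form
  components, the component of form degree \<open>p\<close> having bidegree \<open>(k - p, p)\<close>.  In the product of
  such functions signs are governed by the total degree, whereas the component forms multiply by the
  bigraded rule.  The two are related by the sign \<open>(-1)\<^sup>g\<^sup>f\<^sup>'\<close> that arises when the ghost part of the
  first factor (ghost degree \<open>g\<close>) is moved past the odd coordinates of the second (form degree
  \<open>f'\<close>).  The first argument of \<open>sprod\<close> is the total degree of the first factor.\<close>
definition sprod :: "int \<Rightarrow> (nat \<Rightarrow> 'w::real_algebra_1) \<Rightarrow> (nat \<Rightarrow> 'w) \<Rightarrow> nat \<Rightarrow> 'w" where
  "sprod k f g n = (\<Sum>p\<le>n. sg ((k - int p) * int (n - p)) *\<^sub>R (f p * g (n - p)))"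

definition sdif :: "('w, 'r) form_algebra \<Rightarrow> (nat \<Rightarrow> 'w::real_algebra_1) \<Rightarrow> nat \<Rightarrow> 'w" where
  "sdif K f n = (case n of 0 \<Rightarrow> 0 | Suc p \<Rightarrow> dif K (f p))"

definition of_comps :: "'w::real_algebra_1 list \<Rightarrow> nat \<Rightarrow> 'w" where
  "of_comps l n = (if n < length l then l ! n else 0)"

text \<open>Superfields of total degree 0, 1, 2; the only component fields entering with a minus sign
  are \<open>X\<^sup>\<dagger>\<close> and \<open>\<epsilon>\<^sup>\<dagger>\<close>.\<close>
definition superX :: "('m::finite, 'a::finite, 'w::real_algebra_1) bv_fields \<Rightarrow> 'm \<Rightarrow> nat \<Rightarrow> 'w" where
  "superX \<Phi> \<mu> = of_comps [fX \<Phi> \<mu>, Bd \<Phi> \<mu>, psid \<Phi> \<mu>, tpsid \<Phi> \<mu>]"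

definition superA :: "('m::finite, 'a::finite) courant_data
    \<Rightarrow> ('m, 'a, 'w::real_algebra_1) bv_fields \<Rightarrow> 'a \<Rightarrow> nat \<Rightarrow> 'w" where
  "superA Q \<Phi> a = of_comps [eps \<Phi> a, fA \<Phi> a,
     \<Sum>b\<in>UNIV. eta_inv Q a b *\<^sub>R Ad \<Phi> b, - (\<Sum>b\<in>UNIV. eta_inv Q a b *\<^sub>R epsd \<Phi> b)]"

definition superB :: "('m::finite, 'a::finite, 'w::real_algebra_1) bv_fields \<Rightarrow> 'm \<Rightarrow> nat \<Rightarrow> 'w" where
  "superB \<Phi> \<mu> = of_comps [tpsi \<Phi> \<mu>, psi \<Phi> \<mu>, fB \<Phi> \<mu>, - Xd \<Phi> \<mu>]"

text \<open>\<open>f(\<^bold>X)\<close> is the Taylor expansion around \<open>X\<close> in the nilpotent part \<open>\<^bold>X - X\<close>.  That part has form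
  degree at least 1, so terms of order above 3 have form degree above 3 and vanish.\<close>
definition nilX :: "('m::finite, 'a::finite, 'w::real_algebra_1) bv_fields \<Rightarrow> 'm \<Rightarrow> nat \<Rightarrow> 'w" where
  "nilX \<Phi> \<mu> n = (if n = 0 then 0 else superX \<Phi> \<mu> n)"

fun nil_prod :: "('m::finite, 'a::finite, 'w::real_algebra_1) bv_fields \<Rightarrow> 'm list \<Rightarrow> nat \<Rightarrow> 'w" where
  "nil_prod \<Phi> [] = of_comps [1]"
| "nil_prod \<Phi> (\<mu> # l) = sprod 0 (nilX \<Phi> \<mu>) (nil_prod \<Phi> l)"

definition super_ev :: "('m::finite, 'a::finite, 'w::real_algebra_1) bv_fields
    \<Rightarrow> (real^'m \<Rightarrow> real) \<Rightarrow> nat \<Rightarrow> 'w" where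
  "super_ev \<Phi> f n = (\<Sum>k\<le>3. (1 / fact k) *\<^sub>R
     (\<Sum>l | length l = k. ev \<Phi> (pds l f) * nil_prod \<Phi> l n))"

definition aksz_lagrangian ::
  "('m::finite, 'a::finite) courant_data \<Rightarrow> ('w::real_algebra_1, 'r::real_vector) form_algebra
    \<Rightarrow> ('m, 'a, 'w) bv_fields \<Rightarrow> nat \<Rightarrow> 'w" where
  "aksz_lagrangian Q K \<Phi> n =
    - (\<Sum>\<mu>\<in>UNIV. sprod 2 (superB \<Phi> \<mu>) (sdif K (superX \<Phi> \<mu>)) n)
    + (1/2) *\<^sub>R (\<Sum>a\<in>UNIV. \<Sum>b\<in>UNIV.
        (eta Q $ a $ b) *\<^sub>R sprod 1 (superA Q \<Phi> a) (sdif K (superA Q \<Phi> b)) n)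
    + (\<Sum>a\<in>UNIV. \<Sum>\<mu>\<in>UNIV.
        sprod 2 (sprod 0 (super_ev \<Phi> (anchor Q a \<mu>)) (superB \<Phi> \<mu>)) (superA Q \<Phi> a) n)
    + (1 / fact 3) *\<^sub>R (\<Sum>a\<in>UNIV. \<Sum>b\<in>UNIV. \<Sum>c\<in>UNIV.
        sprod 2 (sprod 1 (sprod 0 (super_ev \<Phi> (flux Q a b c)) (superA Q \<Phi> a))
          (superA Q \<Phi> b)) (superA Q \<Phi> c) n)"

text \<open>Integration over \<open>T[1]\<Sigma>\<close>: the Berezin integral selects the 3-form component.\<close>
definition aksz_action ::
  "('m::finite, 'a::finite) courant_data \<Rightarrow> ('w::real_algebra_1, 'r::real_vector) form_algebra
    \<Rightarrow> ('m, 'a, 'w) bv_fields \<Rightarrow> 'r" where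
  "aksz_action Q K \<Phi> = integral\<^sub>\<Sigma> K (aksz_lagrangian Q K \<Phi> 3)"


section \<open>The operations \<open>\<O>\<^sub>(\<^sub>n\<^sub>)\<close>\<close>

datatype kind = kX | kA | kB | kEps | kPsi | kTpsi

datatype ('m, 'a) comp = cX 'm | cA 'a | cB 'm | cEps 'a | cPsi 'm | cTpsi 'm

instance comp :: (finite, finite) finite
proof (intro_classes)
  have *: "(UNIV :: ('a, 'b) comp set) \<subseteq>
      range cX \<union> range cA \<union> range cB \<union> range cEps \<union> range cPsi \<union> range cTpsi"
  proof (rule subsetI)
    fix x :: "('a, 'b) comp"
    show "x \<in> range cX \<union> range cA \<union> range cB \<union> range cEps \<union> range cPsi \<union> range cTpsi"
      by (cases x) (blast intro: rangeI)+
  qed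
  show "finite (UNIV :: ('a, 'b) comp set)"
    by (rule finite_subset[OF *]) (intro finite_UnI finite_imageI finite_class.finite_UNIV)
qed

fun kind_of :: "('m, 'a) comp \<Rightarrow> kind" where
  "kind_of (cX \<mu>) = kX" | "kind_of (cA a) = kA" | "kind_of (cB \<mu>) = kB"
| "kind_of (cEps a) = kEps" | "kind_of (cPsi \<mu>) = kPsi" | "kind_of (cTpsi \<mu>) = kTpsi"

fun gh :: "kind \<Rightarrow> nat" where
  "gh kX = 0" | "gh kA = 0" | "gh kB = 0" | "gh kEps = 1" | "gh kPsi = 1" | "gh kTpsi = 2"

fun field :: "('m::finite, 'a::finite, 'w) bv_fields \<Rightarrow> ('m, 'a) comp \<Rightarrow> 'w" where
  "field \<Phi> (cX \<mu>) = fX \<Phi> \<mu>" | "field \<Phi> (cA a) = fA \<Phi> a" | "field \<Phi> (cB \<mu>) = fB \<Phi> \<mu>"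
| "field \<Phi> (cEps a) = eps \<Phi> a" | "field \<Phi> (cPsi \<mu>) = psi \<Phi> \<mu>" | "field \<Phi> (cTpsi \<mu>) = tpsi \<Phi> \<mu>"

fun antifield :: "('m::finite, 'a::finite, 'w) bv_fields \<Rightarrow> ('m, 'a) comp \<Rightarrow> 'w" where
  "antifield \<Phi> (cX \<mu>) = Xd \<Phi> \<mu>" | "antifield \<Phi> (cA a) = Ad \<Phi> a"
| "antifield \<Phi> (cB \<mu>) = Bd \<Phi> \<mu>" | "antifield \<Phi> (cEps a) = epsd \<Phi> a"
| "antifield \<Phi> (cPsi \<mu>) = psid \<Phi> \<mu>" | "antifield \<Phi> (cTpsi \<mu>) = tpsid \<Phi> \<mu>"

fun brst ::
  "('m::finite, 'a::finite) courant_data \<Rightarrow> ('w::real_algebra_1, 'r::real_vector) form_algebra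
    \<Rightarrow> ('m, 'a, 'w) bv_fields \<Rightarrow> ('m, 'a) comp \<Rightarrow> 'w" where
  "brst Q K \<Phi> (cX \<mu>) = (\<Sum>a\<in>UNIV. ev \<Phi> (anchor Q a \<mu>) * eps \<Phi> a)"
| "brst Q K \<Phi> (cA a) = dif K (eps \<Phi> a)
    + (\<Sum>b\<in>UNIV. \<Sum>\<mu>\<in>UNIV. eta_inv Q a b *\<^sub>R (ev \<Phi> (anchor Q b \<mu>) * psi \<Phi> \<mu>))
    + (\<Sum>b\<in>UNIV. \<Sum>c\<in>UNIV. ev \<Phi> (flux_up Q a b c) * fA \<Phi> b * eps \<Phi> c)"
| "brst Q K \<Phi> (cB \<mu>) = - dif K (psi \<Phi> \<mu>)
    - (\<Sum>a\<in>UNIV. \<Sum>\<nu>\<in>UNIV. ev \<Phi> (pd \<mu> (anchor Q a \<nu>)) * (fB \<Phi> \<nu> * eps \<Phi> a - psi \<Phi> \<nu> * fA \<Phi> a))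
    - (1/2) *\<^sub>R (\<Sum>a\<in>UNIV. \<Sum>b\<in>UNIV. \<Sum>c\<in>UNIV.
        ev \<Phi> (pd \<mu> (flux Q a b c)) * fA \<Phi> a * fA \<Phi> b * eps \<Phi> c)"
| "brst Q K \<Phi> (cEps a) = - (\<Sum>b\<in>UNIV. eta_inv Q a b *\<^sub>R
    ((\<Sum>\<mu>\<in>UNIV. ev \<Phi> (anchor Q b \<mu>) * tpsi \<Phi> \<mu>)
     + (1/2) *\<^sub>R (\<Sum>c\<in>UNIV. \<Sum>d\<in>UNIV. ev \<Phi> (flux Q b c d) * eps \<Phi> c * eps \<Phi> d)))"
| "brst Q K \<Phi> (cPsi \<mu>) = dif K (tpsi \<Phi> \<mu>)
    + (\<Sum>a\<in>UNIV. \<Sum>\<nu>\<in>UNIV. ev \<Phi> (pd \<mu> (anchor Q a \<nu>)) * (tpsi \<Phi> \<nu> * fA \<Phi> a + psi \<Phi> \<nu> * eps \<Phi> a))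
    + (1/2) *\<^sub>R (\<Sum>a\<in>UNIV. \<Sum>b\<in>UNIV. \<Sum>c\<in>UNIV.
        ev \<Phi> (pd \<mu> (flux Q a b c)) * fA \<Phi> a * eps \<Phi> b * eps \<Phi> c)"
| "brst Q K \<Phi> (cTpsi \<mu>) =
    - (\<Sum>a\<in>UNIV. \<Sum>\<nu>\<in>UNIV. ev \<Phi> (pd \<mu> (anchor Q a \<nu>)) * tpsi \<Phi> \<nu> * eps \<Phi> a)
    - (1/6) *\<^sub>R (\<Sum>a\<in>UNIV. \<Sum>b\<in>UNIV. \<Sum>c\<in>UNIV.
        ev \<Phi> (pd \<mu> (flux Q a b c)) * eps \<Phi> a * eps \<Phi> b * eps \<Phi> c)"

text \<open>The on-shell closed BRST transformation \<open>s\<^sub>0\<close>, given by \<open>brst\<close> on the component fields,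
  as an operator: a derivation of bidegree \<open>(1, 0)\<close>, hence commuting with the differential,
  which annihilates antifields.\<close>
definition brst_operator ::
  "('m::finite, 'a::finite) courant_data \<Rightarrow> ('w::real_algebra_1, 'r::real_vector) form_algebra
    \<Rightarrow> ('m, 'a, 'w) bv_fields \<Rightarrow> ('w \<Rightarrow> 'w) \<Rightarrow> bool" where
  "brst_operator Q K \<Phi> s \<longleftrightarrow>
     linear s
   \<and> (\<forall>g f. \<forall>\<alpha>\<in>bideg K g f. s \<alpha> \<in> bideg K (g + 1) f)
   \<and> (\<forall>g f g' f'. \<forall>\<alpha>\<in>bideg K g f. \<forall>\<beta>\<in>bideg K g' f'.
        s (\<alpha> * \<beta>) = s \<alpha> * \<beta> + sg g *\<^sub>R (\<alpha> * s \<beta>))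
   \<and> (\<forall>g f. \<forall>\<alpha>\<in>bideg K g f. s (dif K \<alpha>) = dif K (s \<alpha>))
   \<and> (\<forall>h. smooth_fun (patch Q) h \<longrightarrow>
        s (ev \<Phi> h) = (\<Sum>\<mu>\<in>UNIV. ev \<Phi> (pd \<mu> h) * brst Q K \<Phi> (cX \<mu>)))
   \<and> (\<forall>\<phi>. s (field \<Phi> \<phi>) = brst Q K \<Phi> \<phi>)
   \<and> (\<forall>\<phi>. s (antifield \<Phi> \<phi>) = 0)"

text \<open>The terms of \<open>\<phi>\<^sup>\<dagger>\<O>\<^sub>(\<^sub>n\<^sub>)\<phi>\<close> are distinguished by the kinds of the antifields occurring in them:
  \<open>op_contents n k\<close> lists, for a field \<open>\<phi>\<close> of kind \<open>k\<close>, the antifield contents of the terms of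
  \<open>\<O>\<^sub>(\<^sub>n\<^sub>)\<phi>\<close>, not counting the prefactor \<open>\<phi>\<^sup>\<dagger>\<close>.\<close>
definition op_contents :: "nat \<Rightarrow> kind \<Rightarrow> kind multiset set" where
  "op_contents n k =
    (if n = 1 then {{#}}
     else if n = 2 then
       (case k of kA \<Rightarrow> {{#kB#}} | kB \<Rightarrow> {{#kB#}, {#kA#}} | kPsi \<Rightarrow> {{#kB#}} | _ \<Rightarrow> {})
     else if n = 3 then (case k of kB \<Rightarrow> {{#kB, kB#}} | _ \<Rightarrow> {})
     else {})"

text \<open>The term of \<open>\<O>\<^sub>(\<^sub>2\<^sub>)\<phi>\<close> with antifield content \<open>M\<close>, with placeholders \<open>u\<close> and \<open>v\<close>: inserting the
  field equations \<open>F\<^sup>\<mu>\<close> and \<open>G\<^sup>a\<close> gives \<open>s\<^sub>0\<^sup>2\<phi>\<close>, inserting their images \<open>B\<^sup>\<dagger>\<^sup>\<mu>\<close> and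
  \<open>-\<eta>\<^sup>a\<^sup>bA\<^sup>\<dagger>\<^sub>b\<close> under \<open>\<ff>\<close> gives \<open>\<O>\<^sub>(\<^sub>2\<^sub>)\<phi>\<close>.\<close>
fun op2_part ::
  "('m::finite, 'a::finite) courant_data \<Rightarrow> ('m, 'a, 'w::real_algebra_1) bv_fields
    \<Rightarrow> ('m \<Rightarrow> 'w) \<Rightarrow> ('a \<Rightarrow> 'w) \<Rightarrow> ('m, 'a) comp \<Rightarrow> kind multiset \<Rightarrow> 'w" where
  "op2_part Q \<Phi> u v (cA a) M =
    (if M = {#kB#} then
       - (\<Sum>b\<in>UNIV. \<Sum>\<mu>\<in>UNIV. eta_inv Q a b *\<^sub>R (u \<mu> *
           ((\<Sum>\<nu>\<in>UNIV. ev \<Phi> (pd \<mu> (anchor Q b \<nu>)) * tpsi \<Phi> \<nu>)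
            + (1/2) *\<^sub>R (\<Sum>c\<in>UNIV. \<Sum>d\<in>UNIV. ev \<Phi> (pd \<mu> (flux Q b c d)) * eps \<Phi> c * eps \<Phi> d))))
     else 0)"
| "op2_part Q \<Phi> u v (cPsi \<mu>) M =
    (if M = {#kB#} then
       - (\<Sum>\<kappa>\<in>UNIV. u \<kappa> *
           ((\<Sum>a\<in>UNIV. \<Sum>\<nu>\<in>UNIV. ev \<Phi> (pd \<mu> (pd \<kappa> (anchor Q a \<nu>))) * tpsi \<Phi> \<nu> * eps \<Phi> a)
            + (1/6) *\<^sub>R (\<Sum>a\<in>UNIV. \<Sum>b\<in>UNIV. \<Sum>c\<in>UNIV.
                ev \<Phi> (pd \<mu> (pd \<kappa> (flux Q a b c))) * eps \<Phi> a * eps \<Phi> b * eps \<Phi> c)))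
     else 0)"
| "op2_part Q \<Phi> u v (cB \<mu>) M =
    (if M = {#kB#} then
       - (\<Sum>\<kappa>\<in>UNIV. u \<kappa> *
           ((\<Sum>a\<in>UNIV. \<Sum>\<nu>\<in>UNIV. ev \<Phi> (pd \<mu> (pd \<kappa> (anchor Q a \<nu>)))
               * (psi \<Phi> \<nu> * eps \<Phi> a + tpsi \<Phi> \<nu> * fA \<Phi> a))
            + (1/2) *\<^sub>R (\<Sum>a\<in>UNIV. \<Sum>b\<in>UNIV. \<Sum>c\<in>UNIV.
                ev \<Phi> (pd \<mu> (pd \<kappa> (flux Q a b c))) * fA \<Phi> a * eps \<Phi> b * eps \<Phi> c)))
     else if M = {#kA#} then
       - (\<Sum>a\<in>UNIV. v a *
           ((\<Sum>\<nu>\<in>UNIV. ev \<Phi> (pd \<mu> (anchor Q a \<nu>)) * tpsi \<Phi> \<nu>)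
            + (1/2) *\<^sub>R (\<Sum>b\<in>UNIV. \<Sum>c\<in>UNIV. ev \<Phi> (pd \<mu> (flux Q a b c)) * eps \<Phi> b * eps \<Phi> c)))
     else 0)"
| "op2_part Q \<Phi> u v (cX \<mu>) M = 0"
| "op2_part Q \<Phi> u v (cEps a) M = 0"
| "op2_part Q \<Phi> u v (cTpsi \<mu>) M = 0"

fun op3_part ::
  "('m::finite, 'a::finite) courant_data \<Rightarrow> ('m, 'a, 'w::real_algebra_1) bv_fields
    \<Rightarrow> ('m, 'a) comp \<Rightarrow> kind multiset \<Rightarrow> 'w" where
  "op3_part Q \<Phi> (cB \<mu>) M =
    (if M = {#kB, kB#} then
       (\<Sum>\<kappa>\<in>UNIV. \<Sum>\<sigma>\<in>UNIV. Bd \<Phi> \<kappa> * Bd \<Phi> \<sigma> *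
           ((\<Sum>a\<in>UNIV. \<Sum>\<nu>\<in>UNIV.
               ev \<Phi> (pd \<mu> (pd \<kappa> (pd \<sigma> (anchor Q a \<nu>)))) * tpsi \<Phi> \<nu> * eps \<Phi> a)
            + (1/6) *\<^sub>R (\<Sum>a\<in>UNIV. \<Sum>b\<in>UNIV. \<Sum>c\<in>UNIV.
                ev \<Phi> (pd \<mu> (pd \<kappa> (pd \<sigma> (flux Q a b c)))) * eps \<Phi> a * eps \<Phi> b * eps \<Phi> c)))
     else 0)"
| "op3_part Q \<Phi> _ M = 0"

definition op_part ::
  "('m::finite, 'a::finite) courant_data \<Rightarrow> ('w::real_algebra_1, 'r::real_vector) form_algebra
    \<Rightarrow> ('m, 'a, 'w) bv_fields \<Rightarrow> nat \<Rightarrow> ('m, 'a) comp \<Rightarrow> kind multiset \<Rightarrow> 'w" where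
  "op_part Q K \<Phi> n \<phi> M =
    (if n = 1 then (if M = {#} then brst Q K \<Phi> \<phi> else 0)
     else if n = 2 then
       op2_part Q \<Phi> (Bd \<Phi>) (\<lambda>a. - (\<Sum>b\<in>UNIV. eta_inv Q a b *\<^sub>R Ad \<Phi> b)) \<phi> M
     else if n = 3 then op3_part Q \<Phi> \<phi> M
     else 0)"

text \<open>Symmetry factors of a term of \<open>\<phi>\<^sup>\<dagger>\<O>\<^sub>(\<^sub>n\<^sub>)\<phi>\<close> with total antifield content \<open>N\<close>: the factorial
  \<open>\<beta>\<^sub>\<dagger>!\<close> for antifields of the same kind, and the number \<open>\<beta>\<^sub>n\<close> of times that the term occurs.\<close>
definition beta_dagger_fact :: "kind multiset \<Rightarrow> nat" where
  "beta_dagger_fact N = (\<Prod>k\<in>set_mset N. fact (count N k))"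

definition beta :: "nat \<Rightarrow> kind multiset \<Rightarrow> nat" where
  "beta n N = card {(k, M). M \<in> op_contents n k \<and> add_mset k M = N}"

end

theory Submission
  imports Defs
begin

text \<open>For the action, the 3-form component of the AKSZ Lagrangian is expanded in form degrees.  The terms
  with \<open>p\<close> powers of the odd coordinates coming from the Taylor expansion of \<open>\<rho>(\<^bold>X)\<close> and \<open>C(\<^bold>X)\<close>,
  for \<open>p = 0, 1, 2, 3\<close>, are matched separately with the terms \<open>\<phi>\<^sup>\<dagger>\<O>\<^sub>(\<^sub>n\<^sub>)\<phi>\<close>; total antisymmetry of \<open>C\<close>
  collects the cubic terms, and the kinetic terms agree up to an exact form.

  For the square of \<open>s = s\<^sub>0\<close>, put \<open>\<^bold>A = \<epsilon> + A\<close> and \<open>\<^bold>B = \<psi>\<^sup>~ + \<psi> + B\<close>.  On the algebra of functions on \<open>T[1]\<Sigma>\<close> the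
  operator \<open>D = d \<plusminus> s\<close> is an odd derivation with \<open>D\<^sup>2 = s\<^sup>2\<close> in each component, and the definition of \<open>s\<close>
  amounts to the equations \<open>DX = \<rho>\<^bold>A + F\<close>, \<open>D\<^bold>A = - \<eta>(\<rho>\<^bold>B + \<^bold>A\<^bold>A C/2) + G\<close>, \<open>D\<^bold>B = - \<partial>\<rho> \<^bold>B\<^bold>A - \<^bold>A\<^bold>A\<^bold>A \<partial>C/6 + H\<close>
  with \<open>F\<close>, \<open>G\<close>, \<open>H\<close> of form degree at least 1, 2, 3.  Applying \<open>D\<close> once more, the terms without \<open>F\<close>, \<open>G\<close>, \<open>H\<close>
  cancel by the axioms (i)--(iii) and their first derivatives, the terms with \<open>H\<close> have too high form
  degree, and the terms with \<open>F\<close> and \<open>G\<close> are the claimed ones.\<close>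

section \<open>Partial derivatives of smooth functions\<close>

text \<open>The weights 1/(beta_dagger! beta_n) have two origins. The Taylor factor 1/k! of the
  anchor and the flux survives as beta_dagger! when the term contains k factors \<open>Bd\<close>;
  in the second-order term with one \<open>psid\<close> and one \<open>Bd\<close> it is cancelled by
  the two possible orders. The term with \<open>Ad\<close> and \<open>Bd\<close> occurs once in the
  AKSZ Lagrangian but is listed under both A and B in the second operation, whence beta_2 = 2. The
  obstacle throughout is signs: forms with ghosts obey a bigraded rule, superfields a rule by total
  degree. The type \<open>super\<close> builds the conversion sign into its product, so that
  commuting two factors depends only on the parities of their total degrees, and s, twisted by a
  sign in the form degree, obeys the same Leibniz rule as d. Symmetry of mixed partials is needed
  because Taylor coefficients and differentiated axioms produce the same second derivatives in
  different orders.\<close>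

lemma pd_has_derivative: "(f has_derivative f') (at x) \<Longrightarrow> pd \<mu> f x = f' (axis \<mu> 1)"
  unfolding pd_def by (simp flip: frechet_derivative_at)

text \<open>A derivative is local, and \<open>frechet_derivative\<close> is a choice among the
  derivatives at x, so equal sets of derivatives give equal values even where none exists.\<close>

lemma pd_cong_open:
  assumes "open U" "x \<in> U" "\<And>y. y \<in> U \<Longrightarrow> f y = g y"
  shows "pd \<mu> f x = pd \<mu> g x"
proof -
  have "(f has_derivative f') (at x) \<longleftrightarrow> (g has_derivative f') (at x)" for f'
    using assms by (metis (no_types, lifting) has_derivative_transform_within_open)
  then show ?thesis
    unfolding pd_def frechet_derivative_def by simp
qed

lemma pds_cong_open:
  assumes "open U" "\<And>y. y \<in> U \<Longrightarrow> f y = g y"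
  shows "x \<in> U \<Longrightarrow> pds l f x = pds l g x"
proof (induction l arbitrary: x)
  case (Cons \<mu> l)
  then show ?case using pd_cong_open[OF assms(1), of x "pds l f" "pds l g"] by simp
qed (use assms in simp)

text \<open>The last list element is the derivative taken first. Splitting a list there is what
  passes smoothness from f to \<open>pd \<mu> f\<close> and back.\<close>

lemma pds_snoc: "pds (l @ [\<mu>]) f = pds l (pd \<mu> f)"
  by (induction l) auto

lemma smooth_fun_pd [simp]: "smooth_fun U f \<Longrightarrow> smooth_fun U (pd \<mu> f)"
  unfolding smooth_fun_def by (metis pds_snoc)

lemma smooth_fun_pds [simp]: "smooth_fun U f \<Longrightarrow> smooth_fun U (pds l f)"
  by (induction l) auto

lemma smooth_fun_differentiable:
  "open U \<Longrightarrow> smooth_fun U f \<Longrightarrow> x \<in> U \<Longrightarrow> f differentiable (at x)"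
  unfolding smooth_fun_def by (metis differentiable_on_eq_differentiable_at pds.simps(1))

lemma smooth_fun_step:
  assumes "f differentiable_on U" "\<And>\<mu>. smooth_fun U (pd \<mu> f)"
  shows "smooth_fun U f"
  unfolding smooth_fun_def
proof
  fix l show "pds l f differentiable_on U"
    using assms by (cases l rule: rev_cases) (auto simp: pds_snoc smooth_fun_def)
qed

lemma pd_const [simp]: "pd \<mu> (\<lambda>x. c) = (\<lambda>x. 0)"
  by (rule ext) (simp add: pd_def)

lemma smooth_fun_const [simp]:
  fixes U :: "(real^'m::finite) set"
  shows "smooth_fun U (\<lambda>x. c)"
proof -
  have "\<exists>c'. pds l (\<lambda>x. c) = (\<lambda>x::real^'m. c')" for l
    by (induction l) auto
  then have "pds l (\<lambda>x. c) differentiable_on U" for l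
    by (metis differentiable_on_const)
  then show ?thesis
    by (simp add: smooth_fun_def)
qed

lemma pd_coordinate: "pd \<mu> (\<lambda>x. x $ \<nu>) = (\<lambda>x. if \<mu> = \<nu> then 1 else 0)"
proof
  fix x :: "real^'a"
  have "((\<lambda>x. x $ \<nu>) has_derivative (\<lambda>x. x $ \<nu>)) (at x)"
    by (rule bounded_linear_imp_has_derivative[OF bounded_linear_vec_nth])
  then show "pd \<mu> (\<lambda>x. x $ \<nu>) x = (if \<mu> = \<nu> then 1 else 0)"
    by (simp add: pd_has_derivative axis_def)
qed

lemma smooth_fun_coordinate [simp]: "smooth_fun U (\<lambda>x. x $ \<nu>)"
  by (rule smooth_fun_step)
    (auto simp: pd_coordinate intro!: linear_imp_differentiable_on bounded_linear.linear bounded_linear_vec_nth)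


text \<open>The functions built from smooth ones by sums and products form a class of differentiable
  functions that is closed under partial derivatives, hence consists of smooth functions.\<close>
inductive smooth_poly :: "(real^'m::finite) set \<Rightarrow> (real^'m \<Rightarrow> real) \<Rightarrow> bool" for U where
  "smooth_fun U f \<Longrightarrow> smooth_poly U f"
| "smooth_poly U f \<Longrightarrow> smooth_poly U g \<Longrightarrow> smooth_poly U (\<lambda>x. f x + g x)"
| "smooth_poly U f \<Longrightarrow> smooth_poly U g \<Longrightarrow> smooth_poly U (\<lambda>x. f x * g x)"

section \<open>Closure of smooth functions under sums and products\<close>

context
  fixes U :: "(real^'m::finite) set"
  assumes open_U: "open U"
begin

lemma pd_add_at:
  assumes "f differentiable (at x)" "g differentiable (at x)"
  shows "pd \<mu> (\<lambda>x. f x + g x) x = pd \<mu> f x + pd \<mu> g x"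
proof -
  obtain f' g' where "(f has_derivative f') (at x)" "(g has_derivative g') (at x)"
    using assms unfolding differentiable_def by blast
  then show ?thesis
    by (simp add: pd_has_derivative pd_has_derivative[OF has_derivative_add])
qed

lemma pd_mult_at:
  assumes "f differentiable (at x)" "g differentiable (at x)"
  shows "pd \<mu> (\<lambda>x. f x * g x) x = pd \<mu> f x * g x + f x * pd \<mu> g x"
proof -
  obtain f' g' where "(f has_derivative f') (at x)" "(g has_derivative g') (at x)"
    using assms unfolding differentiable_def by blast
  then show ?thesis
    by (simp add: pd_has_derivative pd_has_derivative[OF has_derivative_mult])
qed

lemma smooth_poly_differentiable: "smooth_poly U f \<Longrightarrow> x \<in> U \<Longrightarrow> f differentiable (at x)"
  by (induction rule: smooth_poly.induct)
    (auto intro: smooth_fun_differentiable[OF open_U] differentiable_add differentiable_mult)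

text \<open>Sum and product rule hold only where both functions are differentiable, hence on U. The
  class is therefore closed under \<open>pd\<close> only up to equality on U, which forces the
  witness g.\<close>

lemma smooth_poly_pd: "smooth_poly U f \<Longrightarrow> \<exists>g. smooth_poly U g \<and> (\<forall>x\<in>U. pd \<mu> f x = g x)"
proof (induction rule: smooth_poly.induct)
  case (1 f)
  then show ?case using smooth_poly.intros(1)[OF smooth_fun_pd] by blast
next
  case (2 f g)
  then obtain f' g' where "smooth_poly U f'" "\<forall>x\<in>U. pd \<mu> f x = f' x"
    "smooth_poly U g'" "\<forall>x\<in>U. pd \<mu> g x = g' x" by blast
  with 2 show ?case
    by (intro exI[of _ "\<lambda>x. f' x + g' x"])
      (auto simp: pd_add_at smooth_poly_differentiable intro: smooth_poly.intros)
next
  case (3 f g)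
  then obtain f' g' where "smooth_poly U f'" "\<forall>x\<in>U. pd \<mu> f x = f' x"
    "smooth_poly U g'" "\<forall>x\<in>U. pd \<mu> g x = g' x" by blast
  with 3 show ?case
    by (intro exI[of _ "\<lambda>x. f' x * g x + f x * g' x"])
      (auto simp: pd_mult_at smooth_poly_differentiable intro!: smooth_poly.intros(2,3))
qed

text \<open>Each iterated partial agrees on U with a member of the class. Since U is open,
  differentiability passes from that member to the partial itself.\<close>

lemma smooth_poly_smooth:
  assumes "smooth_poly U f"
  shows "smooth_fun U f"
proof -
  have "\<exists>g. smooth_poly U g \<and> (\<forall>x\<in>U. pds l f x = g x)" for l
  proof (induction l)
    case (Cons \<mu> l)
    then obtain g where g: "smooth_poly U g" "\<forall>x\<in>U. pds l f x = g x" by blast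
    with smooth_poly_pd[OF g(1)] pd_cong_open[OF open_U, of _ "pds l f" g] show ?case
      by (metis pds.simps(2))
  qed (use assms in auto)
  then show ?thesis
    unfolding smooth_fun_def differentiable_on_eq_differentiable_at[OF open_U]
    by (metis (no_types, lifting) differentiable_def has_derivative_transform_within_open open_U
        smooth_poly_differentiable)
qed

lemma smooth_fun_add [simp]: "smooth_fun U f \<Longrightarrow> smooth_fun U g \<Longrightarrow> smooth_fun U (\<lambda>x. f x + g x)"
  and smooth_fun_mult [simp]: "smooth_fun U f \<Longrightarrow> smooth_fun U g \<Longrightarrow> smooth_fun U (\<lambda>x. f x * g x)"
  by (rule smooth_poly_smooth, rule smooth_poly.intros(2,3); rule smooth_poly.intros(1); assumption)+

lemma smooth_fun_sum [simp]:
  assumes "\<And>i. i \<in> I \<Longrightarrow> smooth_fun U (f i)"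
  shows "smooth_fun U (\<lambda>x. \<Sum>i\<in>I. f i x)"
  using assms by (induction I rule: infinite_finite_induct) auto

lemma pd_add:
  "smooth_fun U f \<Longrightarrow> smooth_fun U g \<Longrightarrow> x \<in> U \<Longrightarrow> pd \<mu> (\<lambda>x. f x + g x) x = pd \<mu> f x + pd \<mu> g x"
  by (simp add: pd_add_at smooth_fun_differentiable[OF open_U])

lemma pd_mult:
  "smooth_fun U f \<Longrightarrow> smooth_fun U g \<Longrightarrow> x \<in> U \<Longrightarrow>
    pd \<mu> (\<lambda>x. f x * g x) x = pd \<mu> f x * g x + f x * pd \<mu> g x"
  by (simp add: pd_mult_at smooth_fun_differentiable[OF open_U])

lemma pd_sum:
  assumes "\<And>i. i \<in> I \<Longrightarrow> smooth_fun U (f i)" "x \<in> U"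
  shows "pd \<mu> (\<lambda>x. \<Sum>i\<in>I. f i x) x = (\<Sum>i\<in>I. pd \<mu> (f i) x)"
  using assms(1)
proof (induction I rule: infinite_finite_induct)
  case (insert i I)
  have "pd \<mu> (\<lambda>x. \<Sum>i\<in>insert i I. f i x) x = pd \<mu> (\<lambda>x. f i x + (\<Sum>i\<in>I. f i x)) x"
    by (simp only: sum.insert[OF insert.hyps])
  also have "\<dots> = pd \<mu> (f i) x + pd \<mu> (\<lambda>x. \<Sum>i\<in>I. f i x) x"
    by (rule pd_add[OF _ _ assms(2)]) (simp_all add: insert.prems)
  also have "pd \<mu> (\<lambda>x. \<Sum>i\<in>I. f i x) x = (\<Sum>i\<in>I. pd \<mu> (f i) x)"
    by (rule insert.IH) (simp add: insert.prems)
  finally show ?case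
    by (simp only: sum.insert[OF insert.hyps])
qed simp_all

lemma pd_cmult:
  "smooth_fun U f \<Longrightarrow> x \<in> U \<Longrightarrow> pd \<mu> (\<lambda>x. c * f x) x = c * pd \<mu> f x"
  by (simp add: pd_mult)

text \<open>Restriction to a coordinate line, the form in which the one-variable mean value theorem
  can be applied.\<close>

lemma pd_has_real_derivative:
  assumes "smooth_fun U f" "y + s *\<^sub>R axis \<mu> 1 \<in> U"
  shows "((\<lambda>s. f (y + s *\<^sub>R axis \<mu> 1)) has_real_derivative pd \<mu> f (y + s *\<^sub>R axis \<mu> 1)) (at s)"
proof -
  let ?z = "y + s *\<^sub>R axis \<mu> 1"
  have f: "(f has_derivative frechet_derivative f (at ?z)) (at ?z)"
    using smooth_fun_differentiable[OF open_U assms] by (simp add: frechet_derivative_works)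
  have g: "((\<lambda>s. y + s *\<^sub>R axis \<mu> 1) has_derivative (\<lambda>h. h *\<^sub>R axis \<mu> 1)) (at s)"
    by (auto intro!: derivative_eq_intros)
  have "((\<lambda>s. f (y + s *\<^sub>R axis \<mu> 1)) has_derivative
      (\<lambda>h. frechet_derivative f (at ?z) (h *\<^sub>R axis \<mu> 1))) (at s)"
    by (rule has_derivative_compose[OF g f])
  moreover have "frechet_derivative f (at ?z) (h *\<^sub>R axis \<mu> 1) = pd \<mu> f ?z * h" for h
    using linear_cmul[OF has_derivative_linear[OF f]] by (simp add: pd_def)
  ultimately show ?thesis by (simp add: has_field_derivative_def)
qed

text \<open>Both mixed partial derivatives are the limit of the second difference quotient.\<close>
lemma second_difference_limit:
  assumes f: "smooth_fun U f" and x: "x \<in> U"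
  shows "((\<lambda>h. (f (x + h *\<^sub>R axis \<mu> 1 + h *\<^sub>R axis \<nu> 1) - f (x + h *\<^sub>R axis \<mu> 1)
      - f (x + h *\<^sub>R axis \<nu> 1) + f x) / h\<^sup>2) \<longlongrightarrow> pd \<nu> (pd \<mu> f) x) (at_right 0)"
  (is "(?q \<longlongrightarrow> _) _")
proof (rule tendstoI)
  fix e :: real assume e: "e > 0"
  let ?u = "axis \<mu> 1 :: real^'m" and ?v = "axis \<nu> 1 :: real^'m"
  have "isCont (pd \<nu> (pd \<mu> f)) x"
    by (intro differentiable_imp_continuous_within smooth_fun_differentiable[OF open_U] smooth_fun_pd f x)
  then obtain d1 where d1: "d1 > 0" "\<And>y. dist y x < d1 \<Longrightarrow> dist (pd \<nu> (pd \<mu> f) y) (pd \<nu> (pd \<mu> f) x) < e"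
    unfolding continuous_at_eps_delta using e by blast
  obtain d2 where d2: "d2 > 0" "ball x d2 \<subseteq> U"
    using openE[OF open_U x] by blast
  define d where "d = min d1 d2"
  have near: "dist (x + s *\<^sub>R ?u + t *\<^sub>R ?v) x < d" if "0 \<le> s" "0 \<le> t" "s + t < d" for s t
  proof -
    have "dist (x + s *\<^sub>R ?u + t *\<^sub>R ?v) x = norm (s *\<^sub>R ?u + t *\<^sub>R ?v)"
      by (simp add: dist_norm algebra_simps)
    also have "\<dots> \<le> s + t"
      using norm_triangle_ineq[of "s *\<^sub>R ?u" "t *\<^sub>R ?v"] that by (simp add: norm_axis_1)
    finally show ?thesis using that by simp
  qed
  then have inU: "x + s *\<^sub>R ?u + t *\<^sub>R ?v \<in> U" if "0 \<le> s" "0 \<le> t" "s + t < d" for s t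
    using near[OF that] d2(2) by (auto simp: d_def dist_commute subset_iff)
  \<comment> \<open>The bound d / 2 keeps every point with offsets s, t at most h both inside U and
    inside the ball given by continuity.\<close>
  have "dist (?q h) (pd \<nu> (pd \<mu> f) x) < e" if h: "0 < h" "h < d / 2" for h
  proof -
    \<comment> \<open>The second difference is \<open>?g h - ?g 0\<close>. One mean value in
      direction \<open>\<mu>\<close> produces s, a second one in direction \<open>\<nu>\<close>
      produces t, and the two factors h cancel the denominator.\<close>
    let ?g = "\<lambda>s. f (x + h *\<^sub>R ?v + s *\<^sub>R ?u) - f (x + s *\<^sub>R ?u)"
    let ?g' = "\<lambda>s. pd \<mu> f (x + h *\<^sub>R ?v + s *\<^sub>R ?u) - pd \<mu> f (x + s *\<^sub>R ?u)"
    have "DERIV ?g s :> ?g' s" if "0 \<le> s" "s \<le> h" for s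
      using that h inU[of s h] inU[of s 0]
      by (intro DERIV_diff pd_has_real_derivative f) (auto simp: algebra_simps)
    from MVT2[OF h(1), of ?g ?g', OF this]
    obtain s where s: "0 < s" "s < h" "?g h - ?g 0 = (h - 0) * ?g' s"
      by blast
    have "DERIV (\<lambda>t. pd \<mu> f (x + s *\<^sub>R ?u + t *\<^sub>R ?v)) t :> pd \<nu> (pd \<mu> f) (x + s *\<^sub>R ?u + t *\<^sub>R ?v)"
      if "0 \<le> t" "t \<le> h" for t
      using that s h inU[of s t] f by (intro pd_has_real_derivative) auto
    from MVT2[OF h(1), of "\<lambda>t. pd \<mu> f (x + s *\<^sub>R ?u + t *\<^sub>R ?v)", OF this]
    obtain t where t: "0 < t" "t < h"
      "pd \<mu> f (x + s *\<^sub>R ?u + h *\<^sub>R ?v) - pd \<mu> f (x + s *\<^sub>R ?u + 0 *\<^sub>R ?v)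
        = (h - 0) * pd \<nu> (pd \<mu> f) (x + s *\<^sub>R ?u + t *\<^sub>R ?v)"
      by blast
    have "?g h - ?g 0 = h\<^sup>2 * pd \<nu> (pd \<mu> f) (x + s *\<^sub>R ?u + t *\<^sub>R ?v)"
      using s(3) t(3) by (simp add: algebra_simps power2_eq_square)
    moreover have "?q h = (?g h - ?g 0) / h\<^sup>2"
      by (simp add: algebra_simps)
    ultimately have "?q h = pd \<nu> (pd \<mu> f) (x + s *\<^sub>R ?u + t *\<^sub>R ?v)"
      using h by simp
    then show ?thesis
      using d1(2) near[of s t] s t h by (simp add: d_def)
  qed
  then show "\<forall>\<^sub>F h in at_right 0. dist (?q h) (pd \<nu> (pd \<mu> f) x) < e"
    unfolding eventually_at_right_field using d1(1) d2(1)
    by (intro exI[of _ "d / 2"]) (auto simp: d_def)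
qed

lemma pd_commute:
  assumes "smooth_fun U f" "x \<in> U"
  shows "pd \<mu> (pd \<nu> f) x = pd \<nu> (pd \<mu> f) x"
proof (rule tendsto_unique)
  have "(f (x + h *\<^sub>R axis \<mu> 1 + h *\<^sub>R axis \<nu> 1) - f (x + h *\<^sub>R axis \<mu> 1)
      - f (x + h *\<^sub>R axis \<nu> 1) + f x) / h\<^sup>2 =
    (f (x + h *\<^sub>R axis \<nu> 1 + h *\<^sub>R axis \<mu> 1) - f (x + h *\<^sub>R axis \<nu> 1)
      - f (x + h *\<^sub>R axis \<mu> 1) + f x) / h\<^sup>2" for h
    by (simp only: add.commute[of "h *\<^sub>R axis \<mu> 1"] add.assoc) simp
  then show "((\<lambda>h. (f (x + h *\<^sub>R axis \<nu> 1 + h *\<^sub>R axis \<mu> 1) - f (x + h *\<^sub>R axis \<nu> 1)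
      - f (x + h *\<^sub>R axis \<mu> 1) + f x) / h\<^sup>2) \<longlongrightarrow> pd \<nu> (pd \<mu> f) x) (at_right 0)"
    using second_difference_limit[OF assms, of \<mu> \<nu>] by (simp only:)
qed (use second_difference_limit[OF assms, of \<nu> \<mu>] in simp_all)

end

section \<open>The algebra of functions on \<open>T[1]\<Sigma>\<close>\<close>

lemma scaleR_3: "3 *\<^sub>R x = x + x + x" for x :: "'b::real_vector"
  using scaleR_add_left[of 2 1 x] by (simp add: scaleR_2)

lemma scaleR_4: "4 *\<^sub>R x = x + x + x + x" for x :: "'b::real_vector"
  using scaleR_add_left[of 2 2 x] by (simp add: scaleR_2)

section \<open>Products of superfields in form degrees 0 to 3\<close>

lemma of_comps_expand:
  "of_comps [] n = (0::'w::real_algebra_1)" "of_comps (u # us) 0 = (u::'w)"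
  "of_comps (u # us) (Suc n) = of_comps us n" "of_comps (u # us) 2 = of_comps us (Suc 0)"
  "of_comps (u # us) 3 = of_comps us 2"
  by (simp_all add: of_comps_def nth_Cons numeral_2_eq_2 numeral_3_eq_3)

lemma sdif_expand:
  "sdif K u 0 = 0" "sdif K u (Suc n) = dif K (u n)" "sdif K u 2 = dif K (u (Suc 0))" "sdif K u 3 = dif K (u 2)"
  by (simp_all add: sdif_def numeral_2_eq_2 numeral_3_eq_3)

lemma sprod_0: "sprod k u v 0 = u 0 * v 0"
  by (simp add: sprod_def sg_def)

lemma sprod_1: "sprod k u v (Suc 0) = sg k *\<^sub>R (u 0 * v (Suc 0)) + u (Suc 0) * v 0"
  by (simp add: sprod_def sg_def)

lemma sprod_2: "sprod k u v 2 = u 0 * v 2 + sg (k - 1) *\<^sub>R (u (Suc 0) * v (Suc 0)) + u 2 * v 0"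
  by (simp add: sprod_def sg_def numeral_2_eq_2)

lemma sprod_3: "sprod k u v 3 = sg k *\<^sub>R (u 0 * v 3) + u (Suc 0) * v 2 + sg k *\<^sub>R (u 2 * v (Suc 0)) + u 3 * v 0"
proof -
  have "{..3::nat} = {0, Suc 0, 2, 3}" by auto
  then show ?thesis by (simp add: sprod_def sg_def)
qed

lemmas sprod_expand = sprod_0 sprod_1 sprod_2 sprod_3

text \<open>A component is labelled by its form degree and the parity of its ghost degree.  The sign in the
  product is the one of \<open>sprod\<close>, but here the degrees of the factors need not be supplied, so that the
  product makes sense for inhomogeneous elements and is associative and bilinear.\<close>
datatype (plugins only:) 'w super = Super (cmp: "nat \<Rightarrow> bool \<Rightarrow> 'w")

lemma super_eqI: "(\<And>n b. cmp f n b = cmp g n b) \<Longrightarrow> f = g"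
  by (cases f; cases g) (simp add: fun_eq_iff)

definition eps_sign :: "bool \<Rightarrow> real" where
  "eps_sign b = (if b then -1 else 1)"

lemma eps_sign_simps [simp]: "eps_sign True = -1" "eps_sign False = 1"
  by (simp_all add: eps_sign_def)

instantiation super :: (real_algebra) real_algebra
begin

definition "0 = Super (\<lambda>n b. 0)"
definition "f + g = Super (\<lambda>n b. cmp f n b + cmp g n b)"
definition "f - g = Super (\<lambda>n b. cmp f n b - cmp g n b)"
definition "- f = Super (\<lambda>n b. - cmp f n b)"
definition "r *\<^sub>R f = Super (\<lambda>n b. r *\<^sub>R cmp f n b)"
definition "f * g = Super (\<lambda>n c. \<Sum>p\<le>n. \<Sum>a\<in>UNIV.
  eps_sign (a \<and> odd (n - p)) *\<^sub>R (cmp f p a * cmp g (n - p) (a \<noteq> c)))"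

lemma cmp_simps [simp]:
  "cmp 0 n b = 0" "cmp (f + g) n b = cmp f n b + cmp g n b"
  "cmp (f - g) n b = cmp f n b - cmp g n b" "cmp (- f) n b = - cmp f n b"
  "cmp (r *\<^sub>R f) n b = r *\<^sub>R cmp f n b"
  by (simp_all add: zero_super_def plus_super_def minus_super_def uminus_super_def scaleR_super_def)

lemma cmp_mult:
  "cmp (f * g) n c = (\<Sum>p\<le>n. \<Sum>a\<in>UNIV.
    eps_sign (a \<and> odd (n - p)) *\<^sub>R (cmp f p a * cmp g (n - p) (a \<noteq> c)))"
  by (simp add: times_super_def)

instance
proof
  fix f g h :: "'a super" and r t :: real
  show "f * g * h = f * (g * h)"
  proof (rule super_eqI)
    fix n e
    \<comment> \<open>F collects the terms with form degrees i, j, k. Both bracketings give it: the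
      ghost parity of a product is the sum of the parities, so the sign exponents are bj + (a + b)k
      on one side and b(j + k) + ak on the other.\<close>
    define F where "F i j k = (\<Sum>b\<in>UNIV. \<Sum>a\<in>UNIV.
      (eps_sign (b \<and> odd (j + k)) * eps_sign (a \<and> odd k)) *\<^sub>R
        (cmp f i b * cmp g j a * cmp h k ((a \<noteq> b) \<noteq> e)))" for i j k
    have F1: "(\<Sum>a\<in>UNIV. eps_sign (a \<and> odd k) *\<^sub>R ((\<Sum>b\<in>UNIV. eps_sign (b \<and> odd j) *\<^sub>R
        (cmp f i b * cmp g j (b \<noteq> a))) * cmp h k (a \<noteq> e))) = F i j k" for i j k
      unfolding F_def UNIV_bool by (cases "odd j"; cases "odd k"; cases e) (simp_all add: algebra_simps)
    have F2: "(\<Sum>b\<in>UNIV. eps_sign (b \<and> odd (j + k)) *\<^sub>R (cmp f i b * (\<Sum>a\<in>UNIV.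
        eps_sign (a \<and> odd k) *\<^sub>R (cmp g j a * cmp h k (a \<noteq> (b \<noteq> e)))))) = F i j k" for i j k
      unfolding F_def UNIV_bool by (cases "odd j"; cases "odd k"; cases e) (simp_all add: algebra_simps)
    have "cmp (f * g * h) n e = (\<Sum>p=0..n. \<Sum>i=0..p. F i (p - i) (n - p))"
      unfolding cmp_mult atMost_atLeast0 sum_distrib_right scaleR_sum_right F1[symmetric]
      by (intro sum.cong refl) (rule sum.swap)
    \<comment> \<open>What remains is the reindexing of triples of degrees with sum n, as for the
      Cauchy product of power series.\<close>
    also have "\<dots> = (\<Sum>p=0..n. \<Sum>i=0..n - p. F p i (n - p - i))"
      by (rule fps_mult_assoc_lemma)
    also have "\<dots> = (\<Sum>p=0..n. \<Sum>i=0..n - p. \<Sum>b\<in>UNIV. eps_sign (b \<and> odd (n - p)) *\<^sub>R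
        (cmp f p b * (\<Sum>a\<in>UNIV. eps_sign (a \<and> odd (n - p - i)) *\<^sub>R
          (cmp g i a * cmp h (n - p - i) (a \<noteq> (b \<noteq> e))))))"
      by (intro sum.cong refl) (simp add: F2[symmetric] del: odd_add)
    also have "\<dots> = cmp (f * (g * h)) n e"
      unfolding cmp_mult atMost_atLeast0 sum_distrib_left scaleR_sum_right
      by (intro sum.cong refl) (rule sum.swap)
    finally show "cmp (f * g * h) n e = cmp (f * (g * h)) n e" .
  qed
qed (auto intro!: super_eqI simp: cmp_mult algebra_simps sum.distrib scaleR_sum_right scaleR_left_commute)

end

lemma cmp_sum [simp]: "cmp (sum f I) n b = (\<Sum>i\<in>I. cmp (f i) n b)"
  by (induction I rule: infinite_finite_induct) auto

definition comps :: "int \<Rightarrow> 'w super \<Rightarrow> nat \<Rightarrow> 'w" where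
  "comps k f p = cmp f p (odd (k - int p))"

text \<open>A sequence of forms carries no ghost degree; the total degree k supplies the parity k -
  p in form degree p.\<close>

definition homogeneous :: "int \<Rightarrow> (nat \<Rightarrow> 'w::zero) \<Rightarrow> 'w super" where
  "homogeneous k u = Super (\<lambda>p b. if b = odd (k - int p) then u p else 0)"

lemma comps_homogeneous [simp]: "comps k (homogeneous k u) = u"
  by (simp add: comps_def homogeneous_def fun_eq_iff)

lemma comps_simps [simp]:
  "comps k 0 n = 0" "comps k (f + g) n = comps k f n + comps k g n"
  "comps k (f - g) n = comps k f n - comps k g n" "comps k (- f) n = - comps k f n"
  "comps k (r *\<^sub>R f) n = r *\<^sub>R comps k f n"
  "comps k (sum F I) n = (\<Sum>i\<in>I. comps k (F i) n)"
  by (simp_all add: comps_def)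

section \<open>Homogeneous superfields and graded commutativity\<close>

context closed_3d_forms
begin

text \<open>More than homogeneity of parity: the ghost degree must be exactly k - p, so that the
  axioms of the form algebra apply to the components.\<close>

definition super_hom :: "int \<Rightarrow> 'w super \<Rightarrow> bool" where
  "super_hom k f \<longleftrightarrow>
    (\<forall>p b. cmp f p b \<in> (if b = odd (k - int p) then bideg K (k - int p) p else {0}))"

lemma super_homD:
  "super_hom k f \<Longrightarrow> cmp f p (odd (k - int p)) \<in> bideg K (k - int p) p"
  "super_hom k f \<Longrightarrow> b \<noteq> odd (k - int p) \<Longrightarrow> cmp f p b = 0"
  unfolding super_hom_def by (metis, metis singletonD)

lemma comps_bideg: "super_hom k f \<Longrightarrow> comps k f p \<in> bideg K (k - int p) p"
  unfolding comps_def by (rule super_homD(1))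

lemma super_hom_subspace: "subspace {f. super_hom k f}"
proof -
  have "subspace (if b then bideg K g p else {0})" for b g p
    by (simp add: bideg_subspace)
  note * = subspace_0[OF this] subspace_add[OF this] subspace_scale[OF this]
  show ?thesis
    unfolding super_hom_def by (auto simp only: subspace_def mem_Collect_eq cmp_simps intro!: * split del: if_split)
qed

lemma super_hom_intros:
  "super_hom k 0"
  "super_hom k f \<Longrightarrow> super_hom k g \<Longrightarrow> super_hom k (f + g)"
  "super_hom k f \<Longrightarrow> super_hom k g \<Longrightarrow> super_hom k (f - g)"
  "super_hom k f \<Longrightarrow> super_hom k (- f)"
  "super_hom k f \<Longrightarrow> super_hom k (r *\<^sub>R f)"
  using subspace_0[OF super_hom_subspace] subspace_add[OF super_hom_subspace]
    subspace_diff[OF super_hom_subspace] subspace_neg[OF super_hom_subspace]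
    subspace_scale[OF super_hom_subspace]
  by auto

lemma super_hom_sum: "(\<And>i. i \<in> I \<Longrightarrow> super_hom k (F i)) \<Longrightarrow> super_hom k (sum F I)"
  using subspace_sum[OF super_hom_subspace, of I F k] by simp

lemma super_hom_homogeneous:
  "(\<And>p. u p \<in> bideg K (k - int p) p) \<Longrightarrow> super_hom k (homogeneous k u)"
  unfolding super_hom_def homogeneous_def super.sel
  by (intro allI) (simp only: singleton_iff split: if_split, blast)

lemma super_hom_eqI:
  assumes "super_hom k f" "super_hom k g" "\<And>n. comps k f n = comps k g n"
  shows "f = g"
proof (rule super_eqI)
  show "cmp f n b = cmp g n b" for n b
    using assms super_homD(2)[OF assms(1)] super_homD(2)[OF assms(2)]
    by (cases "b = odd (k - int n)") (auto simp: comps_def)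
qed

lemma super_hom_mult:
  assumes f: "super_hom k f" and g: "super_hom l g"
  shows "super_hom (k + l) (f * g)"
  unfolding super_hom_def
proof (intro allI)
  fix n c
  let ?T = "if c = odd (k + l - int n) then bideg K (k + l - int n) n else {0}"
  have sub: "subspace ?T" by (simp add: bideg_subspace)
  have "cmp f p a * cmp g (n - p) (a \<noteq> c) \<in> ?T" if "p \<le> n" for p a
  proof (cases "a = odd (k - int p) \<and> (a \<noteq> c) = odd (l - int (n - p))")
    case True
    then have "cmp f p a * cmp g (n - p) (a \<noteq> c) \<in> bideg K (k - int p + (l - int (n - p))) (p + (n - p))"
      using super_homD(1)[OF f, of p] super_homD(1)[OF g, of "n - p"] by (auto intro: mult_bideg)
    moreover have "c = odd (k + l - int n)"
      using True that by (auto simp: of_nat_diff)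
    ultimately show ?thesis using that by (simp add: of_nat_diff algebra_simps)
  next
    case False
    then have "cmp f p a = 0 \<or> cmp g (n - p) (a \<noteq> c) = 0"
      using super_homD(2)[OF f, of a p] super_homD(2)[OF g, of "a \<noteq> c" "n - p"] by argo
    then have "cmp f p a * cmp g (n - p) (a \<noteq> c) = 0"
      by (elim disjE) (simp_all only: mult_zero_left mult_zero_right)
    then show ?thesis using subspace_0[OF sub] by simp
  qed
  then show "cmp (f * g) n c \<in> ?T"
    unfolding cmp_mult by (intro subspace_sum[OF sub] subspace_scale[OF sub]) auto
qed

text \<open>In each form degree only one ghost parity of the first factor is nonzero. The sum over
  parities collapses to that term, and its sign is the one in \<open>sprod\<close>.\<close>

lemma comps_mult:
  assumes f: "super_hom k f" and g: "super_hom l g"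
  shows "comps (k + l) (f * g) n = sprod k (comps k f) (comps l g) n"
  unfolding comps_def[of "k + l"] cmp_mult sprod_def
proof (intro sum.cong refl)
  fix p assume "p \<in> {..n}"
  then have *: "(odd (k - int p) \<noteq> odd (k + l - int n)) = odd (l - int (n - p))"
    by (auto simp: of_nat_diff)
  have "(\<Sum>a\<in>UNIV. eps_sign (a \<and> odd (n - p)) *\<^sub>R
      (cmp f p a * cmp g (n - p) (a \<noteq> odd (k + l - int n)))) =
    (\<Sum>a\<in>{odd (k - int p)}. eps_sign (a \<and> odd (n - p)) *\<^sub>R
      (cmp f p a * cmp g (n - p) (a \<noteq> odd (k + l - int n))))"
    by (rule sum.mono_neutral_right) (auto simp: super_homD(2)[OF f])
  also have "\<dots> = sg ((k - int p) * int (n - p)) *\<^sub>R (comps k f p * comps l g (n - p))"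
    unfolding sum.insert_remove[OF finite.emptyI] using * by (simp add: comps_def eps_sign_def sg_def)
  finally show "(\<Sum>a\<in>UNIV. eps_sign (a \<and> odd (n - p)) *\<^sub>R
      (cmp f p a * cmp g (n - p) (a \<noteq> odd (k + l - int n)))) =
    sg ((k - int p) * int (n - p)) *\<^sub>R (comps k f p * comps l g (n - p))" .
qed

text \<open>For components of form degrees i and j, the conversion exponent (k - i)j plus the
  bigraded exponent ij + (k - i)(l - j) has the parity of kl + (l - j)i, which is kl plus the
  conversion exponent of the opposite product.\<close>

lemma super_comm:
  assumes f: "super_hom k f" and g: "super_hom l g"
  shows "f * g = sg (k * l) *\<^sub>R (g * f)"
proof (rule super_hom_eqI)
  show "super_hom (k + l) (f * g)" "super_hom (k + l) (sg (k * l) *\<^sub>R (g * f))"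
    using super_hom_mult[OF f g] super_hom_mult[OF g f] super_hom_intros(5) by (simp_all add: add.commute)
  fix n
  have "sprod k (comps k f) (comps l g) n = (\<Sum>p\<le>n. sg ((k - int (n - p)) * int (n - (n - p))) *\<^sub>R
      (comps k f (n - p) * comps l g (n - (n - p))))"
    unfolding sprod_def by (rule sum.reindex_bij_witness[of _ "\<lambda>p. n - p" "\<lambda>p. n - p"]) auto
  also have "\<dots> = sg (k * l) *\<^sub>R sprod l (comps l g) (comps k f) n"
    unfolding sprod_def scaleR_sum_right
  proof (intro sum.cong refl)
    fix p assume "p \<in> {..n}"
    then have p: "n - (n - p) = p" by simp
    show "sg ((k - int (n - p)) * int (n - (n - p))) *\<^sub>R (comps k f (n - p) * comps l g (n - (n - p)))
      = sg (k * l) *\<^sub>R sg ((l - int p) * int (n - p)) *\<^sub>R (comps l g p * comps k f (n - p))"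
      unfolding p graded_comm[OF comps_bideg[OF f, of "n - p"] comps_bideg[OF g, of p]]
      by (auto simp: sg_def)
  qed
  finally show "comps (k + l) (f * g) n = comps (k + l) (sg (k * l) *\<^sub>R (g * f)) n"
    using comps_mult[OF f g] comps_mult[OF g f] by (simp add: add.commute)
qed

end

section \<open>The operator \<open>tot_dif\<close> and its Leibniz rule\<close>

locale ghost_derivation = closed_3d_forms K
  for K :: "('w::real_algebra_1, 'r::real_vector) form_algebra" +
  fixes s :: "'w \<Rightarrow> 'w"
  assumes s_linear: "linear s"
    and s_bideg: "\<alpha> \<in> bideg K g f \<Longrightarrow> s \<alpha> \<in> bideg K (g + 1) f"
    and s_mult: "\<alpha> \<in> bideg K g f \<Longrightarrow> \<beta> \<in> bideg K g' f' \<Longrightarrow>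
      s (\<alpha> * \<beta>) = s \<alpha> * \<beta> + sg g *\<^sub>R (\<alpha> * s \<beta>)"
    and s_dif: "\<alpha> \<in> bideg K g f \<Longrightarrow> s (dif K \<alpha>) = dif K (s \<alpha>)"
begin

text \<open>The operator \<open>d \<plusminus> s\<close> on elements of total degree \<open>k\<close>.  The sign of \<open>s\<close> turns the
  commutation of \<open>s\<close> with \<open>d\<close> into anticommutation, so that this operator squares to \<open>s\<^sup>2\<close>.\<close>
definition tot_dif :: "int \<Rightarrow> 'w super \<Rightarrow> 'w super" where
  "tot_dif k f = homogeneous (k + 1) (\<lambda>n. sdif K (comps k f) n + sg (int n) *\<^sub>R s (comps k f n))"

lemma comps_tot_dif:
  "k' = k + 1 \<Longrightarrow> comps k' (tot_dif k f) n = sdif K (comps k f) n + sg (int n) *\<^sub>R s (comps k f n)"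
  by (simp add: tot_dif_def)

lemma super_hom_tot_dif:
  assumes "super_hom k f"
  shows "super_hom (k + 1) (tot_dif k f)"
  unfolding tot_dif_def
proof (rule super_hom_homogeneous)
  fix p
  have "sdif K (comps k f) p \<in> bideg K (k + 1 - int p) p"
    using subspace_0[OF bideg_subspace] dif_bideg[OF comps_bideg[OF assms]]
    by (auto simp: sdif_def split: nat.split)
  moreover have "s (comps k f p) \<in> bideg K (k + 1 - int p) p"
    using s_bideg[OF comps_bideg[OF assms, of p]] by (simp add: algebra_simps)
  ultimately show "sdif K (comps k f) p + sg (int p) *\<^sub>R s (comps k f p) \<in> bideg K (k + 1 - int p) p"
    by (intro subspace_add subspace_scale bideg_subspace)
qed

lemma tot_dif_linear: "linear (tot_dif k)"
proof
  note d = linear_add[OF dif_linear] linear_cmul[OF dif_linear] linear_add[OF s_linear] linear_cmul[OF s_linear]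
  fix f g r
  show "tot_dif k (f + g) = tot_dif k f + tot_dif k g"
    by (rule super_eqI) (auto simp: tot_dif_def homogeneous_def sdif_def d algebra_simps split: nat.split)
  show "tot_dif k (r *\<^sub>R f) = r *\<^sub>R tot_dif k f"
    by (rule super_eqI) (auto simp: tot_dif_def homogeneous_def sdif_def d algebra_simps split: nat.split)
qed

text \<open>Raising the form degree of the second factor changes the conversion sign by (-1)^(k -
  p), which turns the (-1)^p of \<open>dif_mult\<close> into (-1)^k.\<close>

lemma sdif_sprod:
  assumes u: "\<And>p. u p \<in> bideg K (k - int p) p" and v: "\<And>p. v p \<in> bideg K (l - int p) p"
  shows "sdif K (sprod k u v) n = sprod (k + 1) (sdif K u) v n + sg k *\<^sub>R sprod k u (sdif K v) n"
proof (cases n)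
  case 0
  then show ?thesis by (simp add: sdif_def sprod_def)
next
  case (Suc m)
  \<comment> \<open>The component of \<open>sdif K u\<close> in degree 0 vanishes, so the sum starts
    at 1 and is shifted; below, the component of \<open>sdif K v\<close> in degree 0 removes the
    last term instead.\<close>
  have 1: "sprod (k + 1) (sdif K u) v n =
      (\<Sum>p\<le>m. sg ((k - int p) * int (m - p)) *\<^sub>R (dif K (u p) * v (m - p)))"
    unfolding Suc sprod_def sum.atMost_Suc_shift by (simp add: sdif_def)
  have 2: "sprod k u (sdif K v) n =
      (\<Sum>p\<le>m. sg ((k - int p) * int (Suc m - p)) *\<^sub>R (u p * dif K (v (m - p))))"
    unfolding Suc sprod_def sum.atMost_Suc by (simp add: sdif_def Suc_diff_le)
  have "sdif K (sprod k u v) n =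
      (\<Sum>p\<le>m. sg ((k - int p) * int (m - p)) *\<^sub>R (dif K (u p) * v (m - p) + sg (int p) *\<^sub>R (u p * dif K (v (m - p)))))"
    unfolding Suc sdif_def sprod_def
    by (simp add: linear_sum[OF dif_linear] linear_cmul[OF dif_linear] dif_mult[OF u v])
  also have "\<dots> = sprod (k + 1) (sdif K u) v n + sg k *\<^sub>R sprod k u (sdif K v) n"
    unfolding 1 2 scaleR_sum_right sum.distrib[symmetric]
    by (intro sum.cong refl) (auto simp: sg_def algebra_simps Suc_diff_le)
  finally show ?thesis .
qed

text \<open>The twist (-1)^p of s combines with the ghost sign (-1)^(k - p) of \<open>s_mult\<close>
  to (-1)^k, so that s follows the same rule as d in \<open>sdif_sprod\<close>.\<close>

lemma s_sprod:
  assumes u: "\<And>p. u p \<in> bideg K (k - int p) p" and v: "\<And>p. v p \<in> bideg K (l - int p) p"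
  shows "sg (int n) *\<^sub>R s (sprod k u v n) = sprod (k + 1) (\<lambda>p. sg (int p) *\<^sub>R s (u p)) v n
    + sg k *\<^sub>R sprod k u (\<lambda>p. sg (int p) *\<^sub>R s (v p)) n"
  unfolding sprod_def linear_sum[OF s_linear] linear_cmul[OF s_linear] s_mult[OF u v]
    scaleR_sum_right sum.distrib[symmetric]
  by (intro sum.cong refl) (auto simp: sg_def algebra_simps of_nat_diff)

lemma tot_dif_mult:
  assumes f: "super_hom k f" and g: "super_hom l g"
  shows "tot_dif (k + l) (f * g) = tot_dif k f * g + sg k *\<^sub>R (f * tot_dif l g)"
proof (rule super_hom_eqI)
  note Df = super_hom_tot_dif[OF f] and Dg = super_hom_tot_dif[OF g]
  show "super_hom (k + l + 1) (tot_dif (k + l) (f * g))"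
    by (intro super_hom_tot_dif super_hom_mult f g)
  have e: "k + l + 1 = k + 1 + l" "k + l + 1 = k + (l + 1)" by simp_all
  show "super_hom (k + l + 1) (tot_dif k f * g + sg k *\<^sub>R (f * tot_dif l g))"
    using super_hom_mult[OF Df g] super_hom_mult[OF f Dg]
    by (intro super_hom_intros) (simp_all only: e[symmetric])
  fix n
  have fg: "comps (k + l) (f * g) = sprod k (comps k f) (comps l g)"
    by (rule ext) (rule comps_mult[OF f g])
  have add: "sprod j (\<lambda>p. u p + u' p) v n = sprod j u v n + sprod j u' v n"
    "sprod j u (\<lambda>p. v p + v' p) n = sprod j u v n + sprod j u v' n" for j u u' and v v' :: "nat \<Rightarrow> 'w"
    unfolding sprod_def sum.distrib[symmetric] by (simp_all add: algebra_simps)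
  have "comps (k + l + 1) (tot_dif k f * g) n = sprod (k + 1) (comps (k + 1) (tot_dif k f)) (comps l g) n"
    unfolding e(1) by (rule comps_mult[OF Df g])
  moreover have "comps (k + l + 1) (f * tot_dif l g) n = sprod k (comps k f) (comps (l + 1) (tot_dif l g)) n"
    unfolding e(2) by (rule comps_mult[OF f Dg])
  ultimately show "comps (k + l + 1) (tot_dif (k + l) (f * g)) n =
      comps (k + l + 1) (tot_dif k f * g + sg k *\<^sub>R (f * tot_dif l g)) n"
    unfolding comps_simps tot_dif_def comps_homogeneous fg add
      sdif_sprod[OF comps_bideg[OF f] comps_bideg[OF g]] s_sprod[OF comps_bideg[OF f] comps_bideg[OF g]]
    by (simp add: algebra_simps)
qed

lemma comps_tot_dif_tot_dif:
  assumes f: "super_hom k f" and k: "k' = k + 1" "k'' = k' + 1"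
  shows "comps k'' (tot_dif k' (tot_dif k f)) n = s (s (comps k f n))"
proof (cases n)
  case 0
  then show ?thesis
    by (simp add: comps_tot_dif[OF k(1)] comps_tot_dif[OF k(2)] sdif_def sg_def)
next
  case (Suc m)
  note b = comps_bideg[OF f]
  note d = linear_add[OF dif_linear] linear_cmul[OF dif_linear] linear_add[OF s_linear] linear_cmul[OF s_linear]
  have "dif K (sdif K (comps k f) m) = 0"
    by (auto simp: sdif_def linear_0[OF dif_linear] dif_dif[OF b] split: nat.split)
  then show ?thesis using s_dif[OF b, of m]
    by (simp add: Suc comps_tot_dif[OF k(1)] comps_tot_dif[OF k(2)] sdif_def d sg_def)
qed

end

section \<open>Pulled back functions\<close>

context courant_algebroid_data
begin

lemmas smooth_intros [simp] =
  anchor_smooth flux_smooth smooth_fun_pd smooth_fun_const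
  smooth_fun_add[OF open_patch] smooth_fun_mult[OF open_patch] smooth_fun_sum[OF open_patch]

lemma smooth_fun_uminus [simp]:
  assumes "smooth_fun (patch Q) f" shows "smooth_fun (patch Q) (\<lambda>x. - f x)"
  using smooth_fun_mult[OF open_patch smooth_fun_const[of _ "-1"] assms] by simp

lemma smooth_fun_diff [simp]:
  assumes "smooth_fun (patch Q) f" "smooth_fun (patch Q) g"
  shows "smooth_fun (patch Q) (\<lambda>x. f x - g x)"
  using smooth_fun_add[OF open_patch assms(1) smooth_fun_uminus[OF assms(2)]] by simp

lemma pd_diff:
  assumes "smooth_fun (patch Q) f" "smooth_fun (patch Q) g" "x \<in> patch Q"
  shows "pd \<mu> (\<lambda>x. f x - g x) x = pd \<mu> f x - pd \<mu> g x"
proof -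
  have "pd \<mu> (\<lambda>x. f x + (-1) * g x) x = pd \<mu> f x + pd \<mu> (\<lambda>x. (-1) * g x) x"
    using assms by (intro pd_add[OF open_patch]) simp_all
  also have "pd \<mu> (\<lambda>x. (-1) * g x) x = (-1) * pd \<mu> g x"
    using assms by (intro pd_cmult[OF open_patch])
  finally show ?thesis by simp
qed

lemma eta_eta_inv_matrix: "eta Q ** matrix_inv (eta Q) = mat 1" "matrix_inv (eta Q) ** eta Q = mat 1"
  using someI_ex[OF eta_nondegenerate[unfolded invertible_def]] by (simp_all add: matrix_inv_def)

text \<open>Transposing eta B = 1 makes the transpose of B a left inverse of the symmetric matrix
  eta, and multiplying by the right inverse B identifies it with B.\<close>

lemma eta_inv_sym: "eta_inv Q a b = eta_inv Q b a"
proof -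
  let ?A = "eta Q" and ?B = "matrix_inv (eta Q)"
  note AB = eta_eta_inv_matrix
  have "transpose ?B ** ?A = transpose (?A ** ?B)"
    by (simp only: matrix_transpose_mul eta_sym)
  then have "transpose ?B ** ?A = mat 1"
    by (simp only: AB transpose_mat)
  then have "transpose ?B ** (?A ** ?B) = ?B"
    by (simp only: matrix_mul_assoc matrix_mul_lid)
  then have "transpose ?B = ?B"
    by (simp only: AB matrix_mul_rid)
  then have "transpose ?B $ a $ b = ?B $ a $ b"
    by simp
  then show ?thesis
    by (simp add: eta_inv_def transpose_def)
qed

lemma eta_eta_inv: "(\<Sum>b\<in>UNIV. eta Q $ a $ b * eta_inv Q b c) = (if a = c then 1 else 0)"
proof -
  have "(eta Q ** matrix_inv (eta Q)) $ a $ c = (mat 1 :: real^'a^'a) $ a $ c"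
    by (simp add: eta_eta_inv_matrix)
  then show ?thesis by (simp add: matrix_matrix_mult_def mat_def eta_inv_def)
qed

end

locale courant_sigma_model =
  courant_algebroid_data Q + bv_field_content K "patch Q" \<Phi>
  for Q :: "('m::finite, 'a::finite) courant_data"
    and K :: "('w::real_algebra_1, 'r::real_vector) form_algebra"
    and \<Phi> :: "('m, 'a, 'w) bv_fields"
begin

lemma ev_0 [simp]: "ev \<Phi> (\<lambda>x. 0) = 0"
  using ev_const[of 0] by simp

lemma ev_cmult: "smooth_fun (patch Q) f \<Longrightarrow> ev \<Phi> (\<lambda>x. c * f x) = c *\<^sub>R ev \<Phi> f"
  by (simp add: ev_mult ev_const of_real_def)

lemma ev_uminus: "smooth_fun (patch Q) f \<Longrightarrow> ev \<Phi> (\<lambda>x. - f x) = - ev \<Phi> f"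
  using ev_cmult[of f "-1"] by simp

lemma ev_diff:
  "smooth_fun (patch Q) f \<Longrightarrow> smooth_fun (patch Q) g \<Longrightarrow> ev \<Phi> (\<lambda>x. f x - g x) = ev \<Phi> f - ev \<Phi> g"
  using ev_add[of f "\<lambda>x. - g x"] by (simp add: ev_uminus)

lemma ev_sum:
  "(\<And>i. i \<in> I \<Longrightarrow> smooth_fun (patch Q) (f i)) \<Longrightarrow> ev \<Phi> (\<lambda>x. \<Sum>i\<in>I. f i x) = (\<Sum>i\<in>I. ev \<Phi> (f i))"
  by (induction I rule: infinite_finite_induct) (simp_all add: ev_add)

lemmas ev_simps = ev_add ev_mult ev_cmult ev_uminus ev_diff ev_sum

text \<open>The patch is open, so a function that vanishes on it has vanishing partials there. This
  is the source of the differentiated axioms.\<close>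

lemma ev_eq_0:
  assumes "\<And>x. x \<in> patch Q \<Longrightarrow> f x = 0"
  shows "ev \<Phi> f = 0" "ev \<Phi> (pd \<kappa> f) = 0"
proof -
  show "ev \<Phi> f = 0" using ev_cong[of f "\<lambda>x. 0"] assms by simp
  have "pd \<kappa> f x = 0" if "x \<in> patch Q" for x
    using pd_cong_open[OF open_patch that, of f "\<lambda>x. 0"] assms by simp
  then show "ev \<Phi> (pd \<kappa> f) = 0" using ev_cong[of "pd \<kappa> f" "\<lambda>x. 0"] by simp
qed

lemma ev_pd_commute:
  "smooth_fun (patch Q) f \<Longrightarrow> ev \<Phi> (pd \<mu> (pd \<nu> f)) = ev \<Phi> (pd \<nu> (pd \<mu> f))"
  by (rule ev_cong) (simp add: pd_commute[OF open_patch])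

text \<open>Pullback along X alone, concentrated in form degree 0; unlike \<open>super_ev\<close> it
  has no Taylor terms in the antifields.\<close>

definition E :: "(real^'m \<Rightarrow> real) \<Rightarrow> 'w super" where
  "E f = homogeneous 0 (of_comps [ev \<Phi> f])"

lemma E_hom: "smooth_fun (patch Q) f \<Longrightarrow> super_hom 0 (E f)"
  unfolding E_def
proof (rule super_hom_homogeneous)
  fix p assume "smooth_fun (patch Q) f"
  then show "of_comps [ev \<Phi> f] p \<in> bideg K (0 - int p) p"
    by (cases p) (simp_all add: of_comps_expand ev_bideg subspace_0[OF bideg_subspace])
qed

lemma comps_E [simp]: "comps 0 (E f) = of_comps [ev \<Phi> f]"
  by (simp add: E_def)

lemma E_simps:
  assumes f: "smooth_fun (patch Q) f" and g: "smooth_fun (patch Q) g"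
  shows "E (\<lambda>x. f x * g x) = E f * E g"
    and "E (\<lambda>x. f x + g x) = E f + E g"
    and "E (\<lambda>x. f x - g x) = E f - E g"
proof -
  have *: "comps 0 (E f * E g) n = sprod 0 (of_comps [ev \<Phi> f]) (of_comps [ev \<Phi> g]) n" for n
    using comps_mult[OF E_hom[OF f] E_hom[OF g]] by simp
  show "E (\<lambda>x. f x * g x) = E f * E g"
  proof (rule super_hom_eqI)
    show "super_hom 0 (E f * E g)" using super_hom_mult[OF E_hom[OF f] E_hom[OF g]] by simp
    show "comps 0 (E (\<lambda>x. f x * g x)) n = comps 0 (E f * E g) n" for n
    proof (cases n)
      case (Suc m)
      have "of_comps [ev \<Phi> f] p * of_comps [ev \<Phi> g] (Suc m - p) = 0" for p
        by (cases p) (simp_all add: of_comps_expand)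
      then show ?thesis unfolding * Suc by (simp add: sprod_def of_comps_expand)
    qed (simp add: * sprod_def of_comps_expand sg_def ev_mult f g)
  qed (simp add: E_hom f g)
  show "E (\<lambda>x. f x + g x) = E f + E g"
    "E (\<lambda>x. f x - g x) = E f - E g"
    by (rule super_eqI, simp add: E_def homogeneous_def of_comps_def ev_simps f g)+
qed

lemma E_sum:
  "(\<And>i. i \<in> I \<Longrightarrow> smooth_fun (patch Q) (f i)) \<Longrightarrow> E (\<lambda>x. \<Sum>i\<in>I. f i x) = (\<Sum>i\<in>I. E (f i))"
  by (rule super_eqI) (simp add: E_def homogeneous_def of_comps_def ev_sum)

lemma E_cong: "(\<And>x. x \<in> patch Q \<Longrightarrow> f x = g x) \<Longrightarrow> E f = E g"
  unfolding E_def using ev_cong[of f g] by simp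

lemma E_const_mult: "E (\<lambda>x. c) * z = c *\<^sub>R z"
proof (rule super_eqI)
  fix n b
  have "cmp (E (\<lambda>x. c)) p a = (if p = 0 then if a then 0 else of_real c else 0)" for p a
    by (cases p) (auto simp: E_def homogeneous_def of_comps_expand ev_const)
  then have "cmp (E (\<lambda>x. c) * z) n b =
      (\<Sum>p\<le>n. if p = 0 then of_real c * cmp z n b else 0)"
    unfolding cmp_mult by (intro sum.cong refl) (simp add: UNIV_bool)
  then show "cmp (E (\<lambda>x. c) * z) n b = cmp (c *\<^sub>R z) n b"
    by (simp add: of_real_def)
qed

lemma E_0 [simp]: "E (\<lambda>x. 0) = 0"
  by (rule super_eqI) (simp add: E_def homogeneous_def of_comps_def)

lemma E_pd_simps:
  assumes "smooth_fun (patch Q) f" "smooth_fun (patch Q) g"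
  shows "E (pd \<kappa> (\<lambda>x. f x + g x)) = E (pd \<kappa> f) + E (pd \<kappa> g)"
    and "E (pd \<kappa> (\<lambda>x. f x - g x)) = E (pd \<kappa> f) - E (pd \<kappa> g)"
    and "E (pd \<kappa> (\<lambda>x. f x * g x)) = E (pd \<kappa> f) * E g + E f * E (pd \<kappa> g)"
proof -
  note pd' = smooth_fun_pd[OF assms(1), of \<kappa>] smooth_fun_pd[OF assms(2), of \<kappa>]
  show "E (pd \<kappa> (\<lambda>x. f x + g x)) = E (pd \<kappa> f) + E (pd \<kappa> g)"
    by (subst E_simps(2)[symmetric], fact, fact, rule E_cong) (simp add: pd_add[OF open_patch] assms)
  show "E (pd \<kappa> (\<lambda>x. f x - g x)) = E (pd \<kappa> f) - E (pd \<kappa> g)"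
    by (subst E_simps(3)[symmetric], fact, fact, rule E_cong) (simp add: pd_diff assms)
  have "E (pd \<kappa> (\<lambda>x. f x * g x)) = E (\<lambda>x. pd \<kappa> f x * g x + f x * pd \<kappa> g x)"
    by (rule E_cong) (simp add: pd_mult[OF open_patch] assms)
  then show "E (pd \<kappa> (\<lambda>x. f x * g x)) = E (pd \<kappa> f) * E g + E f * E (pd \<kappa> g)"
    by (simp add: E_simps assms)
qed

lemma E_pd_sum:
  assumes "\<And>i. i \<in> I \<Longrightarrow> smooth_fun (patch Q) (f i)"
  shows "E (pd \<kappa> (\<lambda>x. \<Sum>i\<in>I. f i x)) = (\<Sum>i\<in>I. E (pd \<kappa> (f i)))"
proof -
  have "E (pd \<kappa> (\<lambda>x. \<Sum>i\<in>I. f i x)) = E (\<lambda>x. \<Sum>i\<in>I. pd \<kappa> (f i) x)"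
    by (rule E_cong) (simp add: pd_sum[OF open_patch] assms)
  then show ?thesis by (simp add: E_sum assms)
qed

lemma E_pd_commute:
  "smooth_fun (patch Q) f \<Longrightarrow> E (pd \<mu> (pd \<nu> f)) = E (pd \<nu> (pd \<mu> f))"
  by (rule E_cong) (simp add: pd_commute[OF open_patch])

lemma E_eq_0:
  assumes "\<And>x. x \<in> patch Q \<Longrightarrow> f x = 0"
  shows "E f = 0" "E (pd \<kappa> f) = 0"
  using ev_eq_0[of f, OF assms] by (auto intro!: super_eqI simp: E_def homogeneous_def of_comps_def)

lemma E_comm:
  assumes "super_hom k z" "smooth_fun (patch Q) f"
  shows "z * E f = E f * z"
  using super_comm[OF assms(1) E_hom[OF assms(2)]] by (simp add: sg_def)

text \<open>Antisymmetry is an identity on an open set and so survives differentiation. Arbitrary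
  lists of derivatives are covered because they are the Taylor coefficients in
  \<open>super_ev\<close>.\<close>

lemma ev_flux_pds_antisym:
  "ev \<Phi> (pds l (flux Q b a c)) = - ev \<Phi> (pds l (flux Q a b c))"
  "ev \<Phi> (pds l (flux Q a c b)) = - ev \<Phi> (pds l (flux Q a b c))"
proof -
  have "pds l (\<lambda>x. - f x) x = - pds l f x" if "smooth_fun (patch Q) f" "x \<in> patch Q" for f x
    using that(2)
  proof (induction l arbitrary: x)
    case (Cons \<mu> l)
    have "pd \<mu> (pds l (\<lambda>x. - f x)) x = pd \<mu> (\<lambda>x. (-1) * pds l f x) x"
      by (rule pd_cong_open[OF open_patch Cons.prems]) (simp add: Cons.IH)
    also have "\<dots> = - pd \<mu> (pds l f) x"
      using Cons.prems that(1) by (subst pd_cmult[OF open_patch]) auto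
    finally show ?case by simp
  qed simp
  then have neg: "ev \<Phi> (pds l (\<lambda>x. - f x)) = - ev \<Phi> (pds l f)" if "smooth_fun (patch Q) f" for f
    using ev_cong[of "pds l (\<lambda>x. - f x)" "\<lambda>x. - pds l f x"] that by (simp add: ev_uminus)
  have cong: "ev \<Phi> (pds l f) = ev \<Phi> (pds l g)" if "\<And>x. x \<in> patch Q \<Longrightarrow> f x = g x" for f g
    by (rule ev_cong) (rule pds_cong_open[OF open_patch that])
  show "ev \<Phi> (pds l (flux Q b a c)) = - ev \<Phi> (pds l (flux Q a b c))"
    "ev \<Phi> (pds l (flux Q a c b)) = - ev \<Phi> (pds l (flux Q a b c))"
    using cong[OF flux_antisym(1)[of _ b a c]] cong[OF flux_antisym(2)[of _ a c b]]
      neg[of "flux Q a b c"] by simp_all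
qed

lemmas ev_antisym =
  ev_flux_pds_antisym[of "[]", unfolded pds.simps]
  ev_flux_pds_antisym[of "[\<kappa>]" for \<kappa>, unfolded pds.simps]
  ev_flux_pds_antisym[of "[\<sigma>, \<kappa>]" for \<sigma> \<kappa>, unfolded pds.simps]

lemma E_uminus_cong: "ev \<Phi> f = - ev \<Phi> g \<Longrightarrow> E f = - E g"
  by (rule super_eqI) (simp add: E_def homogeneous_def of_comps_def)

lemma flux_pd_antisym:
  "E (flux Q b a c) = - E (flux Q a b c)" "E (flux Q a c b) = - E (flux Q a b c)"
  "E (pd \<kappa> (flux Q b a c)) = - E (pd \<kappa> (flux Q a b c))"
  "E (pd \<kappa> (flux Q a c b)) = - E (pd \<kappa> (flux Q a b c))"
  "E (pd \<sigma> (pd \<kappa> (flux Q b a c))) = - E (pd \<sigma> (pd \<kappa> (flux Q a b c)))"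
  "E (pd \<sigma> (pd \<kappa> (flux Q a c b))) = - E (pd \<sigma> (pd \<kappa> (flux Q a b c)))"
  by (rule E_uminus_cong, rule ev_antisym)+

abbreviation R where "R a \<mu> \<equiv> E (anchor Q a \<mu>)"
abbreviation dR where "dR \<kappa> a \<mu> \<equiv> E (pd \<kappa> (anchor Q a \<mu>))"
abbreviation ddR where "ddR \<kappa> \<sigma> a \<mu> \<equiv> E (pd \<kappa> (pd \<sigma> (anchor Q a \<mu>)))"
abbreviation C where "C a b c \<equiv> E (flux Q a b c)"
abbreviation dC where "dC \<kappa> a b c \<equiv> E (pd \<kappa> (flux Q a b c))"
abbreviation ddC where "ddC \<kappa> \<sigma> a b c \<equiv> E (pd \<kappa> (pd \<sigma> (flux Q a b c)))"
abbreviation h where "h \<equiv> eta_inv Q"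

section \<open>The axioms and their first derivatives as identities between superfields\<close>

lemma E_axiom_i:
  "(\<Sum>a\<in>UNIV. \<Sum>b\<in>UNIV. h a b *\<^sub>R (R a \<mu> * R b \<nu>)) = 0" (is ?thesis1)
  "(\<Sum>a\<in>UNIV. \<Sum>b\<in>UNIV. h a b *\<^sub>R (dR \<kappa> a \<mu> * R b \<nu> + R a \<mu> * dR \<kappa> b \<nu>)) = 0" (is ?thesis2)
proof -
  let ?F = "\<lambda>x. (\<Sum>a\<in>UNIV. \<Sum>b\<in>UNIV. eta_inv Q a b * anchor Q a \<mu> x * anchor Q b \<nu> x)"
  have "E ?F = 0" "E (pd \<kappa> ?F) = 0"
    by (rule E_eq_0, rule axiom_i, assumption)+
  then show ?thesis1 ?thesis2
    by (simp_all add: E_sum E_simps E_const_mult E_pd_sum E_pd_simps mult.assoc)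
qed

lemma E_axiom_ii:
  "(\<Sum>\<mu>\<in>UNIV. R b \<mu> * dR \<mu> a \<nu>) - (\<Sum>\<mu>\<in>UNIV. R a \<mu> * dR \<mu> b \<nu>)
    + (\<Sum>e\<in>UNIV. \<Sum>f\<in>UNIV. h e f *\<^sub>R (R e \<nu> * C f a b)) = 0" (is ?thesis1)
  "(\<Sum>\<mu>\<in>UNIV. dR \<kappa> b \<mu> * dR \<mu> a \<nu> + R b \<mu> * ddR \<kappa> \<mu> a \<nu>)
    - (\<Sum>\<mu>\<in>UNIV. dR \<kappa> a \<mu> * dR \<mu> b \<nu> + R a \<mu> * ddR \<kappa> \<mu> b \<nu>)
    + (\<Sum>e\<in>UNIV. \<Sum>f\<in>UNIV. h e f *\<^sub>R (dR \<kappa> e \<nu> * C f a b + R e \<nu> * dC \<kappa> f a b)) = 0" (is ?thesis2)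
proof -
  let ?F = "\<lambda>x. (\<Sum>\<mu>\<in>UNIV. anchor Q b \<mu> x * pd \<mu> (anchor Q a \<nu>) x)
      - (\<Sum>\<mu>\<in>UNIV. anchor Q a \<mu> x * pd \<mu> (anchor Q b \<nu>) x)
      + (\<Sum>e\<in>UNIV. \<Sum>f\<in>UNIV. eta_inv Q e f * anchor Q e \<nu> x * flux Q f a b x)"
  have "E ?F = 0" "E (pd \<kappa> ?F) = 0"
    by (rule E_eq_0, rule axiom_ii, assumption)+
  then show ?thesis1 ?thesis2
    by (simp_all add: E_sum E_simps E_const_mult E_pd_sum E_pd_simps mult.assoc)
qed

lemma E_axiom_iii:
  "(\<Sum>\<mu>\<in>UNIV. R d \<mu> * dC \<mu> a b c - R a \<mu> * dC \<mu> b c d + R b \<mu> * dC \<mu> c d a - R c \<mu> * dC \<mu> d a b)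
    + (\<Sum>e\<in>UNIV. \<Sum>f\<in>UNIV. h e f *\<^sub>R (C e a b * C c d f + C e a c * C d b f + C e a d * C b c f)) = 0" (is ?thesis1)
  "(\<Sum>\<mu>\<in>UNIV. (dR \<kappa> d \<mu> * dC \<mu> a b c + R d \<mu> * ddC \<kappa> \<mu> a b c)
      - (dR \<kappa> a \<mu> * dC \<mu> b c d + R a \<mu> * ddC \<kappa> \<mu> b c d)
      + (dR \<kappa> b \<mu> * dC \<mu> c d a + R b \<mu> * ddC \<kappa> \<mu> c d a)
      - (dR \<kappa> c \<mu> * dC \<mu> d a b + R c \<mu> * ddC \<kappa> \<mu> d a b))
    + (\<Sum>e\<in>UNIV. \<Sum>f\<in>UNIV. h e f *\<^sub>R ((dC \<kappa> e a b * C c d f + C e a b * dC \<kappa> c d f)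
      + (dC \<kappa> e a c * C d b f + C e a c * dC \<kappa> d b f)
      + (dC \<kappa> e a d * C b c f + C e a d * dC \<kappa> b c f))) = 0" (is ?thesis2)
proof -
  let ?F = "\<lambda>x. (\<Sum>\<mu>\<in>UNIV. anchor Q d \<mu> x * pd \<mu> (flux Q a b c) x
        - anchor Q a \<mu> x * pd \<mu> (flux Q b c d) x
        + anchor Q b \<mu> x * pd \<mu> (flux Q c d a) x
        - anchor Q c \<mu> x * pd \<mu> (flux Q d a b) x)
      + (\<Sum>e\<in>UNIV. \<Sum>f\<in>UNIV. eta_inv Q e f *
          (flux Q e a b x * flux Q c d f x + flux Q e a c x * flux Q d b f x
           + flux Q e a d x * flux Q b c f x))"
  have "E ?F = 0" "E (pd \<kappa> ?F) = 0"
    by (rule E_eq_0, rule axiom_iii, assumption)+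
  then show ?thesis1 ?thesis2
    by (simp_all add: E_sum E_simps E_const_mult E_pd_sum E_pd_simps)
qed

end

section \<open>The axioms contracted with ghosts\<close>

context courant_sigma_model
begin

definition SA :: "'a \<Rightarrow> 'w super" where
  "SA a = homogeneous 1 (of_comps [eps \<Phi> a, fA \<Phi> a])"

definition SB :: "'m \<Rightarrow> 'w super" where
  "SB \<mu> = homogeneous 2 (of_comps [tpsi \<Phi> \<mu>, psi \<Phi> \<mu>, fB \<Phi> \<mu>])"

lemma SA_hom: "super_hom 1 (SA a)"
  unfolding SA_def
proof (rule super_hom_homogeneous)
  fix p show "of_comps [eps \<Phi> a, fA \<Phi> a] p \<in> bideg K (1 - int p) p"
    using fields_bideg subspace_0[OF bideg_subspace]
    by (simp add: of_comps_def nth_Cons split: nat.split)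
qed

lemma SB_hom: "super_hom 2 (SB \<mu>)"
  unfolding SB_def
proof (rule super_hom_homogeneous)
  fix p show "of_comps [tpsi \<Phi> \<mu>, psi \<Phi> \<mu>, fB \<Phi> \<mu>] p \<in> bideg K (2 - int p) p"
    using fields_bideg subspace_0[OF bideg_subspace]
    by (simp add: of_comps_def nth_Cons numeral_2_eq_2 split: nat.split)
qed

lemma SA_SA: "SA a * SA b = - (SA b * SA a)"
  by (rule trans[OF super_comm[OF SA_hom SA_hom]]) (simp add: sg_def)

lemma SA_SA_left: "SA a * (SA b * u) = - (SA b * (SA a * u))"
  by (simp only: mult.assoc[symmetric] SA_SA[of a b] mult_minus_left)

text \<open>Oriented towards one normal form: coefficient functions first, then \<open>SB\<close>,
  then \<open>SA\<close>.\<close>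

lemma comm_rules:
  "SA a * SB \<mu> = SB \<mu> * SA a"
  "smooth_fun (patch Q) f \<Longrightarrow> SA a * E f = E f * SA a"
  "smooth_fun (patch Q) f \<Longrightarrow> SB \<mu> * E f = E f * SB \<mu>"
  by (rule trans[OF super_comm[OF SA_hom SB_hom]], simp add: sg_def)
    (erule E_comm[OF SA_hom] E_comm[OF SB_hom])+

lemma left_commuteI: "x * y = y * x \<Longrightarrow> x * (y * u) = y * (x * u)" for x y u :: "'w super"
  by (simp only: mult.assoc[symmetric])

lemma comm_left_rules:
  "SA a * (SB \<mu> * u) = SB \<mu> * (SA a * u)"
  "smooth_fun (patch Q) f \<Longrightarrow> SA a * (E f * u) = E f * (SA a * u)"
  "smooth_fun (patch Q) f \<Longrightarrow> SB \<mu> * (E f * u) = E f * (SB \<mu> * u)"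
  by (rule left_commuteI, rule comm_rules; assumption)+

lemma E_E:
  "smooth_fun (patch Q) f \<Longrightarrow> smooth_fun (patch Q) g \<Longrightarrow> E f * E g = E g * E f"
  using E_comm[OF E_hom] .

lemmas collect = comm_rules comm_left_rules mult.assoc

lemmas expand = sum_distrib_left sum_distrib_right scaleR_sum_right sum.distrib sum_subtractf
  distrib_left distrib_right left_diff_distrib right_diff_distrib scaleR_add_right scaleR_diff_right

text \<open>The two index types are different, so this swap is a terminating rewrite that puts Greek
  sums outside.\<close>

lemma greek_out: "(\<Sum>a\<in>(UNIV::'a set). \<Sum>\<mu>\<in>(UNIV::'m set). f a \<mu>) = (\<Sum>\<mu>\<in>UNIV. \<Sum>a\<in>UNIV. f a \<mu>)"
  by (rule sum.swap)

lemma sum3_cyc: "(\<Sum>a\<in>(UNIV::'a set). \<Sum>b\<in>(UNIV::'a set). \<Sum>c\<in>(UNIV::'a set). f b c a) =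
    (\<Sum>a\<in>UNIV. \<Sum>b\<in>UNIV. \<Sum>c\<in>UNIV. f a b c)"
proof -
  have "(\<Sum>a\<in>UNIV. \<Sum>b\<in>UNIV. \<Sum>c\<in>UNIV. f b c a) = (\<Sum>b\<in>UNIV. \<Sum>a\<in>UNIV. \<Sum>c\<in>UNIV. f b c a)"
    by (rule sum.swap)
  also have "\<dots> = (\<Sum>b\<in>UNIV. \<Sum>c\<in>UNIV. \<Sum>a\<in>UNIV. f b c a)"
    by (rule sum.cong[OF refl]) (rule sum.swap)
  finally show ?thesis .
qed

lemma sum4_cyc: "(\<Sum>a\<in>(UNIV::'a set). \<Sum>b\<in>(UNIV::'a set). \<Sum>c\<in>(UNIV::'a set). \<Sum>d\<in>(UNIV::'a set). f b c d a) =
    (\<Sum>a\<in>UNIV. \<Sum>b\<in>UNIV. \<Sum>c\<in>UNIV. \<Sum>d\<in>UNIV. f a b c d)"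
proof -
  have "(\<Sum>a\<in>UNIV. \<Sum>b\<in>UNIV. \<Sum>c\<in>UNIV. \<Sum>d\<in>UNIV. f b c d a) =
      (\<Sum>b\<in>UNIV. \<Sum>a\<in>UNIV. \<Sum>c\<in>UNIV. \<Sum>d\<in>UNIV. f b c d a)"
    by (rule sum.swap)
  also have "\<dots> = (\<Sum>b\<in>UNIV. \<Sum>c\<in>UNIV. \<Sum>d\<in>UNIV. \<Sum>a\<in>UNIV. f b c d a)"
    by (rule sum.cong[OF refl]) (rule sum3_cyc)
  finally show ?thesis .
qed

lemma latin_out:
  "(\<Sum>a\<in>(UNIV::'a set). \<Sum>b\<in>(UNIV::'a set). \<Sum>c\<in>(UNIV::'a set). \<Sum>e\<in>(UNIV::'a set). \<Sum>f\<in>(UNIV::'a set). X a b c e f) =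
    (\<Sum>e\<in>UNIV. \<Sum>f\<in>UNIV. \<Sum>a\<in>UNIV. \<Sum>b\<in>UNIV. \<Sum>c\<in>UNIV. X a b c e f)"
proof -
  have "(\<Sum>a\<in>UNIV. \<Sum>b\<in>UNIV. \<Sum>c\<in>UNIV. \<Sum>e\<in>UNIV. \<Sum>f\<in>UNIV. X a b c e f) =
      (\<Sum>e\<in>UNIV. \<Sum>a\<in>UNIV. \<Sum>b\<in>UNIV. \<Sum>c\<in>UNIV. \<Sum>f\<in>UNIV. X a b c e f)"
    by (rule sum4_cyc[of "\<lambda>a b c e. \<Sum>f\<in>UNIV. X a b c e f", symmetric])
  also have "\<dots> = (\<Sum>e\<in>UNIV. \<Sum>f\<in>UNIV. \<Sum>a\<in>UNIV. \<Sum>b\<in>UNIV. \<Sum>c\<in>UNIV. X a b c e f)"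
    by (rule sum.cong[OF refl]) (rule sum4_cyc[symmetric])
  finally show ?thesis .
qed

lemma latin_out4:
  "(\<Sum>a\<in>(UNIV::'a set). \<Sum>b\<in>(UNIV::'a set). \<Sum>c\<in>(UNIV::'a set). \<Sum>d\<in>(UNIV::'a set).
      \<Sum>e\<in>(UNIV::'a set). \<Sum>f\<in>(UNIV::'a set). X a b c d e f) =
    (\<Sum>e\<in>UNIV. \<Sum>f\<in>UNIV. \<Sum>a\<in>UNIV. \<Sum>b\<in>UNIV. \<Sum>c\<in>UNIV. \<Sum>d\<in>UNIV. X a b c d e f)"
proof -
  have "(\<Sum>a\<in>UNIV. \<Sum>b\<in>UNIV. \<Sum>c\<in>UNIV. \<Sum>d\<in>UNIV. \<Sum>e\<in>UNIV. \<Sum>f\<in>UNIV. X a b c d e f) =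
      (\<Sum>a\<in>UNIV. \<Sum>e\<in>UNIV. \<Sum>f\<in>UNIV. \<Sum>b\<in>UNIV. \<Sum>c\<in>UNIV. \<Sum>d\<in>UNIV. X a b c d e f)"
    by (rule sum.cong[OF refl]) (rule latin_out)
  also have "\<dots> = (\<Sum>e\<in>UNIV. \<Sum>f\<in>UNIV. \<Sum>a\<in>UNIV. \<Sum>b\<in>UNIV. \<Sum>c\<in>UNIV. \<Sum>d\<in>UNIV. X a b c d e f)"
    by (rule sum3_cyc[of "\<lambda>e f a. \<Sum>b\<in>UNIV. \<Sum>c\<in>UNIV. \<Sum>d\<in>UNIV. X a b c d e f"])
  finally show ?thesis .
qed

text \<open>The prefix \<open>g\<close> marks contractions with the superfields \<open>SA\<close> and \<open>SB\<close>, in which the antifields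
  are set to zero; each \<open>d\<close> is a partial derivative, and the number after \<open>c\<close> counts the
  indices of \<open>C\<close> that are contracted.\<close>
definition gr where "gr \<nu> = (\<Sum>a\<in>UNIV. R a \<nu> * SA a)"
definition gdr where "gdr \<kappa> \<nu> = (\<Sum>a\<in>UNIV. dR \<kappa> a \<nu> * SA a)"
definition gddr where "gddr \<kappa> \<mu> \<nu> = (\<Sum>a\<in>UNIV. ddR \<kappa> \<mu> a \<nu> * SA a)"
definition gc1 where "gc1 a b = (\<Sum>c\<in>UNIV. C a b c * SA c)"
definition gc2 where "gc2 a = (\<Sum>b\<in>UNIV. \<Sum>c\<in>UNIV. C a b c * (SA b * SA c))"
definition gdc2 where "gdc2 \<kappa> a = (\<Sum>b\<in>UNIV. \<Sum>c\<in>UNIV. dC \<kappa> a b c * (SA b * SA c))"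
definition gdc3 where
  "gdc3 \<kappa> = (\<Sum>a\<in>UNIV. \<Sum>b\<in>UNIV. \<Sum>c\<in>UNIV. dC \<kappa> a b c * (SA a * (SA b * SA c)))"
definition gddc3 where
  "gddc3 \<kappa> \<mu> = (\<Sum>a\<in>UNIV. \<Sum>b\<in>UNIV. \<Sum>c\<in>UNIV. ddC \<kappa> \<mu> a b c * (SA a * (SA b * SA c)))"

lemma mult_hom: "super_hom k f \<Longrightarrow> super_hom l g \<Longrightarrow> m = k + l \<Longrightarrow> super_hom m (f * g)"
  using super_hom_mult by simp

lemma ghost_hom:
  "super_hom 1 (gr \<nu>)" "super_hom 1 (gdr \<kappa> \<nu>)" "super_hom 1 (gddr \<kappa> \<mu> \<nu>)" "super_hom 1 (gc1 a b)"
  "super_hom 2 (gc2 a)" "super_hom 2 (gdc2 \<kappa> a)" "super_hom 3 (gdc3 \<kappa>)" "super_hom 3 (gddc3 \<kappa> \<mu>)"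
  unfolding gr_def gdr_def gddr_def gc1_def gc2_def gdc2_def gdc3_def gddc3_def
  by ((intro super_hom_sum)?;
      (rule mult_hom, rule E_hom, simp, (rule SA_hom mult_hom | simp)+)+)+

text \<open>Only one of the two Latin indices is contracted; the free one is the index of
  \<open>master_A\<close>.\<close>

lemma axiom_ii_contracted:
  "(\<Sum>\<mu>\<in>UNIV. gr \<mu> * dR \<mu> b \<nu>) - (\<Sum>\<mu>\<in>UNIV. R b \<mu> * gdr \<mu> \<nu>)
    + (\<Sum>e\<in>UNIV. \<Sum>f\<in>UNIV. h e f *\<^sub>R (R e \<nu> * gc1 f b)) = 0"
proof -
  have "0 = (\<Sum>c\<in>UNIV. ((\<Sum>\<mu>\<in>UNIV. R c \<mu> * dR \<mu> b \<nu>) - (\<Sum>\<mu>\<in>UNIV. R b \<mu> * dR \<mu> c \<nu>)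
    + (\<Sum>e\<in>UNIV. \<Sum>f\<in>UNIV. h e f *\<^sub>R (R e \<nu> * C f b c))) * SA c)"
    by (simp add: E_axiom_ii)
  also have "\<dots> = (\<Sum>\<mu>\<in>UNIV. gr \<mu> * dR \<mu> b \<nu>) - (\<Sum>\<mu>\<in>UNIV. R b \<mu> * gdr \<mu> \<nu>)
    + (\<Sum>c\<in>UNIV. \<Sum>e\<in>UNIV. \<Sum>f\<in>UNIV. h e f *\<^sub>R (R e \<nu> * (C f b c * SA c)))"
    by (simp add: gr_def gdr_def expand collect greek_out)
  also have "(\<Sum>c\<in>UNIV. \<Sum>e\<in>UNIV. \<Sum>f\<in>UNIV. h e f *\<^sub>R (R e \<nu> * (C f b c * SA c))) =
     (\<Sum>e\<in>UNIV. \<Sum>f\<in>UNIV. h e f *\<^sub>R (R e \<nu> * gc1 f b))"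
    unfolding gc1_def expand
    by (rule sum3_cyc[of "\<lambda>e f c. h e f *\<^sub>R (R e \<nu> * (C f b c * SA c))"])
  finally show ?thesis by simp
qed

text \<open>The two anchor terms of axiom (ii) are exchanged by swapping a and b, and so is the
  product of the ghosts up to sign; contracted, they coincide and give the factor 2. The flux term
  changes sign because its indices come in the order opposite to the ghosts.\<close>

lemma axiom_ii_contracted_twice:
  "2 *\<^sub>R (\<Sum>\<mu>\<in>UNIV. gr \<mu> * gdr \<mu> \<nu>) - (\<Sum>e\<in>UNIV. \<Sum>f\<in>UNIV. h e f *\<^sub>R (R e \<nu> * gc2 f)) = 0"
  "2 *\<^sub>R (\<Sum>\<mu>\<in>UNIV. gdr \<kappa> \<mu> * gdr \<mu> \<nu> + gr \<mu> * gddr \<kappa> \<mu> \<nu>)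
    - (\<Sum>e\<in>UNIV. \<Sum>f\<in>UNIV. h e f *\<^sub>R (dR \<kappa> e \<nu> * gc2 f + R e \<nu> * gdc2 \<kappa> f)) = 0"
proof -
  \<comment> \<open>Stated for arbitrary coefficient functions, so as to serve both axiom (ii) and
    its derivative.\<close>
  have P: "(\<Sum>b\<in>UNIV. \<Sum>a\<in>UNIV. (\<Sum>\<mu>\<in>UNIV. E (f b \<mu>) * E (g \<mu> a)) * (SA b * SA a)) =
      (\<Sum>\<mu>\<in>UNIV. (\<Sum>b\<in>UNIV. E (f b \<mu>) * SA b) * (\<Sum>a\<in>UNIV. E (g \<mu> a) * SA a))"
    "(\<Sum>b\<in>UNIV. \<Sum>a\<in>UNIV. (\<Sum>\<mu>\<in>UNIV. E (f a \<mu>) * E (g \<mu> b)) * (SA b * SA a)) =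
      - (\<Sum>\<mu>\<in>UNIV. (\<Sum>b\<in>UNIV. E (f b \<mu>) * SA b) * (\<Sum>a\<in>UNIV. E (g \<mu> a) * SA a))"
    if "\<And>b \<mu>. smooth_fun (patch Q) (f b \<mu>)" "\<And>b \<mu>. smooth_fun (patch Q) (g \<mu> b)"
    for f :: "'a \<Rightarrow> 'm \<Rightarrow> _" and g :: "'m \<Rightarrow> 'a \<Rightarrow> _"
  proof -
    show 1: "(\<Sum>b\<in>UNIV. \<Sum>a\<in>UNIV. (\<Sum>\<mu>\<in>UNIV. E (f b \<mu>) * E (g \<mu> a)) * (SA b * SA a)) =
      (\<Sum>\<mu>\<in>UNIV. (\<Sum>b\<in>UNIV. E (f b \<mu>) * SA b) * (\<Sum>a\<in>UNIV. E (g \<mu> a) * SA a))"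
      using that unfolding sum_product by (simp add: expand collect greek_out)
    have "(\<Sum>b\<in>UNIV. \<Sum>a\<in>UNIV. (\<Sum>\<mu>\<in>UNIV. E (f a \<mu>) * E (g \<mu> b)) * (SA b * SA a)) =
      (\<Sum>a\<in>UNIV. \<Sum>b\<in>UNIV. (\<Sum>\<mu>\<in>UNIV. E (f a \<mu>) * E (g \<mu> b)) * (SA b * SA a))"
      by (rule sum.swap)
    also have "\<dots> = (\<Sum>a\<in>UNIV. \<Sum>b\<in>UNIV. - ((\<Sum>\<mu>\<in>UNIV. E (f a \<mu>) * E (g \<mu> b)) * (SA a * SA b)))"
      by (intro sum.cong refl) (subst SA_SA, rule mult_minus_right)
    finally have "(\<Sum>b\<in>UNIV. \<Sum>a\<in>UNIV. (\<Sum>\<mu>\<in>UNIV. E (f a \<mu>) * E (g \<mu> b)) * (SA b * SA a)) =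
      - (\<Sum>b\<in>UNIV. \<Sum>a\<in>UNIV. (\<Sum>\<mu>\<in>UNIV. E (f b \<mu>) * E (g \<mu> a)) * (SA b * SA a))"
      by (simp only: sum_negf)
    then show "(\<Sum>b\<in>UNIV. \<Sum>a\<in>UNIV. (\<Sum>\<mu>\<in>UNIV. E (f a \<mu>) * E (g \<mu> b)) * (SA b * SA a)) =
      - (\<Sum>\<mu>\<in>UNIV. (\<Sum>b\<in>UNIV. E (f b \<mu>) * SA b) * (\<Sum>a\<in>UNIV. E (g \<mu> a) * SA a))"
      by (simp only: 1)
  qed
  have V: "(\<Sum>b\<in>UNIV. \<Sum>a\<in>UNIV. (\<Sum>e\<in>UNIV. \<Sum>f\<in>UNIV. h e f *\<^sub>R (E (u e) * E (v f a b))) * (SA b * SA a)) =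
      - (\<Sum>e\<in>UNIV. \<Sum>f\<in>UNIV. h e f *\<^sub>R (E (u e) * (\<Sum>a\<in>UNIV. \<Sum>b\<in>UNIV. E (v f a b) * (SA a * SA b))))"
    if "\<And>e. smooth_fun (patch Q) (u e)" "\<And>f a b. smooth_fun (patch Q) (v f a b)"
    for u :: "'a \<Rightarrow> _" and v :: "'a \<Rightarrow> 'a \<Rightarrow> 'a \<Rightarrow> _"
  proof -
    let ?X = "\<lambda>a b e f. h e f *\<^sub>R (E (u e) * (E (v f a b) * (SA a * SA b)))"
    have "(\<Sum>b\<in>UNIV. \<Sum>a\<in>UNIV. (\<Sum>e\<in>UNIV. \<Sum>f\<in>UNIV. h e f *\<^sub>R (E (u e) * E (v f a b))) * (SA b * SA a)) =
      (\<Sum>a\<in>UNIV. \<Sum>b\<in>UNIV. (\<Sum>e\<in>UNIV. \<Sum>f\<in>UNIV. h e f *\<^sub>R (E (u e) * E (v f a b))) * (SA b * SA a))"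
      by (rule sum.swap)
    also have "\<dots> = (\<Sum>a\<in>UNIV. \<Sum>b\<in>UNIV. - (\<Sum>e\<in>UNIV. \<Sum>f\<in>UNIV. ?X a b e f))"
    proof (intro sum.cong refl)
      fix a b
      show "(\<Sum>e\<in>UNIV. \<Sum>f\<in>UNIV. h e f *\<^sub>R (E (u e) * E (v f a b))) * (SA b * SA a) =
          - (\<Sum>e\<in>UNIV. \<Sum>f\<in>UNIV. ?X a b e f)"
        unfolding SA_SA[of b a] by (simp add: sum_distrib_right mult.assoc)
    qed
    also have "\<dots> = - (\<Sum>a\<in>UNIV. \<Sum>b\<in>UNIV. \<Sum>e\<in>UNIV. \<Sum>f\<in>UNIV. ?X a b e f)"
      by (simp only: sum_negf)
    \<comment> \<open>Two cyclic shifts of the four indices bring the pair contracted with eta to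
      the outside.\<close>
    also have "(\<Sum>a\<in>UNIV. \<Sum>b\<in>UNIV. \<Sum>e\<in>UNIV. \<Sum>f\<in>UNIV. ?X a b e f) =
      (\<Sum>a\<in>UNIV. \<Sum>b\<in>UNIV. \<Sum>e\<in>UNIV. \<Sum>f\<in>UNIV. ?X f a b e)"
      by (rule sum4_cyc[of "\<lambda>a b e f. ?X f a b e"])
    also have "\<dots> = (\<Sum>a\<in>UNIV. \<Sum>b\<in>UNIV. \<Sum>e\<in>UNIV. \<Sum>f\<in>UNIV. ?X e f a b)"
      by (rule sum4_cyc[of "\<lambda>a b e f. ?X e f a b"])
    finally show ?thesis by (simp only: expand)
  qed
  have "0 = (\<Sum>b\<in>UNIV. \<Sum>a\<in>UNIV. ((\<Sum>\<mu>\<in>UNIV. R b \<mu> * dR \<mu> a \<nu>) - (\<Sum>\<mu>\<in>UNIV. R a \<mu> * dR \<mu> b \<nu>)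
    + (\<Sum>e\<in>UNIV. \<Sum>f\<in>UNIV. h e f *\<^sub>R (R e \<nu> * C f a b))) * (SA b * SA a))"
    by (simp add: E_axiom_ii)
  also have "\<dots> = 2 *\<^sub>R (\<Sum>\<mu>\<in>UNIV. gr \<mu> * gdr \<mu> \<nu>) - (\<Sum>e\<in>UNIV. \<Sum>f\<in>UNIV. h e f *\<^sub>R (R e \<nu> * gc2 f))"
    unfolding distrib_right left_diff_distrib sum.distrib sum_subtractf
    by (simp add: P V gr_def gdr_def gc2_def scaleR_2)
  finally show "2 *\<^sub>R (\<Sum>\<mu>\<in>UNIV. gr \<mu> * gdr \<mu> \<nu>) - (\<Sum>e\<in>UNIV. \<Sum>f\<in>UNIV. h e f *\<^sub>R (R e \<nu> * gc2 f)) = 0"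
    by simp
  have "0 = (\<Sum>b\<in>UNIV. \<Sum>a\<in>UNIV. ((\<Sum>\<mu>\<in>UNIV. dR \<kappa> b \<mu> * dR \<mu> a \<nu> + R b \<mu> * ddR \<kappa> \<mu> a \<nu>)
    - (\<Sum>\<mu>\<in>UNIV. dR \<kappa> a \<mu> * dR \<mu> b \<nu> + R a \<mu> * ddR \<kappa> \<mu> b \<nu>)
    + (\<Sum>e\<in>UNIV. \<Sum>f\<in>UNIV. h e f *\<^sub>R (dR \<kappa> e \<nu> * C f a b + R e \<nu> * dC \<kappa> f a b))) * (SA b * SA a))"
    by (simp add: E_axiom_ii)
  also have "\<dots> = 2 *\<^sub>R (\<Sum>\<mu>\<in>UNIV. gdr \<kappa> \<mu> * gdr \<mu> \<nu> + gr \<mu> * gddr \<kappa> \<mu> \<nu>)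
    - (\<Sum>e\<in>UNIV. \<Sum>f\<in>UNIV. h e f *\<^sub>R (dR \<kappa> e \<nu> * gc2 f + R e \<nu> * gdc2 \<kappa> f))"
    unfolding distrib_right left_diff_distrib sum.distrib sum_subtractf scaleR_add_right
    by (simp add: P V gr_def gdr_def gddr_def gc2_def gdc2_def scaleR_2)
  finally show "2 *\<^sub>R (\<Sum>\<mu>\<in>UNIV. gdr \<kappa> \<mu> * gdr \<mu> \<nu> + gr \<mu> * gddr \<kappa> \<mu> \<nu>)
    - (\<Sum>e\<in>UNIV. \<Sum>f\<in>UNIV. h e f *\<^sub>R (dR \<kappa> e \<nu> * gc2 f + R e \<nu> * gdc2 \<kappa> f)) = 0"
    by simp
qed

lemma flux_cyc:
  "C b c a = C a b c" "dC \<kappa> b c a = dC \<kappa> a b c" "ddC \<kappa> \<mu> b c a = ddC \<kappa> \<mu> a b c"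
  by (metis flux_pd_antisym minus_minus)+

lemma SA3_cyc: "SA b * (SA c * SA a) = SA a * (SA b * SA c)"
  unfolding SA_SA[of c a] mult_minus_right SA_SA_left[of b a] by simp

text \<open>A cycle of four anticommuting factors is odd, one of three is even. These parities fix
  the signs in the two contractions of axiom (iii).\<close>

lemma SA4_cyc: "SA b * (SA c * (SA d * SA a)) = - (SA a * (SA b * (SA c * SA d)))"
  unfolding SA_SA[of d a] mult_minus_right SA_SA_left[of c a] SA_SA_left[of b a] by simp

text \<open>With d free, the remaining terms of axiom (iii) are cyclic sums over a, b, c. The
  product of three ghosts is cyclically invariant, so each cyclic sum contributes three equal
  terms.\<close>

lemma axiom_iii_contracted_3:
  "(\<Sum>\<mu>\<in>UNIV. R d \<mu> * gdc3 \<mu>) - 3 *\<^sub>R (\<Sum>\<mu>\<in>UNIV. gr \<mu> * gdc2 \<mu> d)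
    + 3 *\<^sub>R (\<Sum>e\<in>UNIV. \<Sum>f\<in>UNIV. h e f *\<^sub>R (gc2 e * gc1 d f)) = 0"
proof -
  let ?W = "\<lambda>a b c. \<Sum>\<mu>\<in>UNIV. R a \<mu> * dC \<mu> d b c"
  let ?V = "\<lambda>a b c. \<Sum>e\<in>UNIV. \<Sum>f\<in>UNIV. h e f *\<^sub>R (C e a b * C d f c)"
  let ?M = "\<lambda>a b c. SA a * (SA b * SA c)"
  \<comment> \<open>Antisymmetry of the flux moves the free index d into the first slot; for the
    quadratic terms the symmetry of eta is used as well.\<close>
  have ax: "(\<Sum>\<mu>\<in>UNIV. R d \<mu> * dC \<mu> a b c) - ?W a b c - ?W b c a - ?W c a b
    + (?V a b c + ?V b c a + ?V c a b) = 0" for a b c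
  proof -
    have W: "?W a b c = (\<Sum>\<mu>\<in>UNIV. R a \<mu> * dC \<mu> b c d)"
      "?W b c a = - (\<Sum>\<mu>\<in>UNIV. R b \<mu> * dC \<mu> c d a)"
      unfolding flux_pd_antisym(3)[of _ d c] flux_cyc(2)[of _ b c d] by (simp_all add: sum_negf)
    have "?V b c a = (\<Sum>e\<in>UNIV. \<Sum>f\<in>UNIV. h f e *\<^sub>R (C f b c * C d e a))"
      by (rule sum.swap)
    also have "\<dots> = (\<Sum>e\<in>UNIV. \<Sum>f\<in>UNIV. h e f *\<^sub>R (C e a d * C b c f))"
      unfolding flux_cyc(1)[of _ a d] flux_cyc(1)[of b c]
      by (intro sum.cong refl arg_cong2[of _ _ _ _ scaleR] E_E flux_smooth eta_inv_sym)
    finally have "?V b c a = (\<Sum>e\<in>UNIV. \<Sum>f\<in>UNIV. h e f *\<^sub>R (C e a d * C b c f))" .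
    moreover have "?V c a b = (\<Sum>e\<in>UNIV. \<Sum>f\<in>UNIV. h e f *\<^sub>R (C e a c * C d b f))"
      unfolding flux_pd_antisym(2)[of _ c a] flux_pd_antisym(2)[of d _ b] by simp
    moreover have "?V a b c = (\<Sum>e\<in>UNIV. \<Sum>f\<in>UNIV. h e f *\<^sub>R (C e a b * C c d f))"
      unfolding flux_cyc(1)[of d _ c] by (rule refl)
    ultimately show ?thesis
      using E_axiom_iii(1)[of d a b c] unfolding W by (simp add: expand algebra_simps)
  qed
  have cyc: "(\<Sum>a\<in>UNIV. \<Sum>b\<in>UNIV. \<Sum>c\<in>UNIV. F b c a * ?M a b c) = (\<Sum>a\<in>UNIV. \<Sum>b\<in>UNIV. \<Sum>c\<in>UNIV. F a b c * ?M a b c)"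
    for F
    by (rule trans[OF _ sum3_cyc[of "\<lambda>a b c. F a b c * ?M a b c"]])
      (intro sum.cong refl arg_cong2[of _ _ _ _ times] SA3_cyc[symmetric])
  have cyc2: "(\<Sum>a\<in>UNIV. \<Sum>b\<in>UNIV. \<Sum>c\<in>UNIV. F c a b * ?M a b c) = (\<Sum>a\<in>UNIV. \<Sum>b\<in>UNIV. \<Sum>c\<in>UNIV. F a b c * ?M a b c)"
    for F
    by (rule cyc[of "\<lambda>a b c. F c a b", symmetric])
  have "0 = (\<Sum>a\<in>UNIV. \<Sum>b\<in>UNIV. \<Sum>c\<in>UNIV. ((\<Sum>\<mu>\<in>UNIV. R d \<mu> * dC \<mu> a b c) - ?W a b c - ?W b c a - ?W c a b
    + (?V a b c + ?V b c a + ?V c a b)) * ?M a b c)"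
    unfolding ax by simp
  also have "\<dots> = (\<Sum>a\<in>UNIV. \<Sum>b\<in>UNIV. \<Sum>c\<in>UNIV. (\<Sum>\<mu>\<in>UNIV. R d \<mu> * dC \<mu> a b c) * ?M a b c)
    - 3 *\<^sub>R (\<Sum>a\<in>UNIV. \<Sum>b\<in>UNIV. \<Sum>c\<in>UNIV. ?W a b c * ?M a b c)
    + 3 *\<^sub>R (\<Sum>a\<in>UNIV. \<Sum>b\<in>UNIV. \<Sum>c\<in>UNIV. ?V a b c * ?M a b c)"
    unfolding distrib_right left_diff_distrib sum.distrib sum_subtractf cyc[of ?W] cyc[of ?V] cyc2[of ?W] cyc2[of ?V]
    by (simp add: scaleR_3 algebra_simps)
  also have "(\<Sum>a\<in>UNIV. \<Sum>b\<in>UNIV. \<Sum>c\<in>UNIV. (\<Sum>\<mu>\<in>UNIV. R d \<mu> * dC \<mu> a b c) * ?M a b c) =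
      (\<Sum>\<mu>\<in>UNIV. R d \<mu> * gdc3 \<mu>)"
    by (simp add: gdc3_def expand collect greek_out)
  also have "(\<Sum>a\<in>UNIV. \<Sum>b\<in>UNIV. \<Sum>c\<in>UNIV. ?W a b c * ?M a b c) = (\<Sum>\<mu>\<in>UNIV. gr \<mu> * gdc2 \<mu> d)"
    unfolding gr_def sum_distrib_right by (simp add: gdc2_def expand collect greek_out)
  also have "(\<Sum>a\<in>UNIV. \<Sum>b\<in>UNIV. \<Sum>c\<in>UNIV. ?V a b c * ?M a b c) =
    (\<Sum>e\<in>UNIV. \<Sum>f\<in>UNIV. h e f *\<^sub>R (gc2 e * gc1 d f))"
    unfolding gc2_def gc1_def sum_distrib_right
    by (rule trans[OF latin_out], intro sum.cong refl) (simp add: expand collect)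
  finally show ?thesis by simp
qed

text \<open>The alternating signs of the four derivative terms match the odd parity of a 4-cycle, so
  these terms add up to 4. The three quadratic terms are odd permutations of one of them and add up
  to -3.\<close>

lemma axiom_iii_contracted_4:
  "4 *\<^sub>R (\<Sum>\<mu>\<in>UNIV. gdr \<kappa> \<mu> * gdc3 \<mu> + gr \<mu> * gddc3 \<kappa> \<mu>)
    - 3 *\<^sub>R (\<Sum>e\<in>UNIV. \<Sum>f\<in>UNIV. h e f *\<^sub>R (gdc2 \<kappa> e * gc2 f + gc2 e * gdc2 \<kappa> f)) = 0"
proof -
  let ?W = "\<lambda>a b c d. \<Sum>\<mu>\<in>UNIV. dR \<kappa> a \<mu> * dC \<mu> b c d + R a \<mu> * ddC \<kappa> \<mu> b c d"
  let ?V = "\<lambda>a b c d. \<Sum>e\<in>UNIV. \<Sum>f\<in>UNIV. h e f *\<^sub>R (dC \<kappa> e a b * C f c d + C e a b * dC \<kappa> f c d)"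
  let ?M = "\<lambda>a b c d. SA a * (SA b * (SA c * SA d))"
  let ?sum = "\<lambda>F. \<Sum>a\<in>UNIV. \<Sum>b\<in>UNIV. \<Sum>c\<in>UNIV. \<Sum>d\<in>UNIV. F a b c d * ?M a b c d"
  have ax: "?W a b c d - ?W b c d a + ?W c d a b - ?W d a b c
    + (?V b c d a + ?V b d a c + ?V b a c d) = 0" for a b c d
  proof -
    let ?V' = "\<lambda>a b c d. \<Sum>e\<in>UNIV. \<Sum>f\<in>UNIV. h e f *\<^sub>R (dC \<kappa> e a b * C c d f + C e a b * dC \<kappa> c d f)"
    have V: "?V p q r t = ?V' p q r t" for p q r t
      unfolding flux_cyc(1)[of r t] flux_cyc(2)[of _ r t] by (rule refl)
    show ?thesis
      unfolding V using E_axiom_iii(2)[where \<kappa> = \<kappa> and d = a and a = b and b = c and c = d]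
      by (simp add: expand algebra_simps)
  qed
  have cyc: "?sum (\<lambda>a b c d. F b c d a) = - ?sum F" for F
  proof -
    have "?sum (\<lambda>a b c d. F b c d a) = (\<Sum>a\<in>UNIV. \<Sum>b\<in>UNIV. \<Sum>c\<in>UNIV. \<Sum>d\<in>UNIV. - (F b c d a * ?M b c d a))"
    proof (intro sum.cong refl)
      fix a b c d
      show "F b c d a * ?M a b c d = - (F b c d a * ?M b c d a)"
        by (simp only: SA4_cyc[of b c d a] mult_minus_right minus_minus)
    qed
    also have "\<dots> = - (\<Sum>a\<in>UNIV. \<Sum>b\<in>UNIV. \<Sum>c\<in>UNIV. \<Sum>d\<in>UNIV. F b c d a * ?M b c d a)"
      by (simp only: sum_negf)
    also have "\<dots> = - ?sum F"
      by (subst sum4_cyc[of "\<lambda>a b c d. F a b c d * ?M a b c d"]) (rule refl)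
    finally show ?thesis .
  qed
  have cyc2: "?sum (\<lambda>a b c d. F c d a b) = ?sum F" for F
    using cyc[of "\<lambda>a b c d. F b c d a"] cyc[of F] by (simp only: minus_minus)
  have cyc3: "?sum (\<lambda>a b c d. F d a b c) = - ?sum F" for F
    using cyc[of "\<lambda>a b c d. F d a b c"] by (simp only: minus_minus)
  have swap: "?sum (\<lambda>a b c d. F b a c d) = - ?sum F" for F
  proof -
    have "?sum (\<lambda>a b c d. F b a c d) = (\<Sum>b\<in>UNIV. \<Sum>a\<in>UNIV. \<Sum>c\<in>UNIV. \<Sum>d\<in>UNIV. F b a c d * ?M a b c d)"
      by (rule sum.swap)
    also have "\<dots> = (\<Sum>b\<in>UNIV. \<Sum>a\<in>UNIV. \<Sum>c\<in>UNIV. \<Sum>d\<in>UNIV. - (F b a c d * ?M b a c d))"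
      by (intro sum.cong refl) (subst SA_SA_left, rule mult_minus_right)
    finally show ?thesis by (simp only: sum_negf)
  qed
  have cyc_last: "?sum (\<lambda>a b c d. F a c d b) = ?sum F" for F
  proof (rule sum.cong[OF refl])
    fix a
    show "(\<Sum>b\<in>UNIV. \<Sum>c\<in>UNIV. \<Sum>d\<in>UNIV. F a c d b * ?M a b c d) =
        (\<Sum>b\<in>UNIV. \<Sum>c\<in>UNIV. \<Sum>d\<in>UNIV. F a b c d * ?M a b c d)"
      by (rule trans[OF _ sum3_cyc[of "\<lambda>b c d. F a b c d * ?M a b c d"]])
        (intro sum.cong refl arg_cong2[of _ _ _ _ times] SA3_cyc[symmetric])
  qed
  \<comment> \<open>This permutation is a 4-cycle composed with a 3-cycle of the last three indices,
    hence odd.\<close>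
  have perm: "?sum (\<lambda>a b c d. F b d a c) = - ?sum F" for F
    using cyc[of "\<lambda>a b c d. F a c d b"] cyc_last[of F] by (simp only:)
  have collected: "?sum (\<lambda>a b c d. W a b c d - W b c d a + W c d a b - W d a b c
    + (V b c d a + V b d a c + V b a c d)) = 4 *\<^sub>R ?sum W - 3 *\<^sub>R ?sum V" for W V
    unfolding distrib_right left_diff_distrib sum.distrib sum_subtractf
      cyc[of W] cyc2[of W] cyc3[of W] cyc[of V] perm[of V] swap[of V]
    by (simp add: scaleR_3 scaleR_4)
  have "0 = ?sum (\<lambda>a b c d. ?W a b c d - ?W b c d a + ?W c d a b - ?W d a b c
    + (?V b c d a + ?V b d a c + ?V b a c d))"
    unfolding ax by simp
  also have "\<dots> = 4 *\<^sub>R ?sum ?W - 3 *\<^sub>R ?sum ?V"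
    by (rule collected[of ?W ?V])
  finally have zero: "0 = 4 *\<^sub>R ?sum ?W - 3 *\<^sub>R ?sum ?V" .
  have W: "?sum ?W = (\<Sum>\<mu>\<in>UNIV. gdr \<kappa> \<mu> * gdc3 \<mu> + gr \<mu> * gddc3 \<kappa> \<mu>)"
    unfolding gr_def gdr_def sum_distrib_right by (simp add: gdc3_def gddc3_def expand collect greek_out)
  have V: "?sum ?V = (\<Sum>e\<in>UNIV. \<Sum>f\<in>UNIV. h e f *\<^sub>R (gdc2 \<kappa> e * gc2 f + gc2 e * gdc2 \<kappa> f))"
    unfolding gc2_def gdc2_def sum_distrib_right
    by (rule trans[OF latin_out4], intro sum.cong refl) (simp add: expand collect)
  show ?thesis using zero[unfolded W V] by (rule sym)
qed

end

context courant_sigma_model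
begin

text \<open>Up to \<open>\<eta>\<close> and to signs, \<open>gy\<close> and \<open>gz\<close> are the derivatives with respect to \<open>SA\<close> and \<open>X\<close> of
  \<open>\<Theta> = \<rho>\<^sub>a\<^sup>\<mu> SB\<^sub>\<mu> SA\<^sup>a + 1/6 C\<^sub>a\<^sub>b\<^sub>c SA\<^sup>a SA\<^sup>b SA\<^sup>c\<close>.  The three identities \<open>master_X\<close>, \<open>master_A\<close>, \<open>master_B\<close> are the
  derivatives of the classical master equation \<open>{\<Theta>, \<Theta>} = 0\<close>.\<close>
definition gy where "gy b = (\<Sum>\<nu>\<in>UNIV. R b \<nu> * SB \<nu>) + (1/2) *\<^sub>R gc2 b"
definition gdy where "gdy \<kappa> b = (\<Sum>\<nu>\<in>UNIV. dR \<kappa> b \<nu> * SB \<nu>) + (1/2) *\<^sub>R gdc2 \<kappa> b"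
definition gz where "gz \<mu> = (\<Sum>\<nu>\<in>UNIV. SB \<nu> * gdr \<mu> \<nu>) + (1/6) *\<^sub>R gdc3 \<mu>"
definition gdz where "gdz \<kappa> \<mu> = (\<Sum>\<nu>\<in>UNIV. SB \<nu> * gddr \<kappa> \<mu> \<nu>) + (1/6) *\<^sub>R gddc3 \<kappa> \<mu>"

lemma gyz_hom: "super_hom 2 (gy b)" "super_hom 2 (gdy \<kappa> b)" "super_hom 3 (gz \<mu>)" "super_hom 3 (gdz \<kappa> \<mu>)"
  unfolding gy_def gdy_def gz_def gdz_def
  by ((rule super_hom_intros(2) super_hom_sum super_hom_intros(5) ghost_hom
      | rule mult_hom[OF E_hom SB_hom] mult_hom[OF SB_hom ghost_hom(2)] mult_hom[OF SB_hom ghost_hom(3)] | simp)+)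

lemma SB_comm:
  assumes "super_hom k g"
  shows "g * SB \<nu> = SB \<nu> * g"
  by (rule trans[OF super_comm[OF assms SB_hom]]) (simp add: sg_def)

lemma odd_comm:
  assumes "super_hom k f" "super_hom l g" "odd k" "odd l"
  shows "f * g = - (g * f)"
  by (rule trans[OF super_comm[OF assms(1,2)]]) (simp add: sg_def assms(3,4))

lemma even_comm:
  assumes "super_hom k f" "super_hom l g" "even k"
  shows "f * g = g * f"
  by (rule trans[OF super_comm[OF assms(1,2)]]) (simp add: sg_def assms(3))

lemma eta_inv_swap:
  fixes F :: "'a \<Rightarrow> 'a \<Rightarrow> 'b::real_vector"
  shows "(\<Sum>a\<in>UNIV. \<Sum>b\<in>UNIV. h a b *\<^sub>R F a b) = (\<Sum>a\<in>UNIV. \<Sum>b\<in>UNIV. h a b *\<^sub>R F b a)"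
proof -
  have "(\<Sum>a\<in>UNIV. \<Sum>b\<in>UNIV. h a b *\<^sub>R F a b) = (\<Sum>b\<in>UNIV. \<Sum>a\<in>UNIV. h a b *\<^sub>R F a b)"
    by (rule sum.swap)
  also have "\<dots> = (\<Sum>b\<in>UNIV. \<Sum>a\<in>UNIV. h b a *\<^sub>R F a b)"
    by (intro sum.cong refl arg_cong2[of _ _ _ _ scaleR] eta_inv_sym)
  finally show ?thesis .
qed

lemma eta_inv_swap_comm:
  fixes F :: "'a \<Rightarrow> 'a \<Rightarrow> 'b::real_vector"
  assumes "\<And>a b. F b a = G a b"
  shows "(\<Sum>a\<in>UNIV. \<Sum>b\<in>UNIV. h a b *\<^sub>R F a b) = (\<Sum>a\<in>UNIV. \<Sum>b\<in>UNIV. h a b *\<^sub>R G a b)"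
  using eta_inv_swap[of F] by (simp only: assms)

text \<open>Axiom (i) removes the part linear in \<open>SB\<close>; the rest is axiom (ii)
  contracted with two ghosts.\<close>

lemma master_X: "(\<Sum>\<nu>\<in>UNIV. gr \<nu> * gdr \<nu> \<mu>) = (\<Sum>a\<in>UNIV. \<Sum>b\<in>UNIV. h a b *\<^sub>R (R a \<mu> * gy b))"
proof -
  have "(\<Sum>a\<in>UNIV. \<Sum>b\<in>UNIV. h a b *\<^sub>R (R a \<mu> * (\<Sum>\<nu>\<in>UNIV. R b \<nu> * SB \<nu>)))
      = (\<Sum>\<nu>\<in>UNIV. (\<Sum>a\<in>UNIV. \<Sum>b\<in>UNIV. h a b *\<^sub>R (R a \<mu> * R b \<nu>)) * SB \<nu>)"
    by (simp add: expand greek_out mult.assoc)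
  also have "\<dots> = 0" by (simp add: E_axiom_i)
  finally have "(\<Sum>a\<in>UNIV. \<Sum>b\<in>UNIV. h a b *\<^sub>R (R a \<mu> * gy b)) =
      (1/2) *\<^sub>R (\<Sum>a\<in>UNIV. \<Sum>b\<in>UNIV. h a b *\<^sub>R (R a \<mu> * gc2 b))"
    by (simp add: gy_def distrib_left scaleR_add_right sum.distrib scaleR_sum_right scaleR_left_commute)
  also have "\<dots> = (1/2) *\<^sub>R (2 *\<^sub>R (\<Sum>\<nu>\<in>UNIV. gr \<nu> * gdr \<nu> \<mu>))"
    using axiom_ii_contracted_twice(1)[of \<mu>] by simp
  finally show ?thesis by simp
qed

text \<open>The part linear in \<open>SB\<close> is axiom (ii) contracted once, the part free of
  \<open>SB\<close> is axiom (iii) contracted three times.\<close>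

lemma master_A:
  "(\<Sum>\<kappa>\<in>UNIV. gr \<kappa> * gdy \<kappa> b) =
    (\<Sum>\<mu>\<in>UNIV. R b \<mu> * gz \<mu>) + (\<Sum>c\<in>UNIV. (\<Sum>e\<in>UNIV. h c e *\<^sub>R gy e) * gc1 b c)"
proof -
  have 1: "(\<Sum>\<kappa>\<in>UNIV. gr \<kappa> * gdy \<kappa> b) =
      (\<Sum>\<nu>\<in>UNIV. SB \<nu> * (\<Sum>\<kappa>\<in>UNIV. gr \<kappa> * dR \<kappa> b \<nu>)) + (1/2) *\<^sub>R (\<Sum>\<kappa>\<in>UNIV. gr \<kappa> * gdc2 \<kappa> b)"
  proof -
    have "(\<Sum>\<kappa>\<in>UNIV. gr \<kappa> * (\<Sum>\<nu>\<in>UNIV. dR \<kappa> b \<nu> * SB \<nu>)) = (\<Sum>\<nu>\<in>UNIV. \<Sum>\<kappa>\<in>UNIV. gr \<kappa> * (dR \<kappa> b \<nu> * SB \<nu>))"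
      unfolding sum_distrib_left by (rule sum.swap)
    also have "\<dots> = (\<Sum>\<nu>\<in>UNIV. SB \<nu> * (\<Sum>\<kappa>\<in>UNIV. gr \<kappa> * dR \<kappa> b \<nu>))"
      unfolding sum_distrib_left
    proof (intro sum.cong refl)
      fix \<nu> \<kappa>
      have "(gr \<kappa> * dR \<kappa> b \<nu>) * SB \<nu> = SB \<nu> * (gr \<kappa> * dR \<kappa> b \<nu>)"
        by (rule SB_comm, rule mult_hom, rule ghost_hom, rule E_hom, simp, rule refl)
      then show "gr \<kappa> * (dR \<kappa> b \<nu> * SB \<nu>) = SB \<nu> * (gr \<kappa> * dR \<kappa> b \<nu>)"
        by (simp only: mult.assoc)
    qed
    finally show ?thesis
      by (simp add: gdy_def distrib_left sum.distrib scaleR_sum_right)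
  qed
  have 2: "(\<Sum>\<mu>\<in>UNIV. R b \<mu> * gz \<mu>) =
      (\<Sum>\<nu>\<in>UNIV. SB \<nu> * (\<Sum>\<mu>\<in>UNIV. R b \<mu> * gdr \<mu> \<nu>)) + (1/6) *\<^sub>R (\<Sum>\<mu>\<in>UNIV. R b \<mu> * gdc3 \<mu>)"
  proof -
    have "(\<Sum>\<mu>\<in>UNIV. R b \<mu> * (\<Sum>\<nu>\<in>UNIV. SB \<nu> * gdr \<mu> \<nu>)) = (\<Sum>\<nu>\<in>UNIV. \<Sum>\<mu>\<in>UNIV. R b \<mu> * (SB \<nu> * gdr \<mu> \<nu>))"
      unfolding sum_distrib_left by (rule sum.swap)
    also have "\<dots> = (\<Sum>\<nu>\<in>UNIV. SB \<nu> * (\<Sum>\<mu>\<in>UNIV. R b \<mu> * gdr \<mu> \<nu>))"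
      by (simp add: sum_distrib_left comm_left_rules)
    finally show ?thesis
      by (simp add: gz_def distrib_left sum.distrib scaleR_sum_right)
  qed
  have 3: "(\<Sum>c\<in>UNIV. (\<Sum>e\<in>UNIV. h c e *\<^sub>R gy e) * gc1 b c) =
     - (\<Sum>\<nu>\<in>UNIV. SB \<nu> * (\<Sum>e\<in>UNIV. \<Sum>f\<in>UNIV. h e f *\<^sub>R (R e \<nu> * gc1 f b)))
     + (1/2) *\<^sub>R (\<Sum>e\<in>UNIV. \<Sum>f\<in>UNIV. h e f *\<^sub>R (gc2 e * gc1 b f))"
  proof -
    have flip: "gc1 b c = - gc1 c b" for c
      unfolding gc1_def sum_negf[symmetric] by (rule sum.cong[OF refl]) (subst flux_pd_antisym(1), simp)
    have "(\<Sum>c\<in>UNIV. (\<Sum>e\<in>UNIV. h c e *\<^sub>R gy e) * gc1 b c) = (\<Sum>c\<in>UNIV. \<Sum>e\<in>UNIV. h c e *\<^sub>R (gy e * gc1 b c))"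
      by (simp add: sum_distrib_right)
    also have "\<dots> = (\<Sum>e\<in>UNIV. \<Sum>c\<in>UNIV. h e c *\<^sub>R (gy e * gc1 b c))"
      by (rule eta_inv_swap)
    also have "\<dots> = (\<Sum>e\<in>UNIV. \<Sum>c\<in>UNIV. h e c *\<^sub>R ((\<Sum>\<nu>\<in>UNIV. R e \<nu> * SB \<nu>) * gc1 b c))
        + (1/2) *\<^sub>R (\<Sum>e\<in>UNIV. \<Sum>c\<in>UNIV. h e c *\<^sub>R (gc2 e * gc1 b c))"
      by (simp add: gy_def distrib_right scaleR_add_right sum.distrib scaleR_sum_right scaleR_left_commute)
    also have "(\<Sum>e\<in>UNIV. \<Sum>c\<in>UNIV. h e c *\<^sub>R ((\<Sum>\<nu>\<in>UNIV. R e \<nu> * SB \<nu>) * gc1 b c)) =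
       (\<Sum>e\<in>UNIV. \<Sum>c\<in>UNIV. \<Sum>\<nu>\<in>UNIV. - (h e c *\<^sub>R (SB \<nu> * (R e \<nu> * gc1 c b))))"
      unfolding flip by (simp add: sum_distrib_right comm_left_rules mult.assoc scaleR_sum_right sum_negf)
    also have "\<dots> = - (\<Sum>\<nu>\<in>UNIV. SB \<nu> * (\<Sum>e\<in>UNIV. \<Sum>f\<in>UNIV. h e f *\<^sub>R (R e \<nu> * gc1 f b)))"
      by (simp add: sum_negf greek_out sum_distrib_left)
    finally show ?thesis .
  qed
  have "0 = (\<Sum>\<nu>\<in>UNIV. SB \<nu> * ((\<Sum>\<mu>\<in>UNIV. gr \<mu> * dR \<mu> b \<nu>) - (\<Sum>\<mu>\<in>UNIV. R b \<mu> * gdr \<mu> \<nu>)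
    + (\<Sum>e\<in>UNIV. \<Sum>f\<in>UNIV. h e f *\<^sub>R (R e \<nu> * gc1 f b))))"
    by (simp only: axiom_ii_contracted mult_zero_right sum.neutral_const)
  also have "\<dots> = (\<Sum>\<nu>\<in>UNIV. SB \<nu> * (\<Sum>\<mu>\<in>UNIV. gr \<mu> * dR \<mu> b \<nu>)) - (\<Sum>\<nu>\<in>UNIV. SB \<nu> * (\<Sum>\<mu>\<in>UNIV. R b \<mu> * gdr \<mu> \<nu>))
    + (\<Sum>\<nu>\<in>UNIV. SB \<nu> * (\<Sum>e\<in>UNIV. \<Sum>f\<in>UNIV. h e f *\<^sub>R (R e \<nu> * gc1 f b)))"
    by (simp only: distrib_left right_diff_distrib sum.distrib sum_subtractf)
  finally have 4: "(\<Sum>\<nu>\<in>UNIV. SB \<nu> * (\<Sum>\<mu>\<in>UNIV. gr \<mu> * dR \<mu> b \<nu>)) = (\<Sum>\<nu>\<in>UNIV. SB \<nu> * (\<Sum>\<mu>\<in>UNIV. R b \<mu> * gdr \<mu> \<nu>))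
    - (\<Sum>\<nu>\<in>UNIV. SB \<nu> * (\<Sum>e\<in>UNIV. \<Sum>f\<in>UNIV. h e f *\<^sub>R (R e \<nu> * gc1 f b)))"
    by (simp add: algebra_simps)
  have 5: "x - 3 *\<^sub>R y + 3 *\<^sub>R z = 0 \<Longrightarrow> (1/2) *\<^sub>R y = (1/6) *\<^sub>R x + (1/2) *\<^sub>R z" for x y z :: "'w super"
  proof -
    assume "x - 3 *\<^sub>R y + 3 *\<^sub>R z = 0"
    then have "3 *\<^sub>R y = x + 3 *\<^sub>R z" by (simp add: algebra_simps)
    then have "(1/6) *\<^sub>R (3 *\<^sub>R y) = (1/6) *\<^sub>R (x + 3 *\<^sub>R z)" by simp
    then show ?thesis by (simp add: scaleR_add_right)
  qed
  show ?thesis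
    unfolding 1 2 3 4 5[OF axiom_iii_contracted_3] by simp
qed

lemma gddr_commute: "gddr \<kappa> \<mu> \<nu> = gddr \<mu> \<kappa> \<nu>"
  unfolding gddr_def by (intro sum.cong refl arg_cong2[of _ _ _ _ times] E_pd_commute anchor_smooth)

lemma gddc3_commute: "gddc3 \<kappa> \<mu> = gddc3 \<mu> \<kappa>"
  unfolding gddc3_def by (intro sum.cong refl arg_cong2[of _ _ _ _ times] E_pd_commute flux_smooth)

text \<open>Ordered by powers of \<open>SB\<close>: the quadratic part is the derivative of axiom
  (i), the linear part that of axiom (ii), and the part free of \<open>SB\<close> that of axiom
  (iii).\<close>

lemma master_B:
  "(\<Sum>\<kappa>\<in>UNIV. gr \<kappa> * gdz \<kappa> \<mu>) =
    (\<Sum>\<nu>\<in>UNIV. gz \<nu> * gdr \<mu> \<nu>) + (\<Sum>a\<in>UNIV. (\<Sum>b\<in>UNIV. h a b *\<^sub>R gy b) * gdy \<mu> a)"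
proof -
  let ?RB = "\<lambda>b. \<Sum>\<nu>\<in>UNIV. R b \<nu> * SB \<nu>" and ?dRB = "\<lambda>a. \<Sum>\<nu>\<in>UNIV. dR \<mu> a \<nu> * SB \<nu>"
  let ?hh = "\<lambda>F. \<Sum>a\<in>UNIV. \<Sum>b\<in>UNIV. h a b *\<^sub>R (F a b :: 'w super)"
  have 1: "(\<Sum>\<kappa>\<in>UNIV. gr \<kappa> * gdz \<kappa> \<mu>) =
      (\<Sum>\<nu>\<in>UNIV. SB \<nu> * (\<Sum>\<kappa>\<in>UNIV. gr \<kappa> * gddr \<mu> \<kappa> \<nu>)) + (1/6) *\<^sub>R (\<Sum>\<kappa>\<in>UNIV. gr \<kappa> * gddc3 \<mu> \<kappa>)"
  proof -
    have "(\<Sum>\<kappa>\<in>UNIV. gr \<kappa> * (\<Sum>\<nu>\<in>UNIV. SB \<nu> * gddr \<mu> \<kappa> \<nu>)) = (\<Sum>\<nu>\<in>UNIV. \<Sum>\<kappa>\<in>UNIV. gr \<kappa> * (SB \<nu> * gddr \<mu> \<kappa> \<nu>))"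
      unfolding sum_distrib_left by (rule sum.swap)
    also have "\<dots> = (\<Sum>\<nu>\<in>UNIV. SB \<nu> * (\<Sum>\<kappa>\<in>UNIV. gr \<kappa> * gddr \<mu> \<kappa> \<nu>))"
      by (simp add: sum_distrib_left left_commuteI[OF SB_comm[OF ghost_hom(1)]])
    finally show ?thesis
      unfolding gdz_def gddr_commute[of _ \<mu>] gddc3_commute[of _ \<mu>]
      by (simp add: distrib_left sum.distrib scaleR_sum_right)
  qed
  have 2: "(\<Sum>\<nu>\<in>UNIV. gz \<nu> * gdr \<mu> \<nu>) =
      - (\<Sum>\<nu>\<in>UNIV. SB \<nu> * (\<Sum>\<kappa>\<in>UNIV. gdr \<mu> \<kappa> * gdr \<kappa> \<nu>)) - (1/6) *\<^sub>R (\<Sum>\<kappa>\<in>UNIV. gdr \<mu> \<kappa> * gdc3 \<kappa>)"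
  proof -
    have "(\<Sum>\<kappa>\<in>UNIV. (\<Sum>\<nu>\<in>UNIV. SB \<nu> * gdr \<kappa> \<nu>) * gdr \<mu> \<kappa>) = (\<Sum>\<nu>\<in>UNIV. \<Sum>\<kappa>\<in>UNIV. SB \<nu> * gdr \<kappa> \<nu> * gdr \<mu> \<kappa>)"
      unfolding sum_distrib_right by (rule sum.swap)
    also have "\<dots> = (\<Sum>\<nu>\<in>UNIV. \<Sum>\<kappa>\<in>UNIV. - (SB \<nu> * (gdr \<mu> \<kappa> * gdr \<kappa> \<nu>)))"
      by (intro sum.cong refl) (subst mult.assoc, subst odd_comm[OF ghost_hom(2) ghost_hom(2)], simp_all)
    also have "\<dots> = - (\<Sum>\<nu>\<in>UNIV. SB \<nu> * (\<Sum>\<kappa>\<in>UNIV. gdr \<mu> \<kappa> * gdr \<kappa> \<nu>))"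
      by (simp add: sum_negf sum_distrib_left)
    finally have a: "(\<Sum>\<kappa>\<in>UNIV. (\<Sum>\<nu>\<in>UNIV. SB \<nu> * gdr \<kappa> \<nu>) * gdr \<mu> \<kappa>) = \<dots>" .
    have b: "gdc3 \<kappa> * gdr \<mu> \<kappa> = - (gdr \<mu> \<kappa> * gdc3 \<kappa>)" for \<kappa>
      by (rule odd_comm[OF ghost_hom(7) ghost_hom(2)]) simp_all
    show ?thesis
      unfolding gz_def distrib_right sum.distrib a mult_scaleR_left b
      by (simp add: scaleR_sum_right sum_negf)
  qed
  have RB_hom: "super_hom 2 (\<Sum>\<nu>\<in>UNIV. E (F \<nu>) * SB \<nu>)"
    if "\<And>\<nu>. smooth_fun (patch Q) (F \<nu>)" for F :: "'m \<Rightarrow> _"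
    by (rule super_hom_sum, rule mult_hom[OF E_hom[OF that] SB_hom]) simp
  \<comment> \<open>By symmetry of eta this sum equals the one with the derivative on the other
    anchor; together they form the derivative of axiom (i), so twice the sum is zero.\<close>
  have BB: "?hh (\<lambda>a b. ?dRB a * ?RB b) = 0"
  proof -
    have swap: "?hh (\<lambda>a b. ?dRB a * ?RB b) = ?hh (\<lambda>a b. ?RB a * ?dRB b)"
      by (rule eta_inv_swap_comm, rule even_comm[OF RB_hom RB_hom]) simp_all
    have e: "?dRB a * ?RB b = (\<Sum>\<nu>\<in>UNIV. \<Sum>\<kappa>\<in>UNIV. (dR \<mu> a \<nu> * R b \<kappa>) * (SB \<nu> * SB \<kappa>))"
      "?RB a * ?dRB b = (\<Sum>\<nu>\<in>UNIV. \<Sum>\<kappa>\<in>UNIV. (R a \<nu> * dR \<mu> b \<kappa>) * (SB \<nu> * SB \<kappa>))" for a b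
      unfolding sum_product by (simp_all add: comm_left_rules mult.assoc)
    have "?hh (\<lambda>a b. ?dRB a * ?RB b) + ?hh (\<lambda>a b. ?RB a * ?dRB b) =
        (\<Sum>\<nu>\<in>UNIV. \<Sum>\<kappa>\<in>UNIV. ?hh (\<lambda>a b. dR \<mu> a \<nu> * R b \<kappa> + R a \<nu> * dR \<mu> b \<kappa>) * (SB \<nu> * SB \<kappa>))"
      unfolding e by (simp add: expand greek_out)
    also have "\<dots> = 0" by (simp only: E_axiom_i mult_zero_left sum.neutral_const)
    finally have "2 *\<^sub>R ?hh (\<lambda>a b. ?dRB a * ?RB b) = 0"
      unfolding swap[symmetric] scaleR_2 .
    then show ?thesis by simp
  qed
  have 3: "(\<Sum>a\<in>UNIV. (\<Sum>b\<in>UNIV. h a b *\<^sub>R gy b) * gdy \<mu> a) =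
    (1/2) *\<^sub>R (\<Sum>\<nu>\<in>UNIV. SB \<nu> * ?hh (\<lambda>e f. dR \<mu> e \<nu> * gc2 f + R e \<nu> * gdc2 \<mu> f))
    + (1/8) *\<^sub>R ?hh (\<lambda>e f. gdc2 \<mu> e * gc2 f + gc2 e * gdc2 \<mu> f)"
  proof -
    have pt: "gdy \<mu> a * gy b = ?dRB a * ?RB b + (1/2) *\<^sub>R (?dRB a * gc2 b)
        + (1/2) *\<^sub>R (gdc2 \<mu> a * ?RB b) + (1/4) *\<^sub>R (gdc2 \<mu> a * gc2 b)" for a b
      by (simp add: gy_def gdy_def distrib_left distrib_right scaleR_add_right)
    have "(\<Sum>a\<in>UNIV. (\<Sum>b\<in>UNIV. h a b *\<^sub>R gy b) * gdy \<mu> a) = ?hh (\<lambda>a b. gy b * gdy \<mu> a)"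
      by (simp add: sum_distrib_right)
    also have "\<dots> = ?hh (\<lambda>a b. gdy \<mu> a * gy b)"
      by (intro sum.cong refl arg_cong2[of _ _ _ _ scaleR] even_comm[OF gyz_hom(1,2)]) simp
    also have "\<dots> = ?hh (\<lambda>a b. ?dRB a * ?RB b) + (1/2) *\<^sub>R ?hh (\<lambda>a b. ?dRB a * gc2 b)
        + (1/2) *\<^sub>R ?hh (\<lambda>a b. gdc2 \<mu> a * ?RB b) + (1/4) *\<^sub>R ?hh (\<lambda>a b. gdc2 \<mu> a * gc2 b)"
      unfolding pt by (simp only: scaleR_add_right sum.distrib scaleR_sum_right scaleR_scaleR mult.commute)
    finally have e: "(\<Sum>a\<in>UNIV. (\<Sum>b\<in>UNIV. h a b *\<^sub>R gy b) * gdy \<mu> a) =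
        ?hh (\<lambda>a b. ?dRB a * ?RB b) + (1/2) *\<^sub>R ?hh (\<lambda>a b. ?dRB a * gc2 b)
        + (1/2) *\<^sub>R ?hh (\<lambda>a b. gdc2 \<mu> a * ?RB b) + (1/4) *\<^sub>R ?hh (\<lambda>a b. gdc2 \<mu> a * gc2 b)" .
    have e1: "?hh (\<lambda>a b. gdc2 \<mu> a * ?RB b) = ?hh (\<lambda>a b. ?RB a * gdc2 \<mu> b)"
      by (rule eta_inv_swap_comm, rule even_comm[OF ghost_hom(6) RB_hom]) simp_all
    have e2: "?hh (\<lambda>a b. ?RB a * gdc2 \<mu> b) = (\<Sum>\<nu>\<in>UNIV. SB \<nu> * ?hh (\<lambda>e f. R e \<nu> * gdc2 \<mu> f))"
      by (simp add: expand greek_out comm_left_rules mult.assoc)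
    have e3: "?hh (\<lambda>a b. ?dRB a * gc2 b) = (\<Sum>\<nu>\<in>UNIV. SB \<nu> * ?hh (\<lambda>e f. dR \<mu> e \<nu> * gc2 f))"
      by (simp add: expand greek_out comm_left_rules mult.assoc)
    have e4: "(1/4) *\<^sub>R ?hh (\<lambda>a b. gdc2 \<mu> a * gc2 b) = (1/8) *\<^sub>R ?hh (\<lambda>e f. gdc2 \<mu> e * gc2 f + gc2 e * gdc2 \<mu> f)"
    proof -
      have "?hh (\<lambda>a b. gdc2 \<mu> a * gc2 b) = ?hh (\<lambda>a b. gc2 a * gdc2 \<mu> b)"
        by (rule eta_inv_swap_comm, rule even_comm[OF ghost_hom(6,5)]) simp
      then show ?thesis
        by (simp add: scaleR_add_right sum.distrib flip: scaleR_2)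
    qed
    show ?thesis
      unfolding e BB e1 e2 e3 e4 by (simp add: distrib_left scaleR_add_right sum.distrib)
  qed
  have 4: "(\<Sum>\<nu>\<in>UNIV. SB \<nu> * ?hh (\<lambda>e f. dR \<mu> e \<nu> * gc2 f + R e \<nu> * gdc2 \<mu> f)) =
      2 *\<^sub>R (\<Sum>\<nu>\<in>UNIV. SB \<nu> * (\<Sum>\<kappa>\<in>UNIV. gdr \<mu> \<kappa> * gdr \<kappa> \<nu>)) +
      2 *\<^sub>R (\<Sum>\<nu>\<in>UNIV. SB \<nu> * (\<Sum>\<kappa>\<in>UNIV. gr \<kappa> * gddr \<mu> \<kappa> \<nu>))"
  proof -
    have "?hh (\<lambda>e f. dR \<mu> e \<nu> * gc2 f + R e \<nu> * gdc2 \<mu> f) =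
       2 *\<^sub>R (\<Sum>\<kappa>\<in>UNIV. gdr \<mu> \<kappa> * gdr \<kappa> \<nu> + gr \<kappa> * gddr \<mu> \<kappa> \<nu>)" for \<nu>
      using axiom_ii_contracted_twice(2)[of \<mu> \<nu>] by simp
    then show ?thesis
      by (simp only: sum.distrib scaleR_add_right distrib_left mult_scaleR_right scaleR_sum_right[symmetric])
  qed
  \<comment> \<open>The factor 4/3 turns the 1/8 of the symmetrized quadratic flux terms into the
    1/6 carried by \<open>gdc3\<close> and \<open>gddc3\<close>.\<close>
  have 5: "?hh (\<lambda>e f. gdc2 \<mu> e * gc2 f + gc2 e * gdc2 \<mu> f) =
      (4/3) *\<^sub>R ((\<Sum>\<kappa>\<in>UNIV. gdr \<mu> \<kappa> * gdc3 \<kappa>) + (\<Sum>\<kappa>\<in>UNIV. gr \<kappa> * gddc3 \<mu> \<kappa>))"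
  proof -
    have "x = (4/3) *\<^sub>R y" if "4 *\<^sub>R y - 3 *\<^sub>R x = 0" for x y :: "'w super"
    proof -
      have "(1/3) *\<^sub>R (4 *\<^sub>R y) = (1/3) *\<^sub>R (3 *\<^sub>R x)" using that by simp
      then show ?thesis by simp
    qed
    from this[OF axiom_iii_contracted_4[of \<mu>]] show ?thesis by (simp only: sum.distrib)
  qed
  show ?thesis
    unfolding 1 2 3 4 5 by (simp add: scaleR_add_right)
qed

end

section \<open>The square of the BRST operator\<close>

locale courant_brst = courant_sigma_model Q K \<Phi> + ghost_derivation K s
  for Q :: "('m::finite, 'a::finite) courant_data"
    and K :: "('w::real_algebra_1, 'r::real_vector) form_algebra"
    and \<Phi> :: "('m, 'a, 'w) bv_fields" and s :: "'w \<Rightarrow> 'w" +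
  assumes s_ev: "smooth_fun (patch Q) f \<Longrightarrow>
      s (ev \<Phi> f) = (\<Sum>\<mu>\<in>UNIV. ev \<Phi> (pd \<mu> f) * brst Q K \<Phi> (cX \<mu>))"
    and s_field: "s (field \<Phi> \<phi>) = brst Q K \<Phi> \<phi>"
begin

lemma fX_bideg: "fX \<Phi> \<mu> \<in> bideg K 0 0"
  unfolding fX_def by (rule ev_bideg) simp

definition SX where "SX \<mu> = homogeneous 0 (of_comps [fX \<Phi> \<mu>])"

lemma SX_hom: "super_hom 0 (SX \<mu>)"
  unfolding SX_def
proof (rule super_hom_homogeneous)
  fix p show "of_comps [fX \<Phi> \<mu>] p \<in> bideg K (0 - int p) p"
    using fX_bideg subspace_0[OF bideg_subspace]
    by (simp add: of_comps_def nth_Cons split: nat.split)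
qed

definition DX where "DX \<mu> = tot_dif 0 (SX \<mu>)"
definition DA where "DA a = tot_dif 1 (SA a)"
definition DB where "DB \<mu> = tot_dif 2 (SB \<mu>)"

lemma D_hom: "super_hom 1 (DX \<mu>)" "super_hom 2 (DA a)" "super_hom 3 (DB \<mu>)"
  using super_hom_tot_dif[OF SX_hom] super_hom_tot_dif[OF SA_hom] super_hom_tot_dif[OF SB_hom]
  by (simp_all add: DX_def DA_def DB_def)

lemma s_0 [simp]: "s 0 = 0" and dif_0 [simp]: "dif K 0 = 0"
  using linear_0[OF s_linear] linear_0[OF dif_linear] .

lemma comps_DX: "comps 1 (DX \<mu>) n = of_comps [brst Q K \<Phi> (cX \<mu>), dif K (fX \<Phi> \<mu>)] n"
  unfolding DX_def comps_tot_dif[of 1 0, simplified] SX_def comps_homogeneous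
  using s_field[of "cX \<mu>"]
  by (auto simp: sdif_def of_comps_def nth_Cons sg_def split: nat.split)

lemma sprod_singleton: "sprod 0 (of_comps [u]) v n = u * v n"
proof -
  have "sprod 0 (of_comps [u]) v n = (\<Sum>p\<le>n. if p = 0 then u * v n else 0)"
    unfolding sprod_def by (intro sum.cong refl) (auto simp: of_comps_def sg_def)
  then show ?thesis by simp
qed

lemma comps_E_mult:
  "smooth_fun (patch Q) f \<Longrightarrow> super_hom k g \<Longrightarrow> comps k (E f * g) n = ev \<Phi> f * comps k g n"
  using comps_mult[OF E_hom, of f k g n] by (simp add: sprod_singleton)

text \<open>Both d and s satisfy the chain rule on pulled back functions; \<open>DX\<close> combines
  sX in form degree 0 with dX in form degree 1.\<close>

lemma tot_dif_E:
  assumes "smooth_fun (patch Q) f"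
  shows "tot_dif 0 (E f) = (\<Sum>\<mu>\<in>UNIV. E (pd \<mu> f) * DX \<mu>)"
proof (rule super_hom_eqI)
  show "super_hom 1 (tot_dif 0 (E f))"
    using super_hom_tot_dif[OF E_hom[OF assms]] by simp
  show "super_hom 1 (\<Sum>\<mu>\<in>UNIV. E (pd \<mu> f) * DX \<mu>)"
    by (rule super_hom_sum, rule mult_hom[OF E_hom D_hom(1)]) (simp_all add: assms)
  fix n
  have "comps 1 (\<Sum>\<mu>\<in>UNIV. E (pd \<mu> f) * DX \<mu>) n = (\<Sum>\<mu>\<in>UNIV. ev \<Phi> (pd \<mu> f) * comps 1 (DX \<mu>) n)"
    by (simp add: comps_E_mult[OF smooth_fun_pd D_hom(1)] assms)
  then show "comps 1 (tot_dif 0 (E f)) n = comps 1 (\<Sum>\<mu>\<in>UNIV. E (pd \<mu> f) * DX \<mu>) n"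
    unfolding comps_DX comps_tot_dif[of 1 0, simplified] comps_E
    using s_ev[OF assms] ev_dif[OF assms]
    by (auto simp: sdif_def of_comps_def nth_Cons sg_def split: nat.split)
qed

lemma tot_dif_E_mult:
  assumes "smooth_fun (patch Q) f" "super_hom k g"
  shows "tot_dif k (E f * g) = (\<Sum>\<mu>\<in>UNIV. DX \<mu> * (E (pd \<mu> f) * g)) + E f * tot_dif k g"
proof -
  have "E (pd \<mu> f) * DX \<mu> * g = DX \<mu> * (E (pd \<mu> f) * g)" for \<mu>
    using E_comm[OF D_hom(1) smooth_fun_pd[OF assms(1)]] by (simp add: mult.assoc[symmetric])
  then show ?thesis
    using tot_dif_mult[OF E_hom[OF assms(1)] assms(2)]
    by (simp add: sg_def tot_dif_E[OF assms(1)] sum_distrib_right)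
qed

lemmas tot_dif_sum = linear_sum[OF tot_dif_linear]
  and tot_dif_add = linear_add[OF tot_dif_linear]
  and tot_dif_scale = linear_cmul[OF tot_dif_linear]

lemma tot_dif_linear_ghost:
  assumes "\<And>a. smooth_fun (patch Q) (f a)"
  shows "tot_dif 1 (\<Sum>a\<in>UNIV. E (f a) * SA a) =
    (\<Sum>\<mu>\<in>UNIV. DX \<mu> * (\<Sum>a\<in>UNIV. E (pd \<mu> (f a)) * SA a)) + (\<Sum>a\<in>UNIV. E (f a) * DA a)"
  by (simp add: tot_dif_sum tot_dif_E_mult[OF assms SA_hom] sum.distrib greek_out sum_distrib_left DA_def)

text \<open>\<open>DA\<close> has even total degree and commutes with \<open>SA\<close>. The minus
  sign of the derivation is compensated by antisymmetry of the flux, so the two terms agree.\<close>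

lemma tot_dif_gc2:
  "tot_dif 2 (gc2 b) = (\<Sum>\<mu>\<in>UNIV. DX \<mu> * gdc2 \<mu> b) + 2 *\<^sub>R (\<Sum>c\<in>UNIV. DA c * gc1 b c)"
proof -
  have SS: "super_hom 2 (SA c * SA d)" for c d
    using mult_hom[OF SA_hom SA_hom] by simp
  have DSS: "tot_dif 2 (SA c * SA d) = DA c * SA d - SA c * DA d" for c d
    using tot_dif_mult[OF SA_hom SA_hom] by (simp add: sg_def DA_def)
  have "tot_dif 2 (gc2 b) = (\<Sum>\<mu>\<in>UNIV. DX \<mu> * gdc2 \<mu> b)
      + (\<Sum>c\<in>UNIV. \<Sum>d\<in>UNIV. C b c d * (DA c * SA d))
      - (\<Sum>c\<in>UNIV. \<Sum>d\<in>UNIV. C b c d * (SA c * DA d))"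
    unfolding gc2_def tot_dif_sum tot_dif_E_mult[OF flux_smooth SS] DSS gdc2_def
    by (simp add: sum.distrib sum_subtractf right_diff_distrib greek_out sum_distrib_left)
  moreover have left: "C b c d * (DA c * SA d) = DA c * (C b c d * SA d)" for c d
    by (rule left_commuteI[OF E_comm[OF D_hom(2) flux_smooth], symmetric])
  moreover have "(\<Sum>c\<in>UNIV. \<Sum>d\<in>UNIV. C b c d * (SA c * DA d)) = - (\<Sum>c\<in>UNIV. \<Sum>d\<in>UNIV. C b c d * (DA c * SA d))"
  proof -
    have "(\<Sum>c\<in>UNIV. \<Sum>d\<in>UNIV. C b c d * (SA c * DA d)) = (\<Sum>d\<in>UNIV. \<Sum>c\<in>UNIV. C b c d * (SA c * DA d))"
      by (rule sum.swap)
    also have "\<dots> = (\<Sum>d\<in>UNIV. \<Sum>c\<in>UNIV. - (C b d c * (DA d * SA c)))"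
      by (intro sum.cong refl, subst flux_pd_antisym(2), subst even_comm[OF D_hom(2) SA_hom]) simp_all
    finally show ?thesis by (simp only: sum_negf)
  qed
  ultimately show ?thesis
    by (simp add: gc1_def sum_distrib_left scaleR_2)
qed

text \<open>With \<open>DA\<close> moved to the front, the derivative of three ghosts is a cyclic
  sum, and cyclic invariance of the flux makes its three terms equal.\<close>

lemma tot_dif_gdc3:
  "tot_dif 3 (gdc3 \<mu>) = (\<Sum>\<kappa>\<in>UNIV. DX \<kappa> * gddc3 \<kappa> \<mu>) + 3 *\<^sub>R (\<Sum>a\<in>UNIV. DA a * gdc2 \<mu> a)"
proof -
  have SS: "super_hom 2 (SA c * SA d)" for c d
    using mult_hom[OF SA_hom SA_hom] by simp
  have SSS: "super_hom 3 (SA b * (SA c * SA d))" for b c d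
    using mult_hom[OF SA_hom SS] by simp
  have DSS: "tot_dif 2 (SA c * SA d) = DA c * SA d - SA c * DA d" for c d
    using tot_dif_mult[OF SA_hom SA_hom] by (simp add: sg_def DA_def)
  have DSSS: "tot_dif 3 (SA a * (SA b * SA c)) =
      DA a * (SA b * SA c) + (DA b * (SA c * SA a) + DA c * (SA a * SA b))" for a b c
  proof -
    have "tot_dif 3 (SA a * (SA b * SA c)) = DA a * (SA b * SA c) - SA a * (DA b * SA c) + SA a * (SA b * DA c)"
      using tot_dif_mult[OF SA_hom SS] by (simp add: sg_def DA_def[symmetric] DSS algebra_simps)
    moreover have "SA a * (DA b * SA c) = - (DA b * (SA c * SA a))"
      unfolding left_commuteI[OF even_comm[OF D_hom(2) SA_hom, symmetric], simplified] SA_SA[of c a] by simp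
    moreover have "SA a * (SA b * DA c) = DA c * (SA a * SA b)"
      using even_comm[OF D_hom(2) SS] by (simp add: mult.assoc)
    ultimately show ?thesis by simp
  qed
  have T: "(\<Sum>a\<in>UNIV. \<Sum>b\<in>UNIV. \<Sum>c\<in>UNIV. dC \<mu> a b c * (DA a * (SA b * SA c))) = (\<Sum>a\<in>UNIV. DA a * gdc2 \<mu> a)"
    by (simp add: gdc2_def sum_distrib_left left_commuteI[OF E_comm[OF D_hom(2) smooth_fun_pd[OF flux_smooth]]])
  have "(\<Sum>a\<in>UNIV. \<Sum>b\<in>UNIV. \<Sum>c\<in>UNIV. dC \<mu> a b c * (DA b * (SA c * SA a))) =
      (\<Sum>a\<in>UNIV. \<Sum>b\<in>UNIV. \<Sum>c\<in>UNIV. dC \<mu> b c a * (DA b * (SA c * SA a)))"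
    by (intro sum.cong refl arg_cong2[of _ _ _ _ times] flux_cyc(2)[symmetric])
  also have "\<dots> = (\<Sum>a\<in>UNIV. DA a * gdc2 \<mu> a)"
    unfolding T[symmetric] by (rule sum3_cyc)
  finally have T1: "(\<Sum>a\<in>UNIV. \<Sum>b\<in>UNIV. \<Sum>c\<in>UNIV. dC \<mu> a b c * (DA b * (SA c * SA a))) =
    (\<Sum>a\<in>UNIV. DA a * gdc2 \<mu> a)" .
  have "(\<Sum>a\<in>UNIV. \<Sum>b\<in>UNIV. \<Sum>c\<in>UNIV. dC \<mu> a b c * (DA c * (SA a * SA b))) =
      (\<Sum>a\<in>UNIV. \<Sum>b\<in>UNIV. \<Sum>c\<in>UNIV. dC \<mu> c a b * (DA c * (SA a * SA b)))"
    by (intro sum.cong refl arg_cong2[of _ _ _ _ times] flux_cyc(2))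
  also have "\<dots> = (\<Sum>a\<in>UNIV. DA a * gdc2 \<mu> a)"
    unfolding T[symmetric] by (rule sum3_cyc[symmetric])
  finally have T2: "(\<Sum>a\<in>UNIV. \<Sum>b\<in>UNIV. \<Sum>c\<in>UNIV. dC \<mu> a b c * (DA c * (SA a * SA b))) =
    (\<Sum>a\<in>UNIV. DA a * gdc2 \<mu> a)" .
  show ?thesis
    unfolding gdc3_def tot_dif_sum tot_dif_E_mult[OF smooth_fun_pd[OF flux_smooth] SSS] DSSS gddc3_def
      distrib_left sum.distrib T T1 T2
    by (simp add: greek_out sum_distrib_left scaleR_3)
qed

lemma tot_dif_gr: "tot_dif 1 (gr \<mu>) = (\<Sum>\<kappa>\<in>UNIV. DX \<kappa> * gdr \<kappa> \<mu>) + (\<Sum>a\<in>UNIV. R a \<mu> * DA a)"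
  unfolding gr_def gdr_def by (rule tot_dif_linear_ghost) simp

lemma tot_dif_gdr: "tot_dif 1 (gdr \<mu> \<nu>) = (\<Sum>\<kappa>\<in>UNIV. DX \<kappa> * gddr \<kappa> \<mu> \<nu>) + (\<Sum>a\<in>UNIV. dR \<mu> a \<nu> * DA a)"
  unfolding gdr_def gddr_def by (rule tot_dif_linear_ghost) simp

text \<open>Chain rule for \<open>gy\<close> as a function of X, \<open>SB\<close> and
  \<open>SA\<close>. The coefficients of \<open>DX\<close>, \<open>DB\<close>, \<open>DA\<close> are
  exactly those that enter \<open>master_A\<close>; \<open>tot_dif_gz\<close> matches
  \<open>master_B\<close> in the same way.\<close>

lemma tot_dif_gy:
  "tot_dif 2 (gy b) = (\<Sum>\<kappa>\<in>UNIV. DX \<kappa> * gdy \<kappa> b) + (\<Sum>\<mu>\<in>UNIV. R b \<mu> * DB \<mu>) + (\<Sum>c\<in>UNIV. DA c * gc1 b c)"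
proof -
  have "(\<Sum>\<nu>\<in>UNIV. \<Sum>\<kappa>\<in>UNIV. DX \<kappa> * (dR \<kappa> b \<nu> * SB \<nu>)) = (\<Sum>\<kappa>\<in>UNIV. \<Sum>\<nu>\<in>UNIV. DX \<kappa> * (dR \<kappa> b \<nu> * SB \<nu>))"
    by (rule sum.swap)
  then show ?thesis
    unfolding gy_def gdy_def tot_dif_add tot_dif_scale tot_dif_sum tot_dif_E_mult[OF anchor_smooth SB_hom] tot_dif_gc2 DB_def[symmetric]
    by (simp add: sum.distrib distrib_left sum_distrib_left scaleR_add_right scaleR_sum_right)
qed

lemma tot_dif_gz:
  "tot_dif 3 (gz \<mu>) = (\<Sum>\<nu>\<in>UNIV. DB \<nu> * gdr \<mu> \<nu>) + (\<Sum>\<kappa>\<in>UNIV. DX \<kappa> * gdz \<kappa> \<mu>) + (\<Sum>a\<in>UNIV. DA a * gdy \<mu> a)"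
proof -
  have D: "tot_dif 3 (SB \<nu> * gdr \<mu> \<nu>) = DB \<nu> * gdr \<mu> \<nu> + SB \<nu> * tot_dif 1 (gdr \<mu> \<nu>)" for \<nu>
    using tot_dif_mult[OF SB_hom ghost_hom(2)] by (simp add: sg_def DB_def)
  have X: "(\<Sum>\<nu>\<in>UNIV. SB \<nu> * (\<Sum>\<kappa>\<in>UNIV. DX \<kappa> * gddr \<kappa> \<mu> \<nu>)) = (\<Sum>\<kappa>\<in>UNIV. DX \<kappa> * (\<Sum>\<nu>\<in>UNIV. SB \<nu> * gddr \<kappa> \<mu> \<nu>))"
    unfolding sum_distrib_left left_commuteI[OF SB_comm[OF D_hom(1)], symmetric] by (rule sum.swap)
  have A: "SB \<nu> * (dR \<mu> a \<nu> * DA a) = DA a * (dR \<mu> a \<nu> * SB \<nu>)" for \<nu> a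
    by (subst comm_left_rules(3), simp, subst SB_comm[OF D_hom(2), symmetric],
      rule left_commuteI[OF E_comm[OF D_hom(2) smooth_fun_pd[OF anchor_smooth]], symmetric])
  have "(\<Sum>\<nu>\<in>UNIV. SB \<nu> * (\<Sum>a\<in>UNIV. dR \<mu> a \<nu> * DA a)) = (\<Sum>a\<in>UNIV. DA a * (\<Sum>\<nu>\<in>UNIV. dR \<mu> a \<nu> * SB \<nu>))"
    unfolding sum_distrib_left A by (rule sum.swap)
  then show ?thesis
    unfolding gz_def gdz_def gdy_def tot_dif_add tot_dif_scale tot_dif_sum D tot_dif_gdr tot_dif_gdc3
    by (simp add: sum.distrib distrib_left X scaleR_add_right scaleR_sum_right)
qed

end

section \<open>Contractions with antisymmetric coefficients\<close>

text \<open>Renaming summation indices moves a permutation from X to T, where it costs its sign; the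
  two transpositions generate the rest.\<close>

lemma antisym_contraction_perms:
  fixes T :: "'i::finite \<Rightarrow> 'i \<Rightarrow> 'i \<Rightarrow> 'w::ring" and X :: "'i \<Rightarrow> 'i \<Rightarrow> 'i \<Rightarrow> 'w"
  assumes T: "\<And>a b c. T b a c = - T a b c" "\<And>a b c. T a c b = - T a b c"
  defines "S \<equiv> \<Sum>a\<in>UNIV. \<Sum>b\<in>UNIV. \<Sum>c\<in>UNIV. T a b c * X a b c"
  shows "(\<Sum>a\<in>UNIV. \<Sum>b\<in>UNIV. \<Sum>c\<in>UNIV. T a b c * X b a c) = - S"
    and "(\<Sum>a\<in>UNIV. \<Sum>b\<in>UNIV. \<Sum>c\<in>UNIV. T a b c * X a c b) = - S"
    and "(\<Sum>a\<in>UNIV. \<Sum>b\<in>UNIV. \<Sum>c\<in>UNIV. T a b c * X b c a) = S"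
    and "(\<Sum>a\<in>UNIV. \<Sum>b\<in>UNIV. \<Sum>c\<in>UNIV. T a b c * X c a b) = S"
    and "(\<Sum>a\<in>UNIV. \<Sum>b\<in>UNIV. \<Sum>c\<in>UNIV. T a b c * X c b a) = - S"
proof -
  let ?S = "\<lambda>X. \<Sum>a\<in>UNIV. \<Sum>b\<in>UNIV. \<Sum>c\<in>UNIV. T a b c * X a b c"
  have 1: "?S (\<lambda>a b c. X b a c) = - ?S X" for X
  proof -
    have "?S (\<lambda>a b c. X b a c) = (\<Sum>b\<in>UNIV. \<Sum>a\<in>UNIV. \<Sum>c\<in>UNIV. T a b c * X b a c)"
      by (rule sum.swap)
    also have "\<dots> = (\<Sum>b\<in>UNIV. \<Sum>a\<in>UNIV. \<Sum>c\<in>UNIV. - (T b a c * X b a c))"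
      by (intro sum.cong refl, subst T(1)) simp
    finally show ?thesis by (simp only: sum_negf)
  qed
  have 2: "?S (\<lambda>a b c. X a c b) = - ?S X" for X
  proof -
    have "?S (\<lambda>a b c. X a c b) = (\<Sum>a\<in>UNIV. \<Sum>c\<in>UNIV. \<Sum>b\<in>UNIV. T a b c * X a c b)"
      by (rule sum.cong[OF refl]) (rule sum.swap)
    also have "\<dots> = (\<Sum>a\<in>UNIV. \<Sum>c\<in>UNIV. \<Sum>b\<in>UNIV. - (T a c b * X a c b))"
      by (intro sum.cong refl, subst T(2)) simp
    finally show ?thesis by (simp only: sum_negf)
  qed
  show "?S (\<lambda>a b c. X b a c) = - S" "?S (\<lambda>a b c. X a c b) = - S"
    unfolding S_def by (rule 1, rule 2)
  show "?S (\<lambda>a b c. X b c a) = S"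
    unfolding S_def using 1[of "\<lambda>a b c. X a c b"] 2[of X] by (simp only: minus_minus)
  show "?S (\<lambda>a b c. X c a b) = S"
    unfolding S_def using 2[of "\<lambda>a b c. X b a c"] 1[of X] by (simp only: minus_minus)
  have "?S (\<lambda>a b c. X c b a) = - ?S (\<lambda>a b c. X b c a)"
    using 1[of "\<lambda>a b c. X c a b"] 2[of "\<lambda>a b c. X b a c"] 1[of X] 1[of "\<lambda>a b c. X a c b"] 2[of X]
    by (simp only: minus_minus)
  then show "?S (\<lambda>a b c. X c b a) = - S"
    unfolding S_def using 1[of "\<lambda>a b c. X a c b"] 2[of X] by (simp only: minus_minus)
qed

context closed_3d_forms
begin

context
  fixes e A A2 A3 :: "'i::finite \<Rightarrow> 'w"
  assumes bidegs: "\<And>a. e a \<in> bideg K 1 0" "\<And>a. A a \<in> bideg K 0 1"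
    "\<And>a. A2 a \<in> bideg K (-1) 2" "\<And>a. A3 a \<in> bideg K (-2) 3"
begin

text \<open>Oriented towards the order A3, A2, A, e, in which contractions are compared.\<close>

lemma order_rules:
  "e a * A b = A b * e a" "e a * (A b * u) = A b * (e a * u)"
  "e a * A2 b = - (A2 b * e a)" "e a * (A2 b * u) = - (A2 b * (e a * u))"
  "e a * A3 b = A3 b * e a" "e a * (A3 b * u) = A3 b * (e a * u)"
  "A a * A2 b = A2 b * A a" "A a * (A2 b * u) = A2 b * (A a * u)"
proof -
  show 1: "e a * A b = A b * e a" "e a * A2 b = - (A2 b * e a)" "e a * A3 b = A3 b * e a"
    "A a * A2 b = A2 b * A a"
    by (subst graded_comm[OF bidegs(1) bidegs(2)] graded_comm[OF bidegs(1) bidegs(3)]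
        graded_comm[OF bidegs(1) bidegs(4)] graded_comm[OF bidegs(2) bidegs(3)], simp add: sg_def)+
  show "e a * (A b * u) = A b * (e a * u)" "e a * (A2 b * u) = - (A2 b * (e a * u))"
    "e a * (A3 b * u) = A3 b * (e a * u)" "A a * (A2 b * u) = A2 b * (A a * u)"
    using 1 by (simp_all add: mult.assoc[symmetric])
qed

lemma quadratic_contraction:
  assumes T: "\<And>a b. T b a = - T a b"
  shows "(\<Sum>a\<in>UNIV. \<Sum>b\<in>UNIV. T a b * sprod 1 (of_comps [e a, A a]) (of_comps [e b, A b]) 1) =
    2 *\<^sub>R (\<Sum>a\<in>UNIV. \<Sum>b\<in>UNIV. T a b * (A a * e b))"
proof -
  have "(\<Sum>a\<in>UNIV. \<Sum>b\<in>UNIV. T a b * (A b * e a)) = (\<Sum>b\<in>UNIV. \<Sum>a\<in>UNIV. T a b * (A b * e a))"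
    by (rule sum.swap)
  also have "\<dots> = (\<Sum>b\<in>UNIV. \<Sum>a\<in>UNIV. - (T b a * (A b * e a)))"
    by (intro sum.cong refl, subst T) simp
  finally have "(\<Sum>a\<in>UNIV. \<Sum>b\<in>UNIV. T a b * (A b * e a)) = - (\<Sum>a\<in>UNIV. \<Sum>b\<in>UNIV. T a b * (A a * e b))"
    by (simp only: sum_negf)
  then show ?thesis
    by (simp add: sprod_expand of_comps_expand sg_def order_rules distrib_left right_diff_distrib
        sum.distrib sum_negf sum_subtractf scaleR_2)
qed

text \<open>For a superfield of odd total degree, antisymmetry of T makes all placements of the
  components contribute equally, so the coefficients are multinomial: 3 if two factors are of one
  kind, 6 if all differ. The minus sign of the 6 is the conversion sign for the order A2, A, e. It
  serves twice, with A2 and A3 zero for s and with antifields for the action.\<close>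

lemma cubic_contraction:
  assumes T: "\<And>a b c. T b a c = - T a b c" "\<And>a b c. T a c b = - T a b c"
  defines "U \<equiv> \<lambda>a. of_comps [e a, A a, A2 a, A3 a]"
  defines "con \<equiv> \<lambda>n. \<Sum>a\<in>UNIV. \<Sum>b\<in>UNIV. \<Sum>c\<in>UNIV. T a b c * sprod 1 (U a) (sprod 1 (U b) (U c)) n"
    and "S \<equiv> \<lambda>X. \<Sum>a\<in>UNIV. \<Sum>b\<in>UNIV. \<Sum>c\<in>UNIV. T a b c * X a b c"
  shows "con 0 = S (\<lambda>a b c. e a * (e b * e c))"
    and "con 1 = 3 *\<^sub>R S (\<lambda>a b c. A a * (e b * e c))"
    and "con 2 = 3 *\<^sub>R S (\<lambda>a b c. A a * (A b * e c)) + 3 *\<^sub>R S (\<lambda>a b c. A2 a * (e b * e c))"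
    and "con 3 = S (\<lambda>a b c. A a * (A b * A c)) - 6 *\<^sub>R S (\<lambda>a b c. A2 a * (A b * e c))
      + 3 *\<^sub>R S (\<lambda>a b c. A3 a * (e b * e c))"
proof -
  note perms = antisym_contraction_perms[of T, OF T]
  note rules = sprod_expand of_comps_expand sg_def order_rules distrib_left right_diff_distrib
        sum.distrib sum_subtractf sum_negf scaleR_3 mult.assoc
  show "con 0 = S (\<lambda>a b c. e a * (e b * e c))"
    unfolding con_def S_def U_def by (simp add: rules)
  show "con 1 = 3 *\<^sub>R S (\<lambda>a b c. A a * (e b * e c))"
    unfolding con_def S_def U_def
    by (simp add: rules perms[of "\<lambda>a b c. A a * (e b * e c)"])
  show "con 2 = 3 *\<^sub>R S (\<lambda>a b c. A a * (A b * e c)) + 3 *\<^sub>R S (\<lambda>a b c. A2 a * (e b * e c))"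
    unfolding con_def S_def U_def
    by (simp add: rules perms[of "\<lambda>a b c. A a * (A b * e c)"] perms[of "\<lambda>a b c. A2 a * (e b * e c)"])
  have six: "6 *\<^sub>R x = x + x + x + x + x + x" for x :: 'w
    using scaleR_add_left[of 3 3 x] by (simp add: scaleR_3)
  show "con 3 = S (\<lambda>a b c. A a * (A b * A c)) - 6 *\<^sub>R S (\<lambda>a b c. A2 a * (A b * e c))
      + 3 *\<^sub>R S (\<lambda>a b c. A3 a * (e b * e c))"
    unfolding con_def S_def U_def
    by (simp add: rules six perms[of "\<lambda>a b c. A2 a * (A b * e c)"] perms[of "\<lambda>a b c. A3 a * (e b * e c)"])
qed

end

end


context courant_sigma_model
begin

lemma ev_comm:
  assumes "smooth_fun (patch Q) f" "u \<in> bideg K g p"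
  shows "u * ev \<Phi> f = ev \<Phi> f * u" "u * (ev \<Phi> f * v) = ev \<Phi> f * (u * v)"
proof -
  show 1: "u * ev \<Phi> f = ev \<Phi> f * u"
    by (rule trans[OF graded_comm[OF assms(2) ev_bideg[OF assms(1)]]]) (simp add: sg_def)
  show "u * (ev \<Phi> f * v) = ev \<Phi> f * (u * v)"
    using 1 by (simp add: mult.assoc[symmetric])
qed

lemma ev_flux_up: "ev \<Phi> (flux_up Q a b c) = (\<Sum>e\<in>UNIV. h a e *\<^sub>R ev \<Phi> (flux Q e b c))"
proof -
  have "ev \<Phi> (flux_up Q a b c) = ev \<Phi> (\<lambda>x. \<Sum>e\<in>UNIV. h a e * flux Q e b c x)"
    by (rule arg_cong[of _ _ "ev \<Phi>"]) (simp add: fun_eq_iff flux_up_def)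
  then show ?thesis by (simp add: ev_sum ev_cmult)
qed

lemma flux_up_sum:
  "(\<Sum>b\<in>UNIV. \<Sum>c\<in>UNIV. ev \<Phi> (flux_up Q a b c) * X b c) =
    (\<Sum>e\<in>UNIV. h a e *\<^sub>R (\<Sum>b\<in>UNIV. \<Sum>c\<in>UNIV. ev \<Phi> (flux Q e b c) * X b c))"
proof -
  have "(\<Sum>b\<in>UNIV. \<Sum>c\<in>UNIV. ev \<Phi> (flux_up Q a b c) * X b c) =
      (\<Sum>b\<in>UNIV. \<Sum>c\<in>UNIV. \<Sum>e\<in>UNIV. h a e *\<^sub>R (ev \<Phi> (flux Q e b c) * X b c))"
    by (simp add: ev_flux_up sum_distrib_right)
  also have "\<dots> = (\<Sum>e\<in>UNIV. \<Sum>b\<in>UNIV. \<Sum>c\<in>UNIV. h a e *\<^sub>R (ev \<Phi> (flux Q e b c) * X b c))"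
    by (rule sum3_cyc[symmetric])
  finally show ?thesis by (simp add: scaleR_sum_right)
qed

end

context courant_brst
begin

section \<open>Form components of the contracted superfields\<close>

lemma comps_SA: "comps 1 (SA a) = of_comps [eps \<Phi> a, fA \<Phi> a, 0, 0]"
  by (simp add: SA_def of_comps_def fun_eq_iff nth_Cons split: nat.split)

lemma comps_SB: "comps 2 (SB \<mu>) = of_comps [tpsi \<Phi> \<mu>, psi \<Phi> \<mu>, fB \<Phi> \<mu>]"
  by (simp add: SB_def)

lemma bideg_0: "0 \<in> bideg K g f"
  by (rule subspace_0[OF bideg_subspace])

lemmas SA_cubic = cubic_contraction[where e = "eps \<Phi>" and A = "fA \<Phi>" and ?A2.0 = "\<lambda>_. 0" and ?A3.0 = "\<lambda>_. 0",
    OF fields_bideg(3,1) bideg_0 bideg_0, simplified]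

lemma comps_quadratic:
  assumes "\<And>a b. smooth_fun (patch Q) (f a b)" "\<And>a b. ev \<Phi> (f b a) = - ev \<Phi> (f a b)"
  defines "q \<equiv> comps 2 (\<Sum>a\<in>UNIV. \<Sum>b\<in>UNIV. E (f a b) * (SA a * SA b))"
  shows "q 0 = (\<Sum>a\<in>UNIV. \<Sum>b\<in>UNIV. ev \<Phi> (f a b) * (eps \<Phi> a * eps \<Phi> b))"
    and "q (Suc 0) = 2 *\<^sub>R (\<Sum>a\<in>UNIV. \<Sum>b\<in>UNIV. ev \<Phi> (f a b) * (fA \<Phi> a * eps \<Phi> b))"
    and "q 2 = (\<Sum>a\<in>UNIV. \<Sum>b\<in>UNIV. ev \<Phi> (f a b) * (fA \<Phi> a * fA \<Phi> b))"
proof -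
  have SS: "super_hom 2 (SA a * SA b)" for a b
    using mult_hom[OF SA_hom SA_hom] by simp
  have q: "q n = (\<Sum>a\<in>UNIV. \<Sum>b\<in>UNIV. ev \<Phi> (f a b) * sprod 1 (comps 1 (SA a)) (comps 1 (SA b)) n)" for n
    using comps_mult[OF SA_hom SA_hom]
    by (simp add: q_def comps_E_mult[OF assms(1) SS])
  show "q 0 = (\<Sum>a\<in>UNIV. \<Sum>b\<in>UNIV. ev \<Phi> (f a b) * (eps \<Phi> a * eps \<Phi> b))"
    "q 2 = (\<Sum>a\<in>UNIV. \<Sum>b\<in>UNIV. ev \<Phi> (f a b) * (fA \<Phi> a * fA \<Phi> b))"
    unfolding q comps_SA by (simp_all add: sprod_expand of_comps_expand sg_def)
  have "comps 1 (SA a) = of_comps [eps \<Phi> a, fA \<Phi> a]" for a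
    by (simp add: SA_def)
  then show "q (Suc 0) = 2 *\<^sub>R (\<Sum>a\<in>UNIV. \<Sum>b\<in>UNIV. ev \<Phi> (f a b) * (fA \<Phi> a * eps \<Phi> b))"
    unfolding q using quadratic_contraction[where e = "eps \<Phi>" and A = "fA \<Phi>" and ?A2.0 = "\<lambda>_. 0" and ?A3.0 = "\<lambda>_. 0"
      and T = "\<lambda>a b. ev \<Phi> (f a b)", OF fields_bideg(3,1) bideg_0 bideg_0 assms(2)] by simp
qed

lemma comps_cubic:
  assumes "\<And>a b c. smooth_fun (patch Q) (f a b c)"
    "\<And>a b c. ev \<Phi> (f b a c) = - ev \<Phi> (f a b c)" "\<And>a b c. ev \<Phi> (f a c b) = - ev \<Phi> (f a b c)"
  defines "q \<equiv> comps 3 (\<Sum>a\<in>UNIV. \<Sum>b\<in>UNIV. \<Sum>c\<in>UNIV. E (f a b c) * (SA a * (SA b * SA c)))"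
  shows "q 0 = (\<Sum>a\<in>UNIV. \<Sum>b\<in>UNIV. \<Sum>c\<in>UNIV. ev \<Phi> (f a b c) * (eps \<Phi> a * (eps \<Phi> b * eps \<Phi> c)))"
    and "q (Suc 0) = 3 *\<^sub>R (\<Sum>a\<in>UNIV. \<Sum>b\<in>UNIV. \<Sum>c\<in>UNIV. ev \<Phi> (f a b c) * (fA \<Phi> a * (eps \<Phi> b * eps \<Phi> c)))"
    and "q 2 = 3 *\<^sub>R (\<Sum>a\<in>UNIV. \<Sum>b\<in>UNIV. \<Sum>c\<in>UNIV. ev \<Phi> (f a b c) * (fA \<Phi> a * (fA \<Phi> b * eps \<Phi> c)))"
proof -
  have SS: "super_hom 2 (SA a * SA b)" for a b
    using mult_hom[OF SA_hom SA_hom] by simp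
  have SSS: "super_hom 3 (SA a * (SA b * SA c))" for a b c
    using mult_hom[OF SA_hom SS] by simp
  have c2: "comps 2 (SA b * SA c) = sprod 1 (comps 1 (SA b)) (comps 1 (SA c))" for b c
    using comps_mult[OF SA_hom SA_hom] by (simp add: fun_eq_iff)
  have c3: "comps 3 (SA a * (SA b * SA c)) n = sprod 1 (comps 1 (SA a)) (sprod 1 (comps 1 (SA b)) (comps 1 (SA c))) n" for a b c n
    using comps_mult[OF SA_hom SS] by (simp add: c2)
  have q: "q n = (\<Sum>a\<in>UNIV. \<Sum>b\<in>UNIV. \<Sum>c\<in>UNIV. ev \<Phi> (f a b c) *
      sprod 1 (comps 1 (SA a)) (sprod 1 (comps 1 (SA b)) (comps 1 (SA c))) n)" for n
    by (simp add: q_def comps_E_mult[OF assms(1) SSS] c3)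
  note cubic = SA_cubic[where T = "\<lambda>a b c. ev \<Phi> (f a b c)", OF assms(2,3)]
  show "q 0 = (\<Sum>a\<in>UNIV. \<Sum>b\<in>UNIV. \<Sum>c\<in>UNIV. ev \<Phi> (f a b c) * (eps \<Phi> a * (eps \<Phi> b * eps \<Phi> c)))"
    "q (Suc 0) = 3 *\<^sub>R (\<Sum>a\<in>UNIV. \<Sum>b\<in>UNIV. \<Sum>c\<in>UNIV. ev \<Phi> (f a b c) * (fA \<Phi> a * (eps \<Phi> b * eps \<Phi> c)))"
    "q 2 = 3 *\<^sub>R (\<Sum>a\<in>UNIV. \<Sum>b\<in>UNIV. \<Sum>c\<in>UNIV. ev \<Phi> (f a b c) * (fA \<Phi> a * (fA \<Phi> b * eps \<Phi> c)))"
    unfolding q comps_SA using cubic by simp_all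
qed

lemma comps_SB_SA:
  assumes "\<And>a \<nu>. smooth_fun (patch Q) (f a \<nu>)"
  defines "q \<equiv> comps 3 (\<Sum>\<nu>\<in>UNIV. SB \<nu> * (\<Sum>a\<in>UNIV. E (f a \<nu>) * SA a))"
  shows "q 0 = (\<Sum>a\<in>UNIV. \<Sum>\<nu>\<in>UNIV. ev \<Phi> (f a \<nu>) * (tpsi \<Phi> \<nu> * eps \<Phi> a))"
    and "q (Suc 0) = (\<Sum>a\<in>UNIV. \<Sum>\<nu>\<in>UNIV. ev \<Phi> (f a \<nu>) * (tpsi \<Phi> \<nu> * fA \<Phi> a + psi \<Phi> \<nu> * eps \<Phi> a))"
    and "q 2 = (\<Sum>a\<in>UNIV. \<Sum>\<nu>\<in>UNIV. ev \<Phi> (f a \<nu>) * (fB \<Phi> \<nu> * eps \<Phi> a - psi \<Phi> \<nu> * fA \<Phi> a))"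
proof -
  have BS: "super_hom 3 (SB \<nu> * SA a)" for \<nu> a
    using mult_hom[OF SB_hom SA_hom] by simp
  have "q n = (\<Sum>a\<in>UNIV. \<Sum>\<nu>\<in>UNIV. ev \<Phi> (f a \<nu>) * sprod 2 (comps 2 (SB \<nu>)) (comps 1 (SA a)) n)" for n
  proof -
    have "(\<Sum>\<nu>\<in>UNIV. SB \<nu> * (\<Sum>a\<in>UNIV. E (f a \<nu>) * SA a)) = (\<Sum>a\<in>UNIV. \<Sum>\<nu>\<in>UNIV. E (f a \<nu>) * (SB \<nu> * SA a))"
      by (simp add: sum_distrib_left comm_left_rules assms(1) greek_out)
    then show ?thesis
      using comps_mult[OF SB_hom SA_hom] by (simp add: q_def comps_E_mult[OF assms(1) BS])
  qed
  then show "q 0 = (\<Sum>a\<in>UNIV. \<Sum>\<nu>\<in>UNIV. ev \<Phi> (f a \<nu>) * (tpsi \<Phi> \<nu> * eps \<Phi> a))"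
    "q (Suc 0) = (\<Sum>a\<in>UNIV. \<Sum>\<nu>\<in>UNIV. ev \<Phi> (f a \<nu>) * (tpsi \<Phi> \<nu> * fA \<Phi> a + psi \<Phi> \<nu> * eps \<Phi> a))"
    "q 2 = (\<Sum>a\<in>UNIV. \<Sum>\<nu>\<in>UNIV. ev \<Phi> (f a \<nu>) * (fB \<Phi> \<nu> * eps \<Phi> a - psi \<Phi> \<nu> * fA \<Phi> a))"
    by (simp_all add: comps_SA comps_SB sprod_expand of_comps_expand sg_def add.commute)
qed

lemma comps_gy:
  "comps 2 (gy b) 0 = (\<Sum>\<nu>\<in>UNIV. ev \<Phi> (anchor Q b \<nu>) * tpsi \<Phi> \<nu>)
    + (1/2) *\<^sub>R (\<Sum>c\<in>UNIV. \<Sum>d\<in>UNIV. ev \<Phi> (flux Q b c d) * (eps \<Phi> c * eps \<Phi> d))"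
  "comps 2 (gy b) (Suc 0) = (\<Sum>\<nu>\<in>UNIV. ev \<Phi> (anchor Q b \<nu>) * psi \<Phi> \<nu>)
    + (\<Sum>c\<in>UNIV. \<Sum>d\<in>UNIV. ev \<Phi> (flux Q b c d) * (fA \<Phi> c * eps \<Phi> d))"
  "comps 2 (gy b) 2 = (\<Sum>\<nu>\<in>UNIV. ev \<Phi> (anchor Q b \<nu>) * fB \<Phi> \<nu>)
    + (1/2) *\<^sub>R (\<Sum>c\<in>UNIV. \<Sum>d\<in>UNIV. ev \<Phi> (flux Q b c d) * (fA \<Phi> c * fA \<Phi> d))"
  unfolding gy_def gc2_def
  by (simp_all only: comps_simps(2,5) comps_quadratic[OF flux_smooth ev_antisym(2)])
    (simp_all add: comps_E_mult[OF anchor_smooth SB_hom] comps_SB of_comps_expand)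

lemma comps_gdy:
  "comps 2 (gdy \<kappa> b) 0 = (\<Sum>\<nu>\<in>UNIV. ev \<Phi> (pd \<kappa> (anchor Q b \<nu>)) * tpsi \<Phi> \<nu>)
    + (1/2) *\<^sub>R (\<Sum>c\<in>UNIV. \<Sum>d\<in>UNIV. ev \<Phi> (pd \<kappa> (flux Q b c d)) * (eps \<Phi> c * eps \<Phi> d))"
  unfolding gdy_def gdc2_def
  by (simp only: comps_simps(2,5) comps_quadratic[OF smooth_fun_pd[OF flux_smooth] ev_antisym(4)])
    (simp add: comps_E_mult[OF smooth_fun_pd[OF anchor_smooth] SB_hom] comps_SB of_comps_expand)

lemma comps_gz:
  "comps 3 (gz \<mu>) 0 = (\<Sum>a\<in>UNIV. \<Sum>\<nu>\<in>UNIV. ev \<Phi> (pd \<mu> (anchor Q a \<nu>)) * (tpsi \<Phi> \<nu> * eps \<Phi> a))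
    + (1/6) *\<^sub>R (\<Sum>a\<in>UNIV. \<Sum>b\<in>UNIV. \<Sum>c\<in>UNIV. ev \<Phi> (pd \<mu> (flux Q a b c)) * (eps \<Phi> a * (eps \<Phi> b * eps \<Phi> c)))"
  "comps 3 (gz \<mu>) (Suc 0) = (\<Sum>a\<in>UNIV. \<Sum>\<nu>\<in>UNIV. ev \<Phi> (pd \<mu> (anchor Q a \<nu>)) * (tpsi \<Phi> \<nu> * fA \<Phi> a + psi \<Phi> \<nu> * eps \<Phi> a))
    + (1/2) *\<^sub>R (\<Sum>a\<in>UNIV. \<Sum>b\<in>UNIV. \<Sum>c\<in>UNIV. ev \<Phi> (pd \<mu> (flux Q a b c)) * (fA \<Phi> a * (eps \<Phi> b * eps \<Phi> c)))"
  "comps 3 (gz \<mu>) 2 = (\<Sum>a\<in>UNIV. \<Sum>\<nu>\<in>UNIV. ev \<Phi> (pd \<mu> (anchor Q a \<nu>)) * (fB \<Phi> \<nu> * eps \<Phi> a - psi \<Phi> \<nu> * fA \<Phi> a))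
    + (1/2) *\<^sub>R (\<Sum>a\<in>UNIV. \<Sum>b\<in>UNIV. \<Sum>c\<in>UNIV. ev \<Phi> (pd \<mu> (flux Q a b c)) * (fA \<Phi> a * (fA \<Phi> b * eps \<Phi> c)))"
  unfolding gz_def gdc3_def gdr_def
  by (simp_all only: comps_simps(2,5) comps_SB_SA[OF smooth_fun_pd[OF anchor_smooth]]
    comps_cubic[OF smooth_fun_pd[OF flux_smooth] ev_antisym(3,4)]) simp_all

lemma comps_gdz:
  "comps 3 (gdz \<kappa> \<mu>) 0 = (\<Sum>a\<in>UNIV. \<Sum>\<nu>\<in>UNIV. ev \<Phi> (pd \<kappa> (pd \<mu> (anchor Q a \<nu>))) * (tpsi \<Phi> \<nu> * eps \<Phi> a))
    + (1/6) *\<^sub>R (\<Sum>a\<in>UNIV. \<Sum>b\<in>UNIV. \<Sum>c\<in>UNIV. ev \<Phi> (pd \<kappa> (pd \<mu> (flux Q a b c))) * (eps \<Phi> a * (eps \<Phi> b * eps \<Phi> c)))"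
  "comps 3 (gdz \<kappa> \<mu>) (Suc 0) = (\<Sum>a\<in>UNIV. \<Sum>\<nu>\<in>UNIV. ev \<Phi> (pd \<kappa> (pd \<mu> (anchor Q a \<nu>))) * (tpsi \<Phi> \<nu> * fA \<Phi> a + psi \<Phi> \<nu> * eps \<Phi> a))
    + (1/2) *\<^sub>R (\<Sum>a\<in>UNIV. \<Sum>b\<in>UNIV. \<Sum>c\<in>UNIV. ev \<Phi> (pd \<kappa> (pd \<mu> (flux Q a b c))) * (fA \<Phi> a * (eps \<Phi> b * eps \<Phi> c)))"
  unfolding gdz_def gddc3_def gddr_def
  by (simp_all only: comps_simps(2,5) comps_SB_SA[OF smooth_fun_pd[OF smooth_fun_pd[OF anchor_smooth]]]
    comps_cubic[OF smooth_fun_pd[OF smooth_fun_pd[OF flux_smooth]] ev_antisym(5,6)]) simp_all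

text \<open>The defects of the field equations of the superfields: they start in form degree 1, 2 and 3, with
  leading components \<open>F\<close> and \<open>G\<close>, and all lower components vanish by the definition of \<open>s\<^sub>0\<close>.\<close>
definition XF where "XF \<mu> = DX \<mu> - gr \<mu>"
definition XG where "XG a = DA a + (\<Sum>b\<in>UNIV. h a b *\<^sub>R gy b)"
definition XH where "XH \<mu> = DB \<mu> + gz \<mu>"

lemma X_hom: "super_hom 1 (XF \<mu>)" "super_hom 2 (XG a)" "super_hom 3 (XH \<mu>)"
  unfolding XF_def XG_def XH_def
  by (intro super_hom_intros super_hom_sum D_hom ghost_hom gyz_hom)+

lemma comps_gr: "comps 1 (gr \<mu>) n = (\<Sum>a\<in>UNIV. ev \<Phi> (anchor Q a \<mu>) * of_comps [eps \<Phi> a, fA \<Phi> a] n)"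
  by (simp add: gr_def comps_E_mult[OF anchor_smooth SA_hom]) (simp add: SA_def)

lemma comps_XF: "comps 1 (XF \<mu>) 0 = 0" "comps 1 (XF \<mu>) (Suc 0) = eomF Q K \<Phi> \<mu>" "comps 1 (XF \<mu>) 2 = 0"
  by (simp_all add: XF_def comps_DX comps_gr of_comps_expand eomF_def)

lemma comps_XG: "comps 2 (XG a) 0 = 0" "comps 2 (XG a) (Suc 0) = 0" "comps 2 (XG a) 2 = eomG Q K \<Phi> a"
proof -
  have D: "comps 2 (DA a) n = sdif K (comps 1 (SA a)) n + sg (int n) *\<^sub>R s (comps 1 (SA a) n)" for n
    unfolding DA_def by (rule comps_tot_dif) simp
  show "comps 2 (XG a) 0 = 0"
    using s_field[of "cEps a"]
    by (simp add: XG_def D comps_SA of_comps_expand sdif_expand comps_gy sg_def mult.assoc scaleR_add_right)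
  show "comps 2 (XG a) (Suc 0) = 0"
    using s_field[of "cA a"]
    by (simp add: XG_def D comps_SA of_comps_expand sdif_expand comps_gy sg_def mult.assoc scaleR_add_right
        flux_up_sum sum.distrib scaleR_sum_right sum_negf)
  show "comps 2 (XG a) 2 = eomG Q K \<Phi> a"
    by (simp add: XG_def D comps_SA of_comps_expand sdif_expand comps_gy sg_def mult.assoc scaleR_add_right
        flux_up_sum sum.distrib eomG_def scaleR_sum_right scaleR_left_commute)
qed

lemma comps_XH: "comps 3 (XH \<mu>) 0 = 0" "comps 3 (XH \<mu>) (Suc 0) = 0" "comps 3 (XH \<mu>) 2 = 0"
proof -
  have D: "comps 3 (DB \<mu>) n = sdif K (comps 2 (SB \<mu>)) n + sg (int n) *\<^sub>R s (comps 2 (SB \<mu>) n)" for n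
    unfolding DB_def by (rule comps_tot_dif) simp
  show "comps 3 (XH \<mu>) 0 = 0"
    using s_field[of "cTpsi \<mu>"]
    by (simp add: XH_def D comps_SB of_comps_expand sdif_expand comps_gz sg_def mult.assoc)
  show "comps 3 (XH \<mu>) (Suc 0) = 0"
    using s_field[of "cPsi \<mu>"]
    by (simp add: XH_def D comps_SB of_comps_expand sdif_expand comps_gz sg_def mult.assoc)
  show "comps 3 (XH \<mu>) 2 = 0"
    using s_field[of "cB \<mu>"]
    by (simp add: XH_def D comps_SB of_comps_expand sdif_expand comps_gz sg_def mult.assoc)
qed

text \<open>Neither d nor s lowers the form degree.\<close>

lemma tot_dif_vanishing:
  assumes "super_hom k f" "\<And>p. p < n \<Longrightarrow> comps k f p = 0"
  shows "m < n \<Longrightarrow> comps (k + 1) (tot_dif k f) m = 0"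
  using assms(2) by (cases m) (simp_all add: comps_tot_dif sdif_expand)

lemma sprod_vanishing: "(\<And>p. p \<le> n \<Longrightarrow> u p = 0) \<Longrightarrow> sprod k u v n = 0"
  by (simp add: sprod_def)

lemma comps_mult_vanishing:
  assumes "super_hom k f" "super_hom l g" "j = k + l" "\<And>p. p \<le> n \<Longrightarrow> comps k f p = 0"
  shows "comps j (f * g) n = 0"
  unfolding assms(3) comps_mult[OF assms(1,2)] by (rule sprod_vanishing) (rule assms(4))

lemma s_s_X: "s (s (fX \<Phi> \<mu>)) = 0"
proof -
  have DDX: "tot_dif 1 (DX \<mu>) = (\<Sum>\<kappa>\<in>UNIV. XF \<kappa> * gdr \<kappa> \<mu>) + (\<Sum>a\<in>UNIV. R a \<mu> * XG a) + tot_dif 1 (XF \<mu>)"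
  proof -
    have "tot_dif 1 (DX \<mu>) = tot_dif 1 (gr \<mu>) + tot_dif 1 (XF \<mu>)"
      by (simp add: XF_def flip: tot_dif_add)
    \<comment> \<open>Here \<open>DX\<close> and \<open>DA\<close> are replaced by their values on
      the field equations plus the defects \<open>XF\<close> and \<open>XG\<close>;
      \<open>master_X\<close> then cancels everything free of defects.\<close>
    also have "tot_dif 1 (gr \<mu>) = (\<Sum>\<kappa>\<in>UNIV. (gr \<kappa> + XF \<kappa>) * gdr \<kappa> \<mu>)
        + (\<Sum>a\<in>UNIV. R a \<mu> * (XG a - (\<Sum>b\<in>UNIV. h a b *\<^sub>R gy b)))"
      unfolding tot_dif_gr by (simp add: XF_def XG_def)
    also have "\<dots> = (\<Sum>\<kappa>\<in>UNIV. XF \<kappa> * gdr \<kappa> \<mu>) + (\<Sum>a\<in>UNIV. R a \<mu> * XG a)"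
      by (simp add: distrib_right right_diff_distrib sum.distrib sum_subtractf master_X sum_distrib_left)
    finally show ?thesis .
  qed
  have "s (s (fX \<Phi> \<mu>)) = comps 2 (tot_dif 1 (DX \<mu>)) 0"
    unfolding DX_def by (subst comps_tot_dif_tot_dif[OF SX_hom]) (simp_all add: SX_def of_comps_expand)
  also have "\<dots> = 0"
    unfolding DDX using comps_mult_vanishing[OF X_hom(1) ghost_hom(2), where j = 2 and n = 0]
      tot_dif_vanishing[OF X_hom(1), where n = 1 and m = 0]
    by (simp add: comps_E_mult[OF anchor_smooth X_hom(2)] comps_XF comps_XG)
  finally show ?thesis .
qed

lemma DDA:
  "tot_dif 2 (DA a) = tot_dif 2 (XG a) - (\<Sum>b\<in>UNIV. h a b *\<^sub>R ((\<Sum>\<kappa>\<in>UNIV. XF \<kappa> * gdy \<kappa> b)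
    + (\<Sum>\<mu>\<in>UNIV. R b \<mu> * XH \<mu>) + (\<Sum>c\<in>UNIV. XG c * gc1 b c)))"
proof -
  have gy: "tot_dif 2 (gy b) = (\<Sum>\<kappa>\<in>UNIV. XF \<kappa> * gdy \<kappa> b)
    + (\<Sum>\<mu>\<in>UNIV. R b \<mu> * XH \<mu>) + (\<Sum>c\<in>UNIV. XG c * gc1 b c)" for b
  proof -
    have "tot_dif 2 (gy b) = (\<Sum>\<kappa>\<in>UNIV. (gr \<kappa> + XF \<kappa>) * gdy \<kappa> b) + (\<Sum>\<mu>\<in>UNIV. R b \<mu> * (XH \<mu> - gz \<mu>))
        + (\<Sum>c\<in>UNIV. (XG c - (\<Sum>e\<in>UNIV. h c e *\<^sub>R gy e)) * gc1 b c)"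
      unfolding tot_dif_gy by (simp add: XF_def XG_def XH_def)
    then show ?thesis
      by (simp add: distrib_right right_diff_distrib left_diff_distrib sum.distrib sum_subtractf master_A)
  qed
  have "tot_dif 2 (DA a) = tot_dif 2 (XG a - (\<Sum>b\<in>UNIV. h a b *\<^sub>R gy b))"
    by (simp add: XG_def)
  also have "\<dots> = tot_dif 2 (XG a) - (\<Sum>b\<in>UNIV. h a b *\<^sub>R tot_dif 2 (gy b))"
    by (simp add: linear_diff[OF tot_dif_linear] tot_dif_sum tot_dif_scale)
  finally show ?thesis unfolding gy .
qed

lemma DDB:
  "tot_dif 3 (DB \<mu>) = tot_dif 3 (XH \<mu>) - ((\<Sum>\<nu>\<in>UNIV. XH \<nu> * gdr \<mu> \<nu>) + (\<Sum>\<kappa>\<in>UNIV. XF \<kappa> * gdz \<kappa> \<mu>)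
    + (\<Sum>a\<in>UNIV. XG a * gdy \<mu> a))"
proof -
  have gz: "tot_dif 3 (gz \<mu>) = (\<Sum>\<nu>\<in>UNIV. XH \<nu> * gdr \<mu> \<nu>) + (\<Sum>\<kappa>\<in>UNIV. XF \<kappa> * gdz \<kappa> \<mu>)
    + (\<Sum>a\<in>UNIV. XG a * gdy \<mu> a)"
  proof -
    have "tot_dif 3 (gz \<mu>) = (\<Sum>\<nu>\<in>UNIV. (XH \<nu> - gz \<nu>) * gdr \<mu> \<nu>) + (\<Sum>\<kappa>\<in>UNIV. (gr \<kappa> + XF \<kappa>) * gdz \<kappa> \<mu>)
        + (\<Sum>a\<in>UNIV. (XG a - (\<Sum>b\<in>UNIV. h a b *\<^sub>R gy b)) * gdy \<mu> a)"
      unfolding tot_dif_gz by (simp add: XF_def XG_def XH_def)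
    then show ?thesis
      by (simp add: distrib_right left_diff_distrib sum.distrib sum_subtractf master_B)
  qed
  have "tot_dif 3 (DB \<mu>) = tot_dif 3 (XH \<mu> - gz \<mu>)"
    by (simp add: XH_def)
  then show ?thesis unfolding linear_diff[OF tot_dif_linear] gz .
qed

text \<open>Only form degrees 0 and 1 are read off, below the starting degrees of \<open>XG\<close>
  and \<open>XH\<close>; the first defect \<open>XF\<close> alone can contribute.\<close>

lemma s_s_A:
  "s (s (eps \<Phi> a)) = 0"
  "s (s (fA \<Phi> a)) = - (\<Sum>b\<in>UNIV. \<Sum>\<mu>\<in>UNIV. h a b *\<^sub>R (eomF Q K \<Phi> \<mu> * comps 2 (gdy \<mu> b) 0))"
proof -
  have s: "s (s (comps 1 (SA a) n)) = comps 3 (tot_dif 2 (DA a)) n" for n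
    unfolding DA_def by (subst comps_tot_dif_tot_dif[OF SA_hom]) simp_all
  have G0: "comps 2 (XG c) p = 0" if "p \<le> Suc 0" for p c
    using that comps_XG[of c] by (cases p) auto
  have H0: "comps 3 (XH \<mu>) p = 0" if "p \<le> 2" for p \<mu>
    using that comps_XH[of \<mu>] by (cases p; cases "p - 1") (auto simp: numeral_2_eq_2)
  have v: "comps 3 (tot_dif 2 (XG a)) n = 0" "comps 3 (XG c * gc1 b c) n = 0" "comps 3 (R b \<mu> * XH \<mu>) n = 0"
    if "n \<le> Suc 0" for n b c \<mu>
    using that tot_dif_vanishing[OF X_hom(2), of 2 a n] comps_mult_vanishing[OF X_hom(2) ghost_hom(4), of 3 n c b c] G0 H0
    by (simp_all add: comps_E_mult[OF anchor_smooth X_hom(3)])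
  have f: "comps 3 (XF \<kappa> * gdy \<kappa> b) n = sprod 1 (comps 1 (XF \<kappa>)) (comps 2 (gdy \<kappa> b)) n" for \<kappa> b n
    using comps_mult[OF X_hom(1) gyz_hom(2)] by simp
  show "s (s (eps \<Phi> a)) = 0"
    using s[of 0] by (simp add: comps_SA of_comps_expand DDA v f sprod_expand comps_XF)
  show "s (s (fA \<Phi> a)) = - (\<Sum>b\<in>UNIV. \<Sum>\<mu>\<in>UNIV. h a b *\<^sub>R (eomF Q K \<Phi> \<mu> * comps 2 (gdy \<mu> b) 0))"
    using s[of "Suc 0"] by (simp add: comps_SA of_comps_expand DDA v f sprod_expand comps_XF scaleR_sum_right)
qed

lemma s_s_B:
  "s (s (tpsi \<Phi> \<mu>)) = 0"
  "s (s (psi \<Phi> \<mu>)) = - (\<Sum>\<kappa>\<in>UNIV. eomF Q K \<Phi> \<kappa> * comps 3 (gdz \<kappa> \<mu>) 0)"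
  "s (s (fB \<Phi> \<mu>)) = - (\<Sum>\<kappa>\<in>UNIV. eomF Q K \<Phi> \<kappa> * comps 3 (gdz \<kappa> \<mu>) (Suc 0))
    - (\<Sum>a\<in>UNIV. eomG Q K \<Phi> a * comps 2 (gdy \<mu> a) 0)"
proof -
  have s: "s (s (comps 2 (SB \<mu>) n)) = comps 4 (tot_dif 3 (DB \<mu>)) n" for n
    unfolding DB_def by (subst comps_tot_dif_tot_dif[OF SB_hom]) simp_all
  have H0: "comps 3 (XH \<mu>) p = 0" if "p \<le> 2" for p \<mu>
    using that comps_XH[of \<mu>] by (cases p; cases "p - 1") (auto simp: numeral_2_eq_2)
  have v: "comps 4 (tot_dif 3 (XH \<mu>)) n = 0" "comps 4 (XH \<nu> * gdr \<mu> \<nu>) n = 0" if "n \<le> 2" for n \<nu>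
    using that tot_dif_vanishing[OF X_hom(3), of 3 \<mu> n] comps_mult_vanishing[OF X_hom(3) ghost_hom(2), of 4 n \<nu> \<mu> \<nu>] H0
    by simp_all
  have f: "comps 4 (XF \<kappa> * gdz \<kappa> \<mu>) n = sprod 1 (comps 1 (XF \<kappa>)) (comps 3 (gdz \<kappa> \<mu>)) n"
    "comps 4 (XG a * gdy \<mu> a) n = sprod 2 (comps 2 (XG a)) (comps 2 (gdy \<mu> a)) n" for \<kappa> a n
    using comps_mult[OF X_hom(1) gyz_hom(4)] comps_mult[OF X_hom(2) gyz_hom(2)] by simp_all
  show "s (s (tpsi \<Phi> \<mu>)) = 0"
    using s[of 0] by (simp add: comps_SB of_comps_expand DDB v f sprod_expand comps_XF comps_XG)
  show "s (s (psi \<Phi> \<mu>)) = - (\<Sum>\<kappa>\<in>UNIV. eomF Q K \<Phi> \<kappa> * comps 3 (gdz \<kappa> \<mu>) 0)"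
    using s[of "Suc 0"] by (simp add: comps_SB of_comps_expand DDB v f sprod_expand comps_XF comps_XG)
  show "s (s (fB \<Phi> \<mu>)) = - (\<Sum>\<kappa>\<in>UNIV. eomF Q K \<Phi> \<kappa> * comps 3 (gdz \<kappa> \<mu>) (Suc 0))
    - (\<Sum>a\<in>UNIV. eomG Q K \<Phi> a * comps 2 (gdy \<mu> a) 0)"
    using s[of 2] by (simp add: comps_SB of_comps_expand DDB v f sprod_expand comps_XF comps_XG sg_def)
qed

lemma s_s_field:
  "s (s (field \<Phi> \<phi>)) = (\<Sum>M\<in>op_contents 2 (kind_of \<phi>). op2_part Q \<Phi> (eomF Q K \<Phi>) (eomG Q K \<Phi>) \<phi> M)"
proof (cases \<phi>)
  case (cX \<mu>)
  then show ?thesis by (simp add: s_s_X op_contents_def)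
next
  case (cA a)
  then show ?thesis by (simp add: s_s_A op_contents_def comps_gdy mult.assoc)
next
  case (cB \<mu>)
  \<comment> \<open>The two contents of the second operation on B are distinct, so the sum over
    contents has two separate terms, those with F and those with G.\<close>
  have "{#kB#} \<noteq> {#kA#}" by simp
  then show ?thesis
    by (simp add: cB s_s_B op_contents_def comps_gdy comps_gdz mult.assoc ev_pd_commute[of _ _ \<mu>]
        add.commute[of "psi \<Phi> \<nu> * eps \<Phi> a" "tpsi \<Phi> \<nu> * fA \<Phi> a" for \<nu> a])
next
  case (cEps a)
  then show ?thesis by (simp add: s_s_A op_contents_def)
next
  case (cPsi \<mu>)
  then show ?thesis by (simp add: s_s_B op_contents_def comps_gdz mult.assoc ev_pd_commute[of _ _ \<mu>])
next
  case (cTpsi \<mu>)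
  then show ?thesis by (simp add: s_s_B op_contents_def)
qed

end

section \<open>Expansion of the AKSZ Lagrangian\<close>

lemma sum_comp:
  fixes f :: "('m::finite, 'a::finite) comp \<Rightarrow> 'b::comm_monoid_add"
  shows "(\<Sum>\<phi>\<in>UNIV. f \<phi>) = (\<Sum>\<mu>\<in>UNIV. f (cX \<mu>)) + (\<Sum>a\<in>UNIV. f (cA a)) + (\<Sum>\<mu>\<in>UNIV. f (cB \<mu>))
    + (\<Sum>a\<in>UNIV. f (cEps a)) + (\<Sum>\<mu>\<in>UNIV. f (cPsi \<mu>)) + (\<Sum>\<mu>\<in>UNIV. f (cTpsi \<mu>))"
proof -
  have U: "(UNIV :: ('m, 'a) comp set) =
      range cX \<union> (range cA \<union> (range cB \<union> (range cEps \<union> (range cPsi \<union> range cTpsi))))"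
  proof (intro set_eqI iffI UNIV_I)
    fix x :: "('m, 'a) comp"
    show "x \<in> range cX \<union> (range cA \<union> (range cB \<union> (range cEps \<union> (range cPsi \<union> range cTpsi))))"
      by (cases x) simp_all
  qed
  have "sum f (UNIV :: ('m, 'a) comp set) = sum f (range cX) + (sum f (range cA) + (sum f (range cB)
      + (sum f (range cEps) + (sum f (range cPsi) + sum f (range cTpsi)))))"
    unfolding U by (subst sum.union_disjoint, simp, simp, blast)+ (rule refl)
  then show ?thesis
    by (simp add: sum.reindex inj_def add.assoc)
qed

section \<open>Symmetry factors\<close>

lemma beta_1: "beta 1 {#k#} = 1"
proof -
  have "{(k', M). M \<in> op_contents 1 k' \<and> add_mset k' M = {#k#}} = {(k, {#})}"
    by (auto simp: op_contents_def)
  then show ?thesis by (simp add: beta_def)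
qed

lemma op_contents_2_cases:
  "M \<in> op_contents 2 k \<longleftrightarrow> (k, M) \<in> {(kA, {#kB#}), (kB, {#kB#}), (kB, {#kA#}), (kPsi, {#kB#})}"
  by (cases k) (auto simp: op_contents_def)

text \<open>The mixed content is reached from A with remaining content B and from B with remaining
  content A; every other content is reached once.\<close>

lemma beta_2:
  "beta 2 {#kA, kB#} = 2" "beta 2 {#kB, kB#} = 1" "beta 2 {#kPsi, kB#} = 1"
proof -
  have "{(k, M). M \<in> op_contents 2 k \<and> add_mset k M = {#kA, kB#}} = {(kA, {#kB#}), (kB, {#kA#})}"
    "{(k, M). M \<in> op_contents 2 k \<and> add_mset k M = {#kB, kB#}} = {(kB, {#kB#})}"
    "{(k, M). M \<in> op_contents 2 k \<and> add_mset k M = {#kPsi, kB#}} = {(kPsi, {#kB#})}"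
    unfolding op_contents_2_cases by (auto simp: add_eq_conv_ex)
  then show "beta 2 {#kA, kB#} = 2" "beta 2 {#kB, kB#} = 1" "beta 2 {#kPsi, kB#} = 1"
    by (simp_all add: beta_def)
qed

lemma beta_3: "beta 3 {#kB, kB, kB#} = 1"
proof -
  have "M \<in> op_contents 3 k \<longleftrightarrow> k = kB \<and> M = {#kB, kB#}" for k M
    by (cases k) (auto simp: op_contents_def)
  then have "{(k, M). M \<in> op_contents 3 k \<and> add_mset k M = {#kB, kB, kB#}} = {(kB, {#kB, kB#})}"
    by auto
  then show ?thesis by (simp add: beta_def)
qed

lemma sum_lists_length_Suc:
  fixes g :: "'m::finite list \<Rightarrow> 'b::comm_monoid_add"
  shows "(\<Sum>l | length l = Suc k. g l) = (\<Sum>\<mu>\<in>UNIV. \<Sum>l | length l = k. g (\<mu> # l))"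
proof -
  have fin: "finite {l::'m list. length l = k}" for k
    using finite_lists_length_eq[of "UNIV :: 'm set" k] by simp
  have "{l::'m list. length l = Suc k} = (\<lambda>(\<mu>, l). \<mu> # l) ` (UNIV \<times> {l. length l = k})"
    by (auto simp: length_Suc_conv)
  then have "(\<Sum>l | length l = Suc k. g l) = (\<Sum>p\<in>UNIV \<times> {l. length l = k}. g (fst p # snd p))"
    by (simp add: sum.reindex inj_on_def case_prod_unfold)
  also have "\<dots> = (\<Sum>\<mu>\<in>UNIV. \<Sum>l | length l = k. g (\<mu> # l))"
    using sum.cartesian_product[of "\<lambda>\<mu> l. g (\<mu> # l)" "{l. length l = k}" UNIV] by (simp add: case_prod_unfold)
  finally show ?thesis .
qed

section \<open>Taylor expansion of functions of the superfield X\<close>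

context courant_sigma_model
begin

lemma nilX_expand: "nilX \<Phi> \<mu> 0 = 0" "nilX \<Phi> \<mu> (Suc 0) = Bd \<Phi> \<mu>" "nilX \<Phi> \<mu> 2 = psid \<Phi> \<mu>" "nilX \<Phi> \<mu> 3 = tpsid \<Phi> \<mu>"
  by (simp_all add: nilX_def superX_def of_comps_expand)

lemmas antifield_ev_comm =
  ev_comm[OF _ antifields_bideg(1)] ev_comm[OF _ antifields_bideg(2)] ev_comm[OF _ antifields_bideg(3)]
  ev_comm[OF _ antifields_bideg(4)] ev_comm[OF _ antifields_bideg(5)] ev_comm[OF _ antifields_bideg(6)]

lemma Bd_psid: "Bd \<Phi> \<mu> * psid \<Phi> \<nu> = psid \<Phi> \<nu> * Bd \<Phi> \<mu>"
  by (rule trans[OF graded_comm[OF antifields_bideg(3) antifields_bideg(5)]]) (simp add: sg_def)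

text \<open>The minus signs with two or three factors \<open>Bd\<close> are conversion signs,
  \<open>Bd\<close> having ghost degree -1 and form degree 1. The mixed second-order term arises in
  two orders, equal because \<open>psid\<close> and \<open>Bd\<close> commute and second derivatives
  are symmetric; this cancels its 1/2.\<close>

lemma super_ev_expand:
  assumes f: "smooth_fun (patch Q) f"
  shows "super_ev \<Phi> f 0 = ev \<Phi> f"
    and "super_ev \<Phi> f (Suc 0) = (\<Sum>\<mu>\<in>UNIV. Bd \<Phi> \<mu> * ev \<Phi> (pd \<mu> f))"
    and "super_ev \<Phi> f 2 = (\<Sum>\<mu>\<in>UNIV. psid \<Phi> \<mu> * ev \<Phi> (pd \<mu> f))
      - (1/2) *\<^sub>R (\<Sum>\<mu>\<in>UNIV. \<Sum>\<kappa>\<in>UNIV. Bd \<Phi> \<mu> * (Bd \<Phi> \<kappa> * ev \<Phi> (pd \<mu> (pd \<kappa> f))))"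
    and "super_ev \<Phi> f 3 = (\<Sum>\<mu>\<in>UNIV. tpsid \<Phi> \<mu> * ev \<Phi> (pd \<mu> f))
      + (\<Sum>\<mu>\<in>UNIV. \<Sum>\<kappa>\<in>UNIV. psid \<Phi> \<mu> * (Bd \<Phi> \<kappa> * ev \<Phi> (pd \<mu> (pd \<kappa> f))))
      - (1/6) *\<^sub>R (\<Sum>\<mu>\<in>UNIV. \<Sum>\<kappa>\<in>UNIV. \<Sum>\<sigma>\<in>UNIV.
          Bd \<Phi> \<mu> * (Bd \<Phi> \<kappa> * (Bd \<Phi> \<sigma> * ev \<Phi> (pd \<mu> (pd \<kappa> (pd \<sigma> f))))))"
proof -
  have three: "{..3::nat} = {0, Suc 0, 2, 3}" by auto
  have lists: "(\<Sum>l | length l = 0. g l) = g []" "(\<Sum>l | length l = Suc 0. g l) = (\<Sum>\<mu>\<in>UNIV. g [\<mu>])"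
    "(\<Sum>l | length l = 2. g l) = (\<Sum>\<mu>\<in>UNIV. \<Sum>\<kappa>\<in>UNIV. g [\<mu>, \<kappa>])"
    "(\<Sum>l | length l = 3. g l) = (\<Sum>\<mu>\<in>UNIV. \<Sum>\<kappa>\<in>UNIV. \<Sum>\<sigma>\<in>UNIV. g [\<mu>, \<kappa>, \<sigma>])"
    for g :: "'m list \<Rightarrow> 'w"
    by (simp_all add: sum_lists_length_Suc numeral_2_eq_2 numeral_3_eq_3 del: length_0_conv) 
      (simp_all)
  have sup: "super_ev \<Phi> f n = ev \<Phi> f * nil_prod \<Phi> [] n + (\<Sum>\<mu>\<in>UNIV. ev \<Phi> (pd \<mu> f) * nil_prod \<Phi> [\<mu>] n)
    + (1/2) *\<^sub>R (\<Sum>\<mu>\<in>UNIV. \<Sum>\<kappa>\<in>UNIV. ev \<Phi> (pd \<mu> (pd \<kappa> f)) * nil_prod \<Phi> [\<mu>, \<kappa>] n)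
    + (1/6) *\<^sub>R (\<Sum>\<mu>\<in>UNIV. \<Sum>\<kappa>\<in>UNIV. \<Sum>\<sigma>\<in>UNIV.
        ev \<Phi> (pd \<mu> (pd \<kappa> (pd \<sigma> f))) * nil_prod \<Phi> [\<mu>, \<kappa>, \<sigma>] n)" for n
    unfolding super_ev_def three by (simp add: lists fact_numeral)
  note rules = sprod_expand of_comps_expand nilX_expand sg_def antifield_ev_comm f
  show "super_ev \<Phi> f 0 = ev \<Phi> f"
    by (simp add: sup rules)
  show "super_ev \<Phi> f (Suc 0) = (\<Sum>\<mu>\<in>UNIV. Bd \<Phi> \<mu> * ev \<Phi> (pd \<mu> f))"
    by (simp add: sup rules)
  show "super_ev \<Phi> f 2 = (\<Sum>\<mu>\<in>UNIV. psid \<Phi> \<mu> * ev \<Phi> (pd \<mu> f))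
      - (1/2) *\<^sub>R (\<Sum>\<mu>\<in>UNIV. \<Sum>\<kappa>\<in>UNIV. Bd \<Phi> \<mu> * (Bd \<Phi> \<kappa> * ev \<Phi> (pd \<mu> (pd \<kappa> f))))"
    by (simp add: sup rules sum_negf)
  have "(\<Sum>\<mu>\<in>UNIV. \<Sum>\<kappa>\<in>UNIV. ev \<Phi> (pd \<mu> (pd \<kappa> f)) * (psid \<Phi> \<kappa> * Bd \<Phi> \<mu>)) =
      (\<Sum>\<kappa>\<in>UNIV. \<Sum>\<mu>\<in>UNIV. ev \<Phi> (pd \<mu> (pd \<kappa> f)) * (psid \<Phi> \<kappa> * Bd \<Phi> \<mu>))"
    by (rule sum.swap)
  also have "\<dots> = (\<Sum>\<kappa>\<in>UNIV. \<Sum>\<mu>\<in>UNIV. ev \<Phi> (pd \<kappa> (pd \<mu> f)) * (psid \<Phi> \<kappa> * Bd \<Phi> \<mu>))"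
    by (intro sum.cong refl arg_cong2[of _ _ _ _ times] ev_pd_commute f)
  finally have swap: "(\<Sum>\<mu>\<in>UNIV. \<Sum>\<kappa>\<in>UNIV. ev \<Phi> (pd \<mu> (pd \<kappa> f)) * (psid \<Phi> \<kappa> * Bd \<Phi> \<mu>)) =
      (\<Sum>\<kappa>\<in>UNIV. \<Sum>\<mu>\<in>UNIV. ev \<Phi> (pd \<kappa> (pd \<mu> f)) * (psid \<Phi> \<kappa> * Bd \<Phi> \<mu>))" .
  show "super_ev \<Phi> f 3 = (\<Sum>\<mu>\<in>UNIV. tpsid \<Phi> \<mu> * ev \<Phi> (pd \<mu> f))
      + (\<Sum>\<mu>\<in>UNIV. \<Sum>\<kappa>\<in>UNIV. psid \<Phi> \<mu> * (Bd \<Phi> \<kappa> * ev \<Phi> (pd \<mu> (pd \<kappa> f))))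
      - (1/6) *\<^sub>R (\<Sum>\<mu>\<in>UNIV. \<Sum>\<kappa>\<in>UNIV. \<Sum>\<sigma>\<in>UNIV.
          Bd \<Phi> \<mu> * (Bd \<Phi> \<kappa> * (Bd \<Phi> \<sigma> * ev \<Phi> (pd \<mu> (pd \<kappa> (pd \<sigma> f))))))"
    by (simp add: sup rules Bd_psid sum_negf sum.distrib distrib_left swap scaleR_add_right mult.assoc flip: scaleR_2)
qed

lemma super_ev_antisym:
  "super_ev \<Phi> (flux Q b a c) n = - super_ev \<Phi> (flux Q a b c) n"
  "super_ev \<Phi> (flux Q a c b) n = - super_ev \<Phi> (flux Q a b c) n"
  unfolding super_ev_def
  by (subst ev_flux_pds_antisym(1)[of _ b a c] ev_flux_pds_antisym(2)[of _ a c b], simp add: sum_negf)+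

text \<open>The index type is arbitrary so that pairs of an algebroid index and a coordinate index,
  and triples of algebroid indices, are treated alike.\<close>

lemma super_ev_contract:
  fixes f :: "'i::finite \<Rightarrow> _"
  assumes f: "\<And>i. smooth_fun (patch Q) (f i)"
  shows "(\<Sum>i\<in>UNIV. super_ev \<Phi> (f i) 0 * X i) = (\<Sum>i\<in>UNIV. ev \<Phi> (f i) * X i)"
    and "(\<Sum>i\<in>UNIV. super_ev \<Phi> (f i) (Suc 0) * X i) = (\<Sum>\<mu>\<in>UNIV. Bd \<Phi> \<mu> * (\<Sum>i\<in>UNIV. ev \<Phi> (pd \<mu> (f i)) * X i))"
    and "(\<Sum>i\<in>UNIV. super_ev \<Phi> (f i) 2 * X i) = (\<Sum>\<mu>\<in>UNIV. psid \<Phi> \<mu> * (\<Sum>i\<in>UNIV. ev \<Phi> (pd \<mu> (f i)) * X i))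
      - (1/2) *\<^sub>R (\<Sum>\<mu>\<in>UNIV. \<Sum>\<kappa>\<in>UNIV. Bd \<Phi> \<mu> * (Bd \<Phi> \<kappa> * (\<Sum>i\<in>UNIV. ev \<Phi> (pd \<mu> (pd \<kappa> (f i))) * X i)))"
    and "(\<Sum>i\<in>UNIV. super_ev \<Phi> (f i) 3 * X i) = (\<Sum>\<mu>\<in>UNIV. tpsid \<Phi> \<mu> * (\<Sum>i\<in>UNIV. ev \<Phi> (pd \<mu> (f i)) * X i))
      + (\<Sum>\<mu>\<in>UNIV. \<Sum>\<kappa>\<in>UNIV. psid \<Phi> \<mu> * (Bd \<Phi> \<kappa> * (\<Sum>i\<in>UNIV. ev \<Phi> (pd \<mu> (pd \<kappa> (f i))) * X i)))
      - (1/6) *\<^sub>R (\<Sum>\<mu>\<in>UNIV. \<Sum>\<kappa>\<in>UNIV. \<Sum>\<sigma>\<in>UNIV.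
          Bd \<Phi> \<mu> * (Bd \<Phi> \<kappa> * (Bd \<Phi> \<sigma> * (\<Sum>i\<in>UNIV. ev \<Phi> (pd \<mu> (pd \<kappa> (pd \<sigma> (f i)))) * X i))))"
proof -
  have out1: "(\<Sum>i\<in>UNIV. \<Sum>\<mu>\<in>(UNIV::'m set). G i \<mu>) = (\<Sum>\<mu>\<in>UNIV. \<Sum>i\<in>UNIV. G i \<mu>)" for G :: "'i \<Rightarrow> 'm \<Rightarrow> 'w"
    by (rule sum.swap)
  have out2: "(\<Sum>i\<in>UNIV. \<Sum>\<mu>\<in>(UNIV::'m set). \<Sum>\<kappa>\<in>(UNIV::'m set). G i \<mu> \<kappa>) = (\<Sum>\<mu>\<in>UNIV. \<Sum>\<kappa>\<in>UNIV. \<Sum>i\<in>UNIV. G i \<mu> \<kappa>)"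
    for G :: "'i \<Rightarrow> 'm \<Rightarrow> 'm \<Rightarrow> 'w"
    unfolding out1[of "\<lambda>i \<mu>. \<Sum>\<kappa>\<in>UNIV. G i \<mu> \<kappa>"] by (rule sum.cong[OF refl]) (rule out1)
  have out3: "(\<Sum>i\<in>UNIV. \<Sum>\<mu>\<in>(UNIV::'m set). \<Sum>\<kappa>\<in>(UNIV::'m set). \<Sum>\<sigma>\<in>(UNIV::'m set). G i \<mu> \<kappa> \<sigma>)
      = (\<Sum>\<mu>\<in>UNIV. \<Sum>\<kappa>\<in>UNIV. \<Sum>\<sigma>\<in>UNIV. \<Sum>i\<in>UNIV. G i \<mu> \<kappa> \<sigma>)"
    for G :: "'i \<Rightarrow> 'm \<Rightarrow> 'm \<Rightarrow> 'm \<Rightarrow> 'w"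
    unfolding out1[of "\<lambda>i \<mu>. \<Sum>\<kappa>\<in>UNIV. \<Sum>\<sigma>\<in>UNIV. G i \<mu> \<kappa> \<sigma>"] by (rule sum.cong[OF refl]) (rule out2)
  note e = super_ev_expand[OF f]
  show "(\<Sum>i\<in>UNIV. super_ev \<Phi> (f i) 0 * X i) = (\<Sum>i\<in>UNIV. ev \<Phi> (f i) * X i)"
    by (simp add: e)
  show "(\<Sum>i\<in>UNIV. super_ev \<Phi> (f i) (Suc 0) * X i) = (\<Sum>\<mu>\<in>UNIV. Bd \<Phi> \<mu> * (\<Sum>i\<in>UNIV. ev \<Phi> (pd \<mu> (f i)) * X i))"
    unfolding e sum_distrib_right sum_distrib_left mult.assoc by (rule out1)
  show "(\<Sum>i\<in>UNIV. super_ev \<Phi> (f i) 2 * X i) = (\<Sum>\<mu>\<in>UNIV. psid \<Phi> \<mu> * (\<Sum>i\<in>UNIV. ev \<Phi> (pd \<mu> (f i)) * X i))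
      - (1/2) *\<^sub>R (\<Sum>\<mu>\<in>UNIV. \<Sum>\<kappa>\<in>UNIV. Bd \<Phi> \<mu> * (Bd \<Phi> \<kappa> * (\<Sum>i\<in>UNIV. ev \<Phi> (pd \<mu> (pd \<kappa> (f i))) * X i)))"
    unfolding e left_diff_distrib mult_scaleR_left sum_distrib_right sum_distrib_left mult.assoc
      sum_subtractf scaleR_sum_right[symmetric]
    by (simp only: out2) (simp only: out1)
  show "(\<Sum>i\<in>UNIV. super_ev \<Phi> (f i) 3 * X i) = (\<Sum>\<mu>\<in>UNIV. tpsid \<Phi> \<mu> * (\<Sum>i\<in>UNIV. ev \<Phi> (pd \<mu> (f i)) * X i))
      + (\<Sum>\<mu>\<in>UNIV. \<Sum>\<kappa>\<in>UNIV. psid \<Phi> \<mu> * (Bd \<Phi> \<kappa> * (\<Sum>i\<in>UNIV. ev \<Phi> (pd \<mu> (pd \<kappa> (f i))) * X i)))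
      - (1/6) *\<^sub>R (\<Sum>\<mu>\<in>UNIV. \<Sum>\<kappa>\<in>UNIV. \<Sum>\<sigma>\<in>UNIV.
          Bd \<Phi> \<mu> * (Bd \<Phi> \<kappa> * (Bd \<Phi> \<sigma> * (\<Sum>i\<in>UNIV. ev \<Phi> (pd \<mu> (pd \<kappa> (pd \<sigma> (f i)))) * X i))))"
    unfolding e left_diff_distrib distrib_right mult_scaleR_left sum_distrib_right sum_distrib_left mult.assoc
      sum_subtractf sum.distrib scaleR_sum_right[symmetric]
    by (simp only: out3) (simp only: out2, simp only: out1)
qed

lemma sum_pair:
  fixes G :: "'a \<Rightarrow> 'm \<Rightarrow> 'w"
  shows "(\<Sum>a\<in>UNIV. \<Sum>\<nu>\<in>UNIV. G a \<nu>) = (\<Sum>i\<in>UNIV. G (fst i) (snd i))"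
  using sum.cartesian_product[of G UNIV UNIV] by (simp add: case_prod_unfold)

lemma sum_triple:
  fixes G :: "'a \<Rightarrow> 'a \<Rightarrow> 'a \<Rightarrow> 'w"
  shows "(\<Sum>a\<in>UNIV. \<Sum>b\<in>UNIV. \<Sum>c\<in>UNIV. G a b c) = (\<Sum>i\<in>UNIV. G (fst i) (fst (snd i)) (snd (snd i)))"
proof -
  have "(\<Sum>a\<in>UNIV. \<Sum>b\<in>UNIV. \<Sum>c\<in>UNIV. G a b c) = (\<Sum>a\<in>UNIV. \<Sum>i\<in>UNIV. G a (fst i) (snd i))"
    using sum.cartesian_product[of "G a" UNIV UNIV for a] by (simp add: case_prod_unfold)
  then show ?thesis
    using sum.cartesian_product[of "\<lambda>a i. G a (fst i) (snd i)" UNIV UNIV] by (simp add: case_prod_unfold)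
qed

definition A2 where "A2 a = (\<Sum>b\<in>UNIV. h a b *\<^sub>R Ad \<Phi> b)"
definition A3 where "A3 a = - (\<Sum>b\<in>UNIV. h a b *\<^sub>R epsd \<Phi> b)"

lemma A2_bideg: "A2 a \<in> bideg K (-1) 2" and A3_bideg: "A3 a \<in> bideg K (-2) 3"
  unfolding A2_def A3_def
  by (intro subspace_neg subspace_sum subspace_scale bideg_subspace antifields_bideg)+

lemma superA_eq: "superA Q \<Phi> a = of_comps [eps \<Phi> a, fA \<Phi> a, A2 a, A3 a]"
  by (simp add: superA_def A2_def A3_def)

text \<open>No signs appear because the conversion exponent of a factor of total degree 0 in form
  degree p is p(3 - p), up to sign, which is always even.\<close>

lemma sprod_assoc_3:
  "sprod 2 (sprod 0 r u) v 3 = r 0 * sprod 2 u v 3 + r (Suc 0) * sprod 2 u v 2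
    + r 2 * sprod 2 u v (Suc 0) + r 3 * sprod 2 u v 0"
  by (simp add: sprod_expand sg_def algebra_simps)

lemma sprod_assoc_4:
  "sprod 2 (sprod 1 (sprod 0 r u) v) w 3 =
    r 0 * sprod 1 u (sprod 1 v w) 3 + r (Suc 0) * sprod 1 u (sprod 1 v w) 2
    + r 2 * sprod 1 u (sprod 1 v w) (Suc 0) + r 3 * sprod 1 u (sprod 1 v w) 0"
  by (simp add: sprod_expand sg_def algebra_simps)

definition rsum :: "('a \<Rightarrow> 'm \<Rightarrow> 'w) \<Rightarrow> ('a \<Rightarrow> 'm \<Rightarrow> 'w) \<Rightarrow> 'w" where
  "rsum f X = (\<Sum>a\<in>UNIV. \<Sum>\<nu>\<in>UNIV. f a \<nu> * X a \<nu>)"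

definition csum :: "('a \<Rightarrow> 'a \<Rightarrow> 'a \<Rightarrow> 'w) \<Rightarrow> ('a \<Rightarrow> 'a \<Rightarrow> 'a \<Rightarrow> 'w) \<Rightarrow> 'w" where
  "csum f X = (\<Sum>a\<in>UNIV. \<Sum>b\<in>UNIV. \<Sum>c\<in>UNIV. f a b c * X a b c)"

abbreviation ev_r where "ev_r a \<nu> \<equiv> ev \<Phi> (anchor Q a \<nu>)"
abbreviation ev_dr where "ev_dr \<mu> a \<nu> \<equiv> ev \<Phi> (pd \<mu> (anchor Q a \<nu>))"
abbreviation ev_ddr where "ev_ddr \<mu> \<kappa> a \<nu> \<equiv> ev \<Phi> (pd \<mu> (pd \<kappa> (anchor Q a \<nu>)))"
abbreviation ev_dddr where "ev_dddr \<mu> \<kappa> \<sigma> a \<nu> \<equiv> ev \<Phi> (pd \<mu> (pd \<kappa> (pd \<sigma> (anchor Q a \<nu>))))"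
abbreviation ev_c where "ev_c a b c \<equiv> ev \<Phi> (flux Q a b c)"
abbreviation ev_dc where "ev_dc \<mu> a b c \<equiv> ev \<Phi> (pd \<mu> (flux Q a b c))"
abbreviation ev_ddc where "ev_ddc \<mu> \<kappa> a b c \<equiv> ev \<Phi> (pd \<mu> (pd \<kappa> (flux Q a b c)))"
abbreviation ev_dddc where "ev_dddc \<mu> \<kappa> \<sigma> a b c \<equiv> ev \<Phi> (pd \<mu> (pd \<kappa> (pd \<sigma> (flux Q a b c))))"

abbreviation "eee a b c \<equiv> eps \<Phi> a * (eps \<Phi> b * eps \<Phi> c)"
abbreviation "Aee a b c \<equiv> fA \<Phi> a * (eps \<Phi> b * eps \<Phi> c)"
abbreviation "AAe a b c \<equiv> fA \<Phi> a * (fA \<Phi> b * eps \<Phi> c)"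
abbreviation "AAA a b c \<equiv> fA \<Phi> a * (fA \<Phi> b * fA \<Phi> c)"

abbreviation sev_r where "sev_r p a \<nu> \<equiv> super_ev \<Phi> (anchor Q a \<nu>) p"
abbreviation sev_c where "sev_c p a b c \<equiv> super_ev \<Phi> (flux Q a b c) p"

lemma super_ev_contract_anchor:
  "rsum (sev_r 0) X = rsum ev_r X"
  "rsum (sev_r (Suc 0)) X = (\<Sum>\<mu>\<in>UNIV. Bd \<Phi> \<mu> * rsum (ev_dr \<mu>) X)"
  "rsum (sev_r 2) X = (\<Sum>\<mu>\<in>UNIV. psid \<Phi> \<mu> * rsum (ev_dr \<mu>) X)
    - (1/2) *\<^sub>R (\<Sum>\<mu>\<in>UNIV. \<Sum>\<kappa>\<in>UNIV. Bd \<Phi> \<mu> * (Bd \<Phi> \<kappa> * rsum (ev_ddr \<mu> \<kappa>) X))"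
  "rsum (sev_r 3) X = (\<Sum>\<mu>\<in>UNIV. tpsid \<Phi> \<mu> * rsum (ev_dr \<mu>) X)
    + (\<Sum>\<mu>\<in>UNIV. \<Sum>\<kappa>\<in>UNIV. psid \<Phi> \<mu> * (Bd \<Phi> \<kappa> * rsum (ev_ddr \<mu> \<kappa>) X))
    - (1/6) *\<^sub>R (\<Sum>\<mu>\<in>UNIV. \<Sum>\<kappa>\<in>UNIV. \<Sum>\<sigma>\<in>UNIV.
        Bd \<Phi> \<mu> * (Bd \<Phi> \<kappa> * (Bd \<Phi> \<sigma> * rsum (ev_dddr \<mu> \<kappa> \<sigma>) X)))"
  unfolding rsum_def sum_pair
  using super_ev_contract[where f = "\<lambda>i. anchor Q (fst i) (snd i)" and X = "\<lambda>i. X (fst i) (snd i)", OF anchor_smooth]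
  by simp_all

lemma super_ev_contract_flux:
  "csum (sev_c 0) X = csum ev_c X"
  "csum (sev_c (Suc 0)) X = (\<Sum>\<mu>\<in>UNIV. Bd \<Phi> \<mu> * csum (ev_dc \<mu>) X)"
  "csum (sev_c 2) X = (\<Sum>\<mu>\<in>UNIV. psid \<Phi> \<mu> * csum (ev_dc \<mu>) X)
    - (1/2) *\<^sub>R (\<Sum>\<mu>\<in>UNIV. \<Sum>\<kappa>\<in>UNIV. Bd \<Phi> \<mu> * (Bd \<Phi> \<kappa> * csum (ev_ddc \<mu> \<kappa>) X))"
  "csum (sev_c 3) X = (\<Sum>\<mu>\<in>UNIV. tpsid \<Phi> \<mu> * csum (ev_dc \<mu>) X)
    + (\<Sum>\<mu>\<in>UNIV. \<Sum>\<kappa>\<in>UNIV. psid \<Phi> \<mu> * (Bd \<Phi> \<kappa> * csum (ev_ddc \<mu> \<kappa>) X))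
    - (1/6) *\<^sub>R (\<Sum>\<mu>\<in>UNIV. \<Sum>\<kappa>\<in>UNIV. \<Sum>\<sigma>\<in>UNIV.
        Bd \<Phi> \<mu> * (Bd \<Phi> \<kappa> * (Bd \<Phi> \<sigma> * csum (ev_dddc \<mu> \<kappa> \<sigma>) X)))"
  unfolding csum_def sum_triple
  using super_ev_contract[where f = "\<lambda>i. flux Q (fst i) (fst (snd i)) (snd (snd i))"
      and X = "\<lambda>i. X (fst i) (fst (snd i)) (snd (snd i))", OF flux_smooth]
  by simp_all

lemma aksz_anchor_part:
  "(\<Sum>a\<in>UNIV. \<Sum>\<nu>\<in>UNIV. sprod 2 (sprod 0 (super_ev \<Phi> (anchor Q a \<nu>)) (superB \<Phi> \<nu>)) (superA Q \<Phi> a) 3) =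
    rsum ev_r (\<lambda>a \<nu>. tpsi \<Phi> \<nu> * A3 a + psi \<Phi> \<nu> * A2 a + fB \<Phi> \<nu> * fA \<Phi> a - Xd \<Phi> \<nu> * eps \<Phi> a)
    + (\<Sum>\<mu>\<in>UNIV. Bd \<Phi> \<mu> * rsum (ev_dr \<mu>) (\<lambda>a \<nu>. tpsi \<Phi> \<nu> * A2 a - psi \<Phi> \<nu> * fA \<Phi> a + fB \<Phi> \<nu> * eps \<Phi> a))
    + ((\<Sum>\<mu>\<in>UNIV. psid \<Phi> \<mu> * rsum (ev_dr \<mu>) (\<lambda>a \<nu>. tpsi \<Phi> \<nu> * fA \<Phi> a + psi \<Phi> \<nu> * eps \<Phi> a))
      - (1/2) *\<^sub>R (\<Sum>\<mu>\<in>UNIV. \<Sum>\<kappa>\<in>UNIV. Bd \<Phi> \<mu> * (Bd \<Phi> \<kappa> *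
          rsum (ev_ddr \<mu> \<kappa>) (\<lambda>a \<nu>. tpsi \<Phi> \<nu> * fA \<Phi> a + psi \<Phi> \<nu> * eps \<Phi> a))))
    + ((\<Sum>\<mu>\<in>UNIV. tpsid \<Phi> \<mu> * rsum (ev_dr \<mu>) (\<lambda>a \<nu>. tpsi \<Phi> \<nu> * eps \<Phi> a))
      + (\<Sum>\<mu>\<in>UNIV. \<Sum>\<kappa>\<in>UNIV. psid \<Phi> \<mu> * (Bd \<Phi> \<kappa> * rsum (ev_ddr \<mu> \<kappa>) (\<lambda>a \<nu>. tpsi \<Phi> \<nu> * eps \<Phi> a)))
      - (1/6) *\<^sub>R (\<Sum>\<mu>\<in>UNIV. \<Sum>\<kappa>\<in>UNIV. \<Sum>\<sigma>\<in>UNIV. Bd \<Phi> \<mu> * (Bd \<Phi> \<kappa> * (Bd \<Phi> \<sigma> *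
          rsum (ev_dddr \<mu> \<kappa> \<sigma>) (\<lambda>a \<nu>. tpsi \<Phi> \<nu> * eps \<Phi> a)))))"
  unfolding super_ev_contract_anchor[symmetric]
  unfolding sprod_assoc_3 sum.distrib rsum_def
  by (simp add: superA_eq superB_def sprod_expand of_comps_expand sg_def)

lemma aksz_flux_part:
  "(\<Sum>a\<in>UNIV. \<Sum>b\<in>UNIV. \<Sum>c\<in>UNIV. sprod 2 (sprod 1 (sprod 0 (super_ev \<Phi> (flux Q a b c)) (superA Q \<Phi> a))
      (superA Q \<Phi> b)) (superA Q \<Phi> c) 3) =
    (csum ev_c AAA - 6 *\<^sub>R csum ev_c (\<lambda>a b c. A2 a * (fA \<Phi> b * eps \<Phi> c))
      + 3 *\<^sub>R csum ev_c (\<lambda>a b c. A3 a * (eps \<Phi> b * eps \<Phi> c)))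
    + (3 *\<^sub>R (\<Sum>\<mu>\<in>UNIV. Bd \<Phi> \<mu> * csum (ev_dc \<mu>) AAe)
      + 3 *\<^sub>R (\<Sum>\<mu>\<in>UNIV. Bd \<Phi> \<mu> * csum (ev_dc \<mu>) (\<lambda>a b c. A2 a * (eps \<Phi> b * eps \<Phi> c))))
    + 3 *\<^sub>R ((\<Sum>\<mu>\<in>UNIV. psid \<Phi> \<mu> * csum (ev_dc \<mu>) Aee)
      - (1/2) *\<^sub>R (\<Sum>\<mu>\<in>UNIV. \<Sum>\<kappa>\<in>UNIV. Bd \<Phi> \<mu> * (Bd \<Phi> \<kappa> * csum (ev_ddc \<mu> \<kappa>) Aee)))
    + ((\<Sum>\<mu>\<in>UNIV. tpsid \<Phi> \<mu> * csum (ev_dc \<mu>) eee)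
      + (\<Sum>\<mu>\<in>UNIV. \<Sum>\<kappa>\<in>UNIV. psid \<Phi> \<mu> * (Bd \<Phi> \<kappa> * csum (ev_ddc \<mu> \<kappa>) eee))
      - (1/6) *\<^sub>R (\<Sum>\<mu>\<in>UNIV. \<Sum>\<kappa>\<in>UNIV. \<Sum>\<sigma>\<in>UNIV. Bd \<Phi> \<mu> * (Bd \<Phi> \<kappa> * (Bd \<Phi> \<sigma> * csum (ev_dddc \<mu> \<kappa> \<sigma>) eee))))"
proof -
  note cubic = cubic_contraction[where e = "eps \<Phi>" and A = "fA \<Phi>" and ?A2.0 = A2 and ?A3.0 = A3,
      OF fields_bideg(3,1) A2_bideg A3_bideg, where T = "\<lambda>a b c. super_ev \<Phi> (flux Q a b c) p" for p,
      OF super_ev_antisym]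
  show ?thesis
    unfolding super_ev_contract_flux[symmetric]
    unfolding sprod_assoc_4 sum.distrib superA_eq cubic(1) cubic(2)[unfolded One_nat_def] cubic(3,4) csum_def
    by (rule refl)
qed

lemma rsum_add: "rsum f (\<lambda>a \<nu>. X a \<nu> + Y a \<nu>) = rsum f X + rsum f Y"
  and rsum_diff: "rsum f (\<lambda>a \<nu>. X a \<nu> - Y a \<nu>) = rsum f X - rsum f Y"
  by (simp_all add: rsum_def distrib_left right_diff_distrib sum.distrib sum_subtractf)

lemma antifield_comm:
  "psi \<Phi> \<mu> * A2 a = - (A2 a * psi \<Phi> \<mu>)" "tpsi \<Phi> \<mu> * A3 a = A3 a * tpsi \<Phi> \<mu>"
  "tpsi \<Phi> \<mu> * A2 a = A2 a * tpsi \<Phi> \<mu>" "Ad \<Phi> a * Bd \<Phi> \<mu> = - (Bd \<Phi> \<mu> * Ad \<Phi> a)"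
  by (subst graded_comm[OF fields_bideg(4) A2_bideg] graded_comm[OF fields_bideg(5) A3_bideg]
      graded_comm[OF fields_bideg(5) A2_bideg] graded_comm[OF antifields_bideg(2,3)], simp add: sg_def)+

text \<open>Symmetry of eta shifts the raising of the index from the antifield to its coefficient,
  where \<open>brst\<close> and \<open>op2_part\<close> carry it.\<close>

lemma A2_sum: "(\<Sum>b\<in>UNIV. A2 b * P b) = (\<Sum>a\<in>UNIV. Ad \<Phi> a * (\<Sum>b\<in>UNIV. h a b *\<^sub>R P b))"
proof -
  have "(\<Sum>b\<in>UNIV. A2 b * P b) = (\<Sum>b\<in>UNIV. \<Sum>a\<in>UNIV. h b a *\<^sub>R (Ad \<Phi> a * P b))"
    by (simp add: A2_def sum_distrib_right)
  also have "\<dots> = (\<Sum>b\<in>UNIV. \<Sum>a\<in>UNIV. h b a *\<^sub>R (Ad \<Phi> b * P a))"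
    by (rule eta_inv_swap)
  finally show ?thesis by (simp add: sum_distrib_left)
qed

lemma A3_sum: "(\<Sum>b\<in>UNIV. A3 b * P b) = - (\<Sum>a\<in>UNIV. epsd \<Phi> a * (\<Sum>b\<in>UNIV. h a b *\<^sub>R P b))"
proof -
  have "(\<Sum>b\<in>UNIV. A3 b * P b) = - (\<Sum>b\<in>UNIV. \<Sum>a\<in>UNIV. h b a *\<^sub>R (epsd \<Phi> a * P b))"
    by (simp add: A3_def sum_distrib_right sum_negf)
  also have "(\<Sum>b\<in>UNIV. \<Sum>a\<in>UNIV. h b a *\<^sub>R (epsd \<Phi> a * P b)) = (\<Sum>b\<in>UNIV. \<Sum>a\<in>UNIV. h b a *\<^sub>R (epsd \<Phi> b * P a))"
    by (rule eta_inv_swap)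
  finally show ?thesis by (simp add: sum_distrib_left)
qed

lemma rsum_csum_collect:
  assumes f: "\<And>a \<nu>. smooth_fun (patch Q) (f a \<nu>)" and g: "\<And>a b c. smooth_fun (patch Q) (g a b c)"
    and u: "\<And>a. u a \<in> bideg K k p"
  shows "rsum (\<lambda>a \<nu>. ev \<Phi> (f a \<nu>)) (\<lambda>a \<nu>. u a * X \<nu>) + r *\<^sub>R csum (\<lambda>a b c. ev \<Phi> (g a b c)) (\<lambda>a b c. u a * (Y b * Z c)) =
    (\<Sum>a\<in>UNIV. u a * ((\<Sum>\<nu>\<in>UNIV. ev \<Phi> (f a \<nu>) * X \<nu>) + r *\<^sub>R (\<Sum>b\<in>UNIV. \<Sum>c\<in>UNIV. ev \<Phi> (g a b c) * Y b * Z c)))"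
  by (simp add: rsum_def csum_def distrib_left sum.distrib sum_distrib_left scaleR_sum_right
      ev_comm(2)[OF f u] ev_comm(2)[OF g u] mult.assoc)

lemma brst_eq:
  "brst Q K \<Phi> (cA a) = dif K (eps \<Phi> a) + (\<Sum>b\<in>UNIV. h a b *\<^sub>R ((\<Sum>\<mu>\<in>UNIV. ev_r b \<mu> * psi \<Phi> \<mu>)
    + 1 *\<^sub>R (\<Sum>c\<in>UNIV. \<Sum>d\<in>UNIV. ev_c b c d * fA \<Phi> c * eps \<Phi> d)))"
  "brst Q K \<Phi> (cB \<mu>) = - dif K (psi \<Phi> \<mu>) - rsum (ev_dr \<mu>) (\<lambda>a \<nu>. fB \<Phi> \<nu> * eps \<Phi> a - psi \<Phi> \<nu> * fA \<Phi> a)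
    - (1/2) *\<^sub>R csum (ev_dc \<mu>) AAe"
  "brst Q K \<Phi> (cPsi \<mu>) = dif K (tpsi \<Phi> \<mu>) + rsum (ev_dr \<mu>) (\<lambda>a \<nu>. tpsi \<Phi> \<nu> * fA \<Phi> a + psi \<Phi> \<nu> * eps \<Phi> a)
    + (1/2) *\<^sub>R csum (ev_dc \<mu>) Aee"
  "brst Q K \<Phi> (cTpsi \<mu>) = - rsum (ev_dr \<mu>) (\<lambda>a \<nu>. tpsi \<Phi> \<nu> * eps \<Phi> a) - (1/6) *\<^sub>R csum (ev_dc \<mu>) eee"
proof -
  show "brst Q K \<Phi> (cA a) = dif K (eps \<Phi> a) + (\<Sum>b\<in>UNIV. h a b *\<^sub>R ((\<Sum>\<mu>\<in>UNIV. ev_r b \<mu> * psi \<Phi> \<mu>)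
    + 1 *\<^sub>R (\<Sum>c\<in>UNIV. \<Sum>d\<in>UNIV. ev_c b c d * fA \<Phi> c * eps \<Phi> d)))"
    by (simp add: mult.assoc flux_up_sum scaleR_add_right sum.distrib scaleR_sum_right)
qed (simp_all add: rsum_def csum_def mult.assoc)

text \<open>The terms without Taylor factors. The differential of \<open>eps\<close> subtracted on
  the right is supplied by \<open>kinetic_A\<close>; those at levels 1 and 2 come from
  \<open>kinetic_B\<close>.\<close>

lemma level_0:
  "rsum ev_r (\<lambda>a \<nu>. tpsi \<Phi> \<nu> * A3 a + psi \<Phi> \<nu> * A2 a + fB \<Phi> \<nu> * fA \<Phi> a - Xd \<Phi> \<nu> * eps \<Phi> a)
    - csum ev_c (\<lambda>a b c. A2 a * (fA \<Phi> b * eps \<Phi> c)) + (1/2) *\<^sub>R csum ev_c (\<lambda>a b c. A3 a * (eps \<Phi> b * eps \<Phi> c)) =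
    rsum ev_r (\<lambda>a \<nu>. fB \<Phi> \<nu> * fA \<Phi> a) - (\<Sum>\<mu>\<in>UNIV. Xd \<Phi> \<mu> * brst Q K \<Phi> (cX \<mu>))
    - (\<Sum>a\<in>UNIV. Ad \<Phi> a * (brst Q K \<Phi> (cA a) - dif K (eps \<Phi> a))) + (\<Sum>a\<in>UNIV. epsd \<Phi> a * brst Q K \<Phi> (cEps a))"
proof -
  have X: "rsum ev_r (\<lambda>a \<nu>. Xd \<Phi> \<nu> * eps \<Phi> a) = (\<Sum>\<mu>\<in>UNIV. Xd \<Phi> \<mu> * brst Q K \<Phi> (cX \<mu>))"
    by (simp add: rsum_def greek_out sum_distrib_left antifield_ev_comm)
  have "rsum ev_r (\<lambda>a \<nu>. psi \<Phi> \<nu> * A2 a) = - rsum ev_r (\<lambda>a \<nu>. A2 a * psi \<Phi> \<nu>)"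
    by (simp add: rsum_def antifield_comm sum_negf)
  moreover have "(\<Sum>a\<in>UNIV. Ad \<Phi> a * (brst Q K \<Phi> (cA a) - dif K (eps \<Phi> a))) =
      rsum ev_r (\<lambda>a \<nu>. A2 a * psi \<Phi> \<nu>) + 1 *\<^sub>R csum ev_c (\<lambda>a b c. A2 a * (fA \<Phi> b * eps \<Phi> c))"
    unfolding rsum_csum_collect[OF anchor_smooth flux_smooth A2_bideg] A2_sum brst_eq(1) by simp
  moreover have "(\<Sum>a\<in>UNIV. epsd \<Phi> a * brst Q K \<Phi> (cEps a)) =
      rsum ev_r (\<lambda>a \<nu>. A3 a * tpsi \<Phi> \<nu>) + (1/2) *\<^sub>R csum ev_c (\<lambda>a b c. A3 a * (eps \<Phi> b * eps \<Phi> c))"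
    unfolding rsum_csum_collect[OF anchor_smooth flux_smooth A3_bideg] A3_sum by (simp add: sum_negf)
  ultimately show ?thesis
    unfolding rsum_add rsum_diff X by (simp add: antifield_comm)
qed

abbreviation "op2 \<equiv> op2_part Q \<Phi> (Bd \<Phi>) (\<lambda>a. - A2 a)"

lemma op2_eq:
  "op2 (cB \<mu>) {#kB#} = - (\<Sum>\<kappa>\<in>UNIV. Bd \<Phi> \<kappa> * (rsum (ev_ddr \<mu> \<kappa>) (\<lambda>a \<nu>. tpsi \<Phi> \<nu> * fA \<Phi> a + psi \<Phi> \<nu> * eps \<Phi> a)
    + (1/2) *\<^sub>R csum (ev_ddc \<mu> \<kappa>) Aee))"
  "op2 (cPsi \<mu>) {#kB#} = - (\<Sum>\<kappa>\<in>UNIV. Bd \<Phi> \<kappa> * (rsum (ev_ddr \<mu> \<kappa>) (\<lambda>a \<nu>. tpsi \<Phi> \<nu> * eps \<Phi> a)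
    + (1/6) *\<^sub>R csum (ev_ddc \<mu> \<kappa>) eee))"
  by (simp_all add: rsum_def csum_def mult.assoc add.commute[of "psi \<Phi> \<nu> * eps \<Phi> a" "tpsi \<Phi> \<nu> * fA \<Phi> a" for \<nu> a])

text \<open>Both sums equal the same expression, so half of each restores the single occurrence in
  the Lagrangian.\<close>

lemma op2_mixed:
  "(1/2) *\<^sub>R (\<Sum>a\<in>UNIV. Ad \<Phi> a * op2 (cA a) {#kB#}) + (1/2) *\<^sub>R (\<Sum>\<mu>\<in>UNIV. Bd \<Phi> \<mu> * op2 (cB \<mu>) {#kA#}) =
    (\<Sum>\<mu>\<in>UNIV. Bd \<Phi> \<mu> * (rsum (ev_dr \<mu>) (\<lambda>a \<nu>. A2 a * tpsi \<Phi> \<nu>)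
      + (1/2) *\<^sub>R csum (ev_dc \<mu>) (\<lambda>a b c. A2 a * (eps \<Phi> b * eps \<Phi> c))))"
proof -
  let ?Z = "\<lambda>\<mu> a. (\<Sum>\<nu>\<in>UNIV. ev_dr \<mu> a \<nu> * tpsi \<Phi> \<nu>)
    + (1/2) *\<^sub>R (\<Sum>b\<in>UNIV. \<Sum>c\<in>UNIV. ev_dc \<mu> a b c * eps \<Phi> b * eps \<Phi> c)"
  have 1: "(\<Sum>a\<in>UNIV. Ad \<Phi> a * op2 (cA a) {#kB#}) = (\<Sum>\<mu>\<in>UNIV. Bd \<Phi> \<mu> * (\<Sum>a\<in>UNIV. A2 a * ?Z \<mu> a))"
  proof -
    have "Ad \<Phi> a * op2 (cA a) {#kB#} = (\<Sum>b\<in>UNIV. \<Sum>\<mu>\<in>UNIV. Bd \<Phi> \<mu> * (Ad \<Phi> a * (h a b *\<^sub>R ?Z \<mu> b)))" for a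
    proof -
      \<comment> \<open>This exchange sign cancels the minus sign in \<open>op2_part\<close>; in the
        second sum it is cancelled by the sign in the image of G.\<close>
      have "Ad \<Phi> a * (Bd \<Phi> \<mu> * z) = - (Bd \<Phi> \<mu> * (Ad \<Phi> a * z))" for \<mu> z
        by (simp only: mult.assoc[symmetric] antifield_comm mult_minus_left)
      then show ?thesis by (simp add: sum_distrib_left sum_negf)
    qed
    then show ?thesis
      unfolding A2_sum by (simp add: greek_out sum_distrib_left)
  qed
  have 2: "(\<Sum>\<mu>\<in>UNIV. Bd \<Phi> \<mu> * op2 (cB \<mu>) {#kA#}) = (\<Sum>\<mu>\<in>UNIV. Bd \<Phi> \<mu> * (\<Sum>a\<in>UNIV. A2 a * ?Z \<mu> a))"
    by (simp add: sum_negf)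
  show ?thesis
    unfolding rsum_csum_collect[OF smooth_fun_pd[OF anchor_smooth] smooth_fun_pd[OF flux_smooth] A2_bideg] 1 2
    by (simp flip: scaleR_add_left)
qed

lemma level_1:
  "(\<Sum>\<mu>\<in>UNIV. Bd \<Phi> \<mu> * rsum (ev_dr \<mu>) (\<lambda>a \<nu>. tpsi \<Phi> \<nu> * A2 a - psi \<Phi> \<nu> * fA \<Phi> a + fB \<Phi> \<nu> * eps \<Phi> a))
    + (1/2) *\<^sub>R ((\<Sum>\<mu>\<in>UNIV. Bd \<Phi> \<mu> * csum (ev_dc \<mu>) AAe)
      + (\<Sum>\<mu>\<in>UNIV. Bd \<Phi> \<mu> * csum (ev_dc \<mu>) (\<lambda>a b c. A2 a * (eps \<Phi> b * eps \<Phi> c)))) =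
    - (\<Sum>\<mu>\<in>UNIV. Bd \<Phi> \<mu> * (brst Q K \<Phi> (cB \<mu>) + dif K (psi \<Phi> \<mu>)))
    + ((1/2) *\<^sub>R (\<Sum>a\<in>UNIV. Ad \<Phi> a * op2 (cA a) {#kB#}) + (1/2) *\<^sub>R (\<Sum>\<mu>\<in>UNIV. Bd \<Phi> \<mu> * op2 (cB \<mu>) {#kA#}))"
  unfolding op2_mixed brst_eq(2) rsum_add rsum_diff antifield_comm
  by (simp add: algebra_simps sum.distrib sum_subtractf sum_negf scaleR_sum_right)

lemma level_2:
  "((\<Sum>\<mu>\<in>UNIV. psid \<Phi> \<mu> * rsum (ev_dr \<mu>) (\<lambda>a \<nu>. tpsi \<Phi> \<nu> * fA \<Phi> a + psi \<Phi> \<nu> * eps \<Phi> a))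
      - (1/2) *\<^sub>R (\<Sum>\<mu>\<in>UNIV. \<Sum>\<kappa>\<in>UNIV. Bd \<Phi> \<mu> * (Bd \<Phi> \<kappa> *
          rsum (ev_ddr \<mu> \<kappa>) (\<lambda>a \<nu>. tpsi \<Phi> \<nu> * fA \<Phi> a + psi \<Phi> \<nu> * eps \<Phi> a))))
    + (1/2) *\<^sub>R ((\<Sum>\<mu>\<in>UNIV. psid \<Phi> \<mu> * csum (ev_dc \<mu>) Aee)
      - (1/2) *\<^sub>R (\<Sum>\<mu>\<in>UNIV. \<Sum>\<kappa>\<in>UNIV. Bd \<Phi> \<mu> * (Bd \<Phi> \<kappa> * csum (ev_ddc \<mu> \<kappa>) Aee))) =
    (\<Sum>\<mu>\<in>UNIV. psid \<Phi> \<mu> * (brst Q K \<Phi> (cPsi \<mu>) - dif K (tpsi \<Phi> \<mu>)))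
    + (1/2) *\<^sub>R (\<Sum>\<mu>\<in>UNIV. Bd \<Phi> \<mu> * op2 (cB \<mu>) {#kB#})"
  unfolding op2_eq brst_eq(3)
  by (simp add: distrib_left right_diff_distrib sum_distrib_left sum.distrib sum_subtractf sum_negf scaleR_sum_right scaleR_add_right
      scaleR_diff_right)

lemma op3_eq:
  "op3_part Q \<Phi> (cB \<mu>) {#kB, kB#} = (\<Sum>\<kappa>\<in>UNIV. \<Sum>\<sigma>\<in>UNIV. Bd \<Phi> \<kappa> * (Bd \<Phi> \<sigma> *
    (rsum (ev_dddr \<mu> \<kappa> \<sigma>) (\<lambda>a \<nu>. tpsi \<Phi> \<nu> * eps \<Phi> a) + (1/6) *\<^sub>R csum (ev_dddc \<mu> \<kappa> \<sigma>) eee)))"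
  by (simp add: rsum_def csum_def mult.assoc)

lemma level_3:
  "((\<Sum>\<mu>\<in>UNIV. tpsid \<Phi> \<mu> * rsum (ev_dr \<mu>) (\<lambda>a \<nu>. tpsi \<Phi> \<nu> * eps \<Phi> a))
      + (\<Sum>\<mu>\<in>UNIV. \<Sum>\<kappa>\<in>UNIV. psid \<Phi> \<mu> * (Bd \<Phi> \<kappa> * rsum (ev_ddr \<mu> \<kappa>) (\<lambda>a \<nu>. tpsi \<Phi> \<nu> * eps \<Phi> a)))
      - (1/6) *\<^sub>R (\<Sum>\<mu>\<in>UNIV. \<Sum>\<kappa>\<in>UNIV. \<Sum>\<sigma>\<in>UNIV. Bd \<Phi> \<mu> * (Bd \<Phi> \<kappa> * (Bd \<Phi> \<sigma> *
          rsum (ev_dddr \<mu> \<kappa> \<sigma>) (\<lambda>a \<nu>. tpsi \<Phi> \<nu> * eps \<Phi> a)))))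
    + (1/6) *\<^sub>R ((\<Sum>\<mu>\<in>UNIV. tpsid \<Phi> \<mu> * csum (ev_dc \<mu>) eee)
      + (\<Sum>\<mu>\<in>UNIV. \<Sum>\<kappa>\<in>UNIV. psid \<Phi> \<mu> * (Bd \<Phi> \<kappa> * csum (ev_ddc \<mu> \<kappa>) eee))
      - (1/6) *\<^sub>R (\<Sum>\<mu>\<in>UNIV. \<Sum>\<kappa>\<in>UNIV. \<Sum>\<sigma>\<in>UNIV. Bd \<Phi> \<mu> * (Bd \<Phi> \<kappa> * (Bd \<Phi> \<sigma> * csum (ev_dddc \<mu> \<kappa> \<sigma>) eee)))) =
    - (\<Sum>\<mu>\<in>UNIV. tpsid \<Phi> \<mu> * brst Q K \<Phi> (cTpsi \<mu>)) - (\<Sum>\<mu>\<in>UNIV. psid \<Phi> \<mu> * op2 (cPsi \<mu>) {#kB#})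
    - (1/6) *\<^sub>R (\<Sum>\<mu>\<in>UNIV. Bd \<Phi> \<mu> * op3_part Q \<Phi> (cB \<mu>) {#kB, kB#})"
  unfolding op2_eq op3_eq brst_eq(4)
  by (simp add: distrib_left right_diff_distrib sum_distrib_left sum.distrib sum_subtractf sum_negf scaleR_sum_right scaleR_add_right
      scaleR_diff_right)

text \<open>The Leibniz rule moves d from the antifields to the ghosts, where \<open>brst\<close>
  has it, at the cost of an exact form.\<close>

lemma kinetic_B:
  "(\<Sum>\<mu>\<in>UNIV. sprod 2 (superB \<Phi> \<mu>) (sdif K (superX \<Phi> \<mu>)) 3) = (\<Sum>\<mu>\<in>UNIV. fB \<Phi> \<mu> * dif K (fX \<Phi> \<mu>))
    - (\<Sum>\<mu>\<in>UNIV. psid \<Phi> \<mu> * dif K (tpsi \<Phi> \<mu>)) - (\<Sum>\<mu>\<in>UNIV. Bd \<Phi> \<mu> * dif K (psi \<Phi> \<mu>))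
    + dif K (\<Sum>\<mu>\<in>UNIV. tpsi \<Phi> \<mu> * psid \<Phi> \<mu> - psi \<Phi> \<mu> * Bd \<Phi> \<mu>)"
proof -
  have "sprod 2 (superB \<Phi> \<mu>) (sdif K (superX \<Phi> \<mu>)) 3 = fB \<Phi> \<mu> * dif K (fX \<Phi> \<mu>)
    - psid \<Phi> \<mu> * dif K (tpsi \<Phi> \<mu>) - Bd \<Phi> \<mu> * dif K (psi \<Phi> \<mu>)
    + dif K (tpsi \<Phi> \<mu> * psid \<Phi> \<mu> - psi \<Phi> \<mu> * Bd \<Phi> \<mu>)" for \<mu>
  proof -
    have "dif K (tpsi \<Phi> \<mu>) * psid \<Phi> \<mu> = psid \<Phi> \<mu> * dif K (tpsi \<Phi> \<mu>)"
      "dif K (psi \<Phi> \<mu>) * Bd \<Phi> \<mu> = - (Bd \<Phi> \<mu> * dif K (psi \<Phi> \<mu>))"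
      by (subst graded_comm[OF dif_bideg[OF fields_bideg(5)] antifields_bideg(5)]
          graded_comm[OF dif_bideg[OF fields_bideg(4)] antifields_bideg(3)], simp add: sg_def)+
    then show ?thesis
      by (simp add: superB_def superX_def sdif_expand sprod_expand of_comps_expand sg_def
         linear_diff[OF dif_linear] dif_mult[OF fields_bideg(5) antifields_bideg(5)]
         dif_mult[OF fields_bideg(4) antifields_bideg(3)])
  qed
  then show ?thesis
    by (simp add: sum.distrib sum_subtractf linear_sum[OF dif_linear] linear_diff[OF dif_linear])
qed

lemma eta_A2: "(\<Sum>b\<in>UNIV. (eta Q $ a $ b) *\<^sub>R A2 b) = Ad \<Phi> a"
proof -
  have "(\<Sum>b\<in>UNIV. (eta Q $ a $ b) *\<^sub>R A2 b) = (\<Sum>b\<in>UNIV. \<Sum>c\<in>UNIV. (eta Q $ a $ b * h b c) *\<^sub>R Ad \<Phi> c)"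
    by (simp add: A2_def scaleR_sum_right)
  also have "\<dots> = (\<Sum>c\<in>UNIV. \<Sum>b\<in>UNIV. (eta Q $ a $ b * h b c) *\<^sub>R Ad \<Phi> c)"
    by (rule sum.swap)
  also have "\<dots> = (\<Sum>c\<in>UNIV. (if a = c then 1 else 0) *\<^sub>R Ad \<Phi> c)"
    by (simp only: scaleR_sum_left[symmetric] eta_eta_inv)
  finally show ?thesis by (simp add: if_distrib[of "\<lambda>r. r *\<^sub>R _"] cong: if_cong)
qed

text \<open>By symmetry of eta, the terms with d on \<open>eps\<close> and on the antifield agree up
  to an exact form. The resulting 2 cancels the 1/2 of the kinetic term.\<close>

lemma kinetic_A:
  "(\<Sum>a\<in>UNIV. \<Sum>b\<in>UNIV. (eta Q $ a $ b) *\<^sub>R sprod 1 (superA Q \<Phi> a) (sdif K (superA Q \<Phi> b)) 3) =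
    (\<Sum>a\<in>UNIV. \<Sum>b\<in>UNIV. (eta Q $ a $ b) *\<^sub>R (fA \<Phi> a * dif K (fA \<Phi> b)))
    - 2 *\<^sub>R (\<Sum>a\<in>UNIV. Ad \<Phi> a * dif K (eps \<Phi> a)) - dif K (\<Sum>a\<in>UNIV. eps \<Phi> a * Ad \<Phi> a)"
proof -
  have sym: "eta Q $ a $ b = eta Q $ b $ a" for a b
    using arg_cong[OF eta_sym, of "\<lambda>M. M $ b $ a"] by (simp add: transpose_def)
  have comp: "sprod 1 (superA Q \<Phi> a) (sdif K (superA Q \<Phi> b)) 3 =
      fA \<Phi> a * dif K (fA \<Phi> b) - eps \<Phi> a * dif K (A2 b) - A2 a * dif K (eps \<Phi> b)" for a b
    by (simp add: superA_eq sdif_expand sprod_expand of_comps_expand sg_def)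
  have 1: "(\<Sum>a\<in>UNIV. \<Sum>b\<in>UNIV. (eta Q $ a $ b) *\<^sub>R (eps \<Phi> a * dif K (A2 b))) = (\<Sum>a\<in>UNIV. eps \<Phi> a * dif K (Ad \<Phi> a))"
    unfolding eta_A2[symmetric] by (simp add: linear_sum[OF dif_linear] linear_cmul[OF dif_linear] sum_distrib_left)
  have "(\<Sum>a\<in>UNIV. \<Sum>b\<in>UNIV. (eta Q $ a $ b) *\<^sub>R (A2 a * dif K (eps \<Phi> b))) =
      (\<Sum>b\<in>UNIV. \<Sum>a\<in>UNIV. (eta Q $ a $ b) *\<^sub>R (A2 a * dif K (eps \<Phi> b)))"
    by (rule sum.swap)
  also have "\<dots> = (\<Sum>b\<in>UNIV. \<Sum>a\<in>UNIV. (eta Q $ b $ a) *\<^sub>R (A2 a * dif K (eps \<Phi> b)))"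
    by (intro sum.cong refl arg_cong2[of _ _ _ _ scaleR] sym)
  also have "\<dots> = (\<Sum>b\<in>UNIV. Ad \<Phi> b * dif K (eps \<Phi> b))"
    unfolding eta_A2[symmetric] by (simp add: sum_distrib_right)
  finally have 2: "(\<Sum>a\<in>UNIV. \<Sum>b\<in>UNIV. (eta Q $ a $ b) *\<^sub>R (A2 a * dif K (eps \<Phi> b))) = (\<Sum>b\<in>UNIV. Ad \<Phi> b * dif K (eps \<Phi> b))" .
  have 3: "eps \<Phi> a * dif K (Ad \<Phi> a) = dif K (eps \<Phi> a * Ad \<Phi> a) + Ad \<Phi> a * dif K (eps \<Phi> a)" for a
  proof -
    have "dif K (eps \<Phi> a) * Ad \<Phi> a = - (Ad \<Phi> a * dif K (eps \<Phi> a))"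
      by (subst graded_comm[OF dif_bideg[OF fields_bideg(3)] antifields_bideg(2)]) (simp add: sg_def)
    then show ?thesis
      by (simp add: dif_mult[OF fields_bideg(3) antifields_bideg(2)] sg_def)
  qed
  show ?thesis
    unfolding comp scaleR_diff_right sum_subtractf 1 2 3
    by (simp add: sum.distrib linear_sum[OF dif_linear] scaleR_2)
qed

definition classical_lagrangian :: 'w where
  "classical_lagrangian =
    - (\<Sum>\<mu>\<in>UNIV. fB \<Phi> \<mu> * dif K (fX \<Phi> \<mu>))
     + (1/2) *\<^sub>R (\<Sum>a\<in>UNIV. \<Sum>b\<in>UNIV. (eta Q $ a $ b) *\<^sub>R (fA \<Phi> a * dif K (fA \<Phi> b)))
     + (\<Sum>a\<in>UNIV. \<Sum>\<mu>\<in>UNIV. ev \<Phi> (anchor Q a \<mu>) * fB \<Phi> \<mu> * fA \<Phi> a)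
     + (1 / fact 3) *\<^sub>R (\<Sum>a\<in>UNIV. \<Sum>b\<in>UNIV. \<Sum>c\<in>UNIV.
          ev \<Phi> (flux Q a b c) * fA \<Phi> a * fA \<Phi> b * fA \<Phi> c)"

text \<open>The weighted sum with its prefactors evaluated: 1/2 is 1/beta_2 for the two mixed terms
  and 1/2! for two factors \<open>Bd\<close>, and 1/6 is 1/3!.\<close>

definition antifield_lagrangian :: 'w where
  "antifield_lagrangian =
    - (\<Sum>\<mu>\<in>UNIV. Xd \<Phi> \<mu> * brst Q K \<Phi> (cX \<mu>)) - (\<Sum>a\<in>UNIV. Ad \<Phi> a * brst Q K \<Phi> (cA a))
    - (\<Sum>\<mu>\<in>UNIV. Bd \<Phi> \<mu> * brst Q K \<Phi> (cB \<mu>)) + (\<Sum>a\<in>UNIV. epsd \<Phi> a * brst Q K \<Phi> (cEps a))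
    + (\<Sum>\<mu>\<in>UNIV. psid \<Phi> \<mu> * brst Q K \<Phi> (cPsi \<mu>)) - (\<Sum>\<mu>\<in>UNIV. tpsid \<Phi> \<mu> * brst Q K \<Phi> (cTpsi \<mu>))
    + (1/2) *\<^sub>R (\<Sum>a\<in>UNIV. Ad \<Phi> a * op2 (cA a) {#kB#})
    + (1/2) *\<^sub>R (\<Sum>\<mu>\<in>UNIV. Bd \<Phi> \<mu> * op2 (cB \<mu>) {#kB#})
    + (1/2) *\<^sub>R (\<Sum>\<mu>\<in>UNIV. Bd \<Phi> \<mu> * op2 (cB \<mu>) {#kA#})
    - (\<Sum>\<mu>\<in>UNIV. psid \<Phi> \<mu> * op2 (cPsi \<mu>) {#kB#})
    - (1/6) *\<^sub>R (\<Sum>\<mu>\<in>UNIV. Bd \<Phi> \<mu> * op3_part Q \<Phi> (cB \<mu>) {#kB, kB#})"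

lemma aksz_lagrangian_eq:
  "aksz_lagrangian Q K \<Phi> 3 = classical_lagrangian + antifield_lagrangian
    - dif K ((\<Sum>\<mu>\<in>UNIV. tpsi \<Phi> \<mu> * psid \<Phi> \<mu> - psi \<Phi> \<mu> * Bd \<Phi> \<mu>) + (1/2) *\<^sub>R (\<Sum>a\<in>UNIV. eps \<Phi> a * Ad \<Phi> a))"
proof -
  define k1 k2 k3 where "k1 = (\<Sum>\<mu>\<in>UNIV. fB \<Phi> \<mu> * dif K (fX \<Phi> \<mu>))"
    and "k2 = (\<Sum>a\<in>UNIV. \<Sum>b\<in>UNIV. (eta Q $ a $ b) *\<^sub>R (fA \<Phi> a * dif K (fA \<Phi> b)))"
    and "k3 = dif K ((\<Sum>\<mu>\<in>UNIV. tpsi \<Phi> \<mu> * psid \<Phi> \<mu> - psi \<Phi> \<mu> * Bd \<Phi> \<mu>) + (1/2) *\<^sub>R (\<Sum>a\<in>UNIV. eps \<Phi> a * Ad \<Phi> a))"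
  have six: "(1 / 6) *\<^sub>R (3 *\<^sub>R x) = (1/2) *\<^sub>R x" "(1/6) *\<^sub>R (6 *\<^sub>R x) = x" for x :: 'w
    by simp_all
  have aksz: "aksz_lagrangian Q K \<Phi> 3 =
    - (\<Sum>\<mu>\<in>UNIV. sprod 2 (superB \<Phi> \<mu>) (sdif K (superX \<Phi> \<mu>)) 3)
    + (1/2) *\<^sub>R (\<Sum>a\<in>UNIV. \<Sum>b\<in>UNIV. (eta Q $ a $ b) *\<^sub>R sprod 1 (superA Q \<Phi> a) (sdif K (superA Q \<Phi> b)) 3)
    + (rsum ev_r (\<lambda>a \<nu>. fB \<Phi> \<nu> * fA \<Phi> a) + (1/6) *\<^sub>R csum ev_c AAA
      - (\<Sum>\<mu>\<in>UNIV. Xd \<Phi> \<mu> * brst Q K \<Phi> (cX \<mu>))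
      - (\<Sum>a\<in>UNIV. Ad \<Phi> a * (brst Q K \<Phi> (cA a) - dif K (eps \<Phi> a))) + (\<Sum>a\<in>UNIV. epsd \<Phi> a * brst Q K \<Phi> (cEps a)))
    + (- (\<Sum>\<mu>\<in>UNIV. Bd \<Phi> \<mu> * (brst Q K \<Phi> (cB \<mu>) + dif K (psi \<Phi> \<mu>)))
      + ((1/2) *\<^sub>R (\<Sum>a\<in>UNIV. Ad \<Phi> a * op2 (cA a) {#kB#}) + (1/2) *\<^sub>R (\<Sum>\<mu>\<in>UNIV. Bd \<Phi> \<mu> * op2 (cB \<mu>) {#kA#})))
    + ((\<Sum>\<mu>\<in>UNIV. psid \<Phi> \<mu> * (brst Q K \<Phi> (cPsi \<mu>) - dif K (tpsi \<Phi> \<mu>)))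
      + (1/2) *\<^sub>R (\<Sum>\<mu>\<in>UNIV. Bd \<Phi> \<mu> * op2 (cB \<mu>) {#kB#}))
    + (- (\<Sum>\<mu>\<in>UNIV. tpsid \<Phi> \<mu> * brst Q K \<Phi> (cTpsi \<mu>)) - (\<Sum>\<mu>\<in>UNIV. psid \<Phi> \<mu> * op2 (cPsi \<mu>) {#kB#})
      - (1/6) *\<^sub>R (\<Sum>\<mu>\<in>UNIV. Bd \<Phi> \<mu> * op3_part Q \<Phi> (cB \<mu>) {#kB, kB#}))"
    unfolding level_1[symmetric] level_2[symmetric] level_3[symmetric] aksz_lagrangian_def aksz_anchor_part aksz_flux_part
    using level_0
    by (simp add: fact_numeral scaleR_add_right scaleR_diff_right algebra_simps)
  show ?thesis
    unfolding aksz kinetic_A kinetic_B classical_lagrangian_def antifield_lagrangian_def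
    by (simp add: rsum_def csum_def mult.assoc fact_numeral scaleR_add_right scaleR_diff_right distrib_left right_diff_distrib
        sum.distrib sum_subtractf sum_negf linear_add[OF dif_linear] linear_cmul[OF dif_linear])
qed

lemma integral_exact:
  "integral\<^sub>\<Sigma> K (dif K ((\<Sum>\<mu>\<in>UNIV. tpsi \<Phi> \<mu> * psid \<Phi> \<mu> - psi \<Phi> \<mu> * Bd \<Phi> \<mu>) + (1/2) *\<^sub>R (\<Sum>a\<in>UNIV. eps \<Phi> a * Ad \<Phi> a))) = 0"
proof (rule stokes)
  have "tpsi \<Phi> \<mu> * psid \<Phi> \<mu> \<in> bideg K 0 2" "psi \<Phi> \<mu> * Bd \<Phi> \<mu> \<in> bideg K 0 2" "eps \<Phi> a * Ad \<Phi> a \<in> bideg K 0 2" for \<mu> a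
    using mult_bideg[OF fields_bideg(5) antifields_bideg(5)] mult_bideg[OF fields_bideg(4) antifields_bideg(3)]
      mult_bideg[OF fields_bideg(3) antifields_bideg(2)] by (simp_all add: numeral_2_eq_2)
  then show "(\<Sum>\<mu>\<in>UNIV. tpsi \<Phi> \<mu> * psid \<Phi> \<mu> - psi \<Phi> \<mu> * Bd \<Phi> \<mu>) + (1/2) *\<^sub>R (\<Sum>a\<in>UNIV. eps \<Phi> a * Ad \<Phi> a) \<in> bideg K 0 2"
    by (intro subspace_add subspace_sum subspace_diff subspace_scale bideg_subspace)
qed

lemma aksz_action_eq:
  "aksz_action Q K \<Phi> = classical_action Q K \<Phi>
      + (\<Sum>n=1..3. \<Sum>\<phi>\<in>UNIV. \<Sum>M\<in>op_contents n (kind_of \<phi>).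
          let N = add_mset (kind_of \<phi>) M in
          ((-1) ^ (gh (kind_of \<phi>) + n) / (real (beta_dagger_fact N) * real (beta n N)))
            *\<^sub>R integral\<^sub>\<Sigma> K (antifield \<Phi> \<phi> * op_part Q K \<Phi> n \<phi> M))" (is "_ = _ + ?rhs")
proof -
  note lin = linear_add[OF integral_linear] linear_diff[OF integral_linear] linear_cmul[OF integral_linear]
    linear_sum[OF integral_linear] linear_neg[OF integral_linear]
  have n: "{1..3::nat} = {1, 2, 3}" by auto
  have op: "op_part Q K \<Phi> 1 \<phi> {#} = brst Q K \<Phi> \<phi>" "op_part Q K \<Phi> 2 \<phi> M = op2 \<phi> M"
    "op_part Q K \<Phi> 3 \<phi> M = op3_part Q \<Phi> \<phi> M" for \<phi> M
    by (simp_all add: op_part_def A2_def)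
  have contents: "op_contents 1 k = {{#}}" "op_contents 2 kA = {{#kB#}}" "op_contents 2 kB = {{#kB#}, {#kA#}}"
    "op_contents 2 kPsi = {{#kB#}}" "op_contents 2 kX = {}" "op_contents 2 kEps = {}" "op_contents 2 kTpsi = {}"
    "op_contents 3 kB = {{#kB, kB#}}" "op_contents 3 kX = {}" "op_contents 3 kA = {}" "op_contents 3 kEps = {}"
    "op_contents 3 kPsi = {}" "op_contents 3 kTpsi = {}" for k
    by (simp_all add: op_contents_def)
  have dagger: "beta_dagger_fact {#k#} = 1" "beta_dagger_fact {#kA, kB#} = 1" "beta_dagger_fact {#kB, kB#} = 2"
    "beta_dagger_fact {#kPsi, kB#} = 1" "beta_dagger_fact {#kB, kB, kB#} = 6" for k
    by (simp_all add: beta_dagger_fact_def fact_numeral numeral_2_eq_2 numeral_3_eq_3)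
  \<comment> \<open>The mixed term reached from B has the same total content as the one reached from
    A, and the symmetry factors are evaluated for one order of writing it.\<close>
  have AB: "{#kB, kA#} = {#kA, kB#}" by (rule add_mset_commute)
  have "?rhs = integral\<^sub>\<Sigma> K antifield_lagrangian"
    unfolding n antifield_lagrangian_def Let_def
    by (simp add: sum_comp op contents beta_1 beta_2 beta_3 dagger AB lin sum_negf sum.distrib scaleR_sum_right del: One_nat_def op2_part.simps op3_part.simps brst.simps)
  moreover have "classical_action Q K \<Phi> = integral\<^sub>\<Sigma> K classical_lagrangian"
    by (simp add: classical_action_def classical_lagrangian_def)
  ultimately show ?thesis
    unfolding aksz_action_def aksz_lagrangian_eq lin integral_exact by simp
qed

end

theorem proposition4p20:
  fixes Q :: "('m::finite, 'a::finite) courant_data"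
    and K :: "('w::real_algebra_1, 'r::real_vector) form_algebra"
    and \<Phi> :: "('m, 'a, 'w) bv_fields"
  assumes "courant_algebroid_data Q"
    and "bv_field_content K (patch Q) \<Phi>"
  shows "aksz_action Q K \<Phi> = classical_action Q K \<Phi>
      + (\<Sum>n=1..3. \<Sum>\<phi>\<in>UNIV. \<Sum>M\<in>op_contents n (kind_of \<phi>).
          let N = add_mset (kind_of \<phi>) M in
          ((-1) ^ (gh (kind_of \<phi>) + n) / (real (beta_dagger_fact N) * real (beta n N)))
            *\<^sub>R integral\<^sub>\<Sigma> K (antifield \<Phi> \<phi> * op_part Q K \<Phi> n \<phi> M))
    \<and> (\<forall>s. brst_operator Q K \<Phi> s \<longrightarrow> (\<forall>\<phi>. s (s (field \<Phi> \<phi>))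
          = (\<Sum>M\<in>op_contents 2 (kind_of \<phi>). op2_part Q \<Phi> (eomF Q K \<Phi>) (eomG Q K \<Phi>) \<phi> M)))"
proof (intro conjI allI impI)
  interpret courant_sigma_model Q K \<Phi>
    using assms by (simp add: courant_sigma_model_def)
  show "aksz_action Q K \<Phi> = classical_action Q K \<Phi>
      + (\<Sum>n=1..3. \<Sum>\<phi>\<in>UNIV. \<Sum>M\<in>op_contents n (kind_of \<phi>).
          let N = add_mset (kind_of \<phi>) M in
          ((-1) ^ (gh (kind_of \<phi>) + n) / (real (beta_dagger_fact N) * real (beta n N)))
            *\<^sub>R integral\<^sub>\<Sigma> K (antifield \<Phi> \<phi> * op_part Q K \<Phi> n \<phi> M))"
    by (rule aksz_action_eq)
  fix s \<phi>
  assume s: "brst_operator Q K \<Phi> s"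
  interpret courant_brst Q K \<Phi> s
  proof (intro courant_brst.intro courant_brst_axioms.intro ghost_derivation.intro
      ghost_derivation_axioms.intro courant_sigma_model_axioms closed_3d_forms_axioms)
    show "linear s"
      using s by (simp only: brst_operator_def)
    show "\<alpha> \<in> bideg K g f \<Longrightarrow> s \<alpha> \<in> bideg K (g + 1) f" for \<alpha> g f
      using s by (simp only: brst_operator_def)
    show "\<alpha> \<in> bideg K g f \<Longrightarrow> \<beta> \<in> bideg K g' f' \<Longrightarrow>
        s (\<alpha> * \<beta>) = s \<alpha> * \<beta> + sg g *\<^sub>R (\<alpha> * s \<beta>)" for \<alpha> \<beta> g f g' f'
      using s by (simp only: brst_operator_def)
    show "\<alpha> \<in> bideg K g f \<Longrightarrow> s (dif K \<alpha>) = dif K (s \<alpha>)" for \<alpha> g f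
      using s by (simp only: brst_operator_def)
    show "smooth_fun (patch Q) h \<Longrightarrow>
        s (ev \<Phi> h) = (\<Sum>\<mu>\<in>UNIV. ev \<Phi> (pd \<mu> h) * brst Q K \<Phi> (cX \<mu>))" for h
      using s by (simp only: brst_operator_def)
    show "s (field \<Phi> \<phi>) = brst Q K \<Phi> \<phi>" for \<phi>
      using s by (simp only: brst_operator_def)
  qed
  show "s (s (field \<Phi> \<phi>)) =
      (\<Sum>M\<in>op_contents 2 (kind_of \<phi>). op2_part Q \<Phi> (eomF Q K \<Phi>) (eomG Q K \<Phi>) \<phi> M)"
    by (rule s_s_field)
qed

end
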